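(* Let $V:\mathbb{T}=\mathbb{R}/\mathbb{Z}\to\mathbb{R}$ be Lipschitz, $\alpha\in\mathbb{R}\setminus\mathbb{Q}$, $\theta\in\mathbb{T}$, and let $H=H_{\theta,\alpha,V}$ be the operator on $\ell^2(\mathbb{Z})$ given by $(Hu)_n=u_{n+1}+u_{n-1}+V(\theta+n\alpha)u_n$. Let $S_0=\{E:L(E)=0\}$, where $L(E)$ is the Lyapunov exponent. Then the quantum dynamics of $H$ is quasiballistic 1. for any $\alpha$ with $\beta(\alpha)>0$, if $S_0\neq\emptyset$; 2. for any $\alpha$ with $\beta(\alpha)=\infty$, otherwise (i.e. if $S_0=\emptyset$).
   Context: Lyapunov exponent: with $A(\theta,E)=\begin{pmatrix}E-V(\theta)&-1\\1&0\end{pmatrix}$ and $A_n(\theta,E)=A(\theta+n\alpha,E)\cdots A(\theta+\alpha,E)$, $L(E)=\lim_{n\to\infty}\frac1n\int_{\mathbb{T}}\log\|A_n(\theta,E)\|\,d\theta$. $\beta(\alpha)=\limsup_n\frac{\log q_{n+1}}{q_n}\in[0,\infty]$, where $p_n/q_n$ are the continued fraction approximants of $\alpha$. For $p>0$ and $T>0$ define $\langle|X|^p_{\delta_0}\rangle(T)=\frac2T\int_0^\infty e^{-2t/T}\sum_{n}|n|^p|\langle e^{-itH}\delta_0,\delta_n\rangle|^2\,dt$, and the upper dynamical exponent $\beta^+_{\delta_0}(p)=\limsup_{T\to\infty}\frac{\log\langle|X|^p_{\delta_0}\rangle(T)}{p\log T}$. The quantum dynamics is quasiballistic if $\beta^+_{\delta_0}(p)=1$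 for all $p>0$. *)

theory Defs
  imports "HOL-Analysis.Analysis"
begin

definition l2_summable :: "(int \<Rightarrow> complex) \<Rightarrow> bool" where
  "l2_summable u \<longleftrightarrow> (\<lambda>n. (cmod (u n))\<^sup>2) summable_on UNIV"

typedef l2Z = "{u. l2_summable u}"
  morphisms l2_coord Abs_l2Z
  by (rule exI[of _ "\<lambda>_. 0"]) (simp add: l2_summable_def)

setup_lifting type_definition_l2Z

lemma l2_summable_add:
  assumes "l2_summable u" "l2_summable v"
  shows "l2_summable (\<lambda>n. u n + v n)"
proof -
  have "(\<lambda>n. 2 * (cmod (u n))\<^sup>2 + 2 * (cmod (v n))\<^sup>2) summable_on UNIV"
    using assms unfolding l2_summable_def
    by (intro summable_on_add summable_on_cmult_right)
  moreover have "(cmod (u n + v n))\<^sup>2 \<le> 2 * (cmod (u n))\<^sup>2 + 2 * (cmod (v n))\<^sup>2" for n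
  proof -
    have "(cmod (u n + v n))\<^sup>2 \<le> (cmod (u n) + cmod (v n))\<^sup>2"
      by (intro power_mono norm_triangle_ineq) auto
    also have "\<dots> \<le> 2 * (cmod (u n))\<^sup>2 + 2 * (cmod (v n))\<^sup>2"
      using sum_squares_bound[of "cmod (u n)" "cmod (v n)"] by (simp add: power2_sum)
    finally show ?thesis .
  qed
  ultimately show ?thesis
    unfolding l2_summable_def by (rule summable_on_comparison_test) auto
qed

lemma l2_summable_bounded_mult:
  assumes u: "l2_summable u" and c: "\<And>n. cmod (c n) \<le> B"
  shows "l2_summable (\<lambda>n. c n * u n)"
proof -
  have "(\<lambda>n. B\<^sup>2 * (cmod (u n))\<^sup>2) summable_on UNIV"
    using u unfolding l2_summable_def by (rule summable_on_cmult_right)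
  moreover have "(cmod (c n * u n))\<^sup>2 \<le> B\<^sup>2 * (cmod (u n))\<^sup>2" for n
    using c[of n] by (simp add: norm_mult power_mult_distrib mult_right_mono power_mono)
  ultimately show ?thesis
    unfolding l2_summable_def by (rule summable_on_comparison_test) auto
qed

lemma l2_summable_cmult: "l2_summable u \<Longrightarrow> l2_summable (\<lambda>n. c * u n)"
  by (rule l2_summable_bounded_mult[where B = "cmod c"]) auto

lemma l2_summable_diff:
  assumes "l2_summable u" "l2_summable v"
  shows "l2_summable (\<lambda>n. u n - v n)"
  using l2_summable_add[OF assms(1) l2_summable_cmult[OF assms(2), of "-1"]] by simp

lemma bij_int_shift: "bij (\<lambda>n. n + k :: int)"
  by (rule o_bij[where g = "\<lambda>n. n - k"]) auto

lemma l2_summable_shift: "l2_summable u \<Longrightarrow> l2_summable (\<lambda>n. u (n + k))"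
  unfolding l2_summable_def
  using summable_on_reindex_bij_betw[OF bij_int_shift, of "\<lambda>n. (cmod (u n))\<^sup>2"] by simp

lemma l2_mult_abs_summable:
  assumes "l2_summable u" "l2_summable v"
  shows "(\<lambda>n. cmod (u n) * cmod (v n)) summable_on UNIV"
proof -
  have "(\<lambda>n. (cmod (u n))\<^sup>2 + (cmod (v n))\<^sup>2) summable_on UNIV"
    using assms unfolding l2_summable_def by (rule summable_on_add)
  moreover have "cmod (u n) * cmod (v n) \<le> (cmod (u n))\<^sup>2 + (cmod (v n))\<^sup>2" for n
    using sum_squares_bound[of "cmod (u n)" "cmod (v n)"]
      mult_nonneg_nonneg[OF norm_ge_zero norm_ge_zero, of "u n" "v n"] by linarith
  ultimately show ?thesis by (rule summable_on_comparison_test) auto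
qed

lemma l2_inner_summable:
  assumes "l2_summable u" "l2_summable v"
  shows "(\<lambda>n. u n \<bullet> v n) summable_on UNIV"
proof (rule abs_summable_summable)
  show "(\<lambda>n. norm (u n \<bullet> v n)) summable_on UNIV"
    using l2_mult_abs_summable[OF assms]
    by (rule summable_on_comparison_test) (auto simp: Cauchy_Schwarz_ineq2)
qed

lemma l2_coord_summable: "l2_summable (l2_coord u)"
  using l2_coord[of u] by simp

text \<open>
  The library has no class of complex normed spaces, so \<open>l2Z\<close> is made a real Hilbert space
  with the real part of its Hermitian product; complex scalars are handled by \<open>cscale\<close>,
  and \<open>l2_herm\<close> is the Hermitian product itself.
\<close>

instantiation l2Z :: real_inner
begin

lift_definition zero_l2Z :: l2Z is "\<lambda>_. 0"
  by (simp add: l2_summable_def)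
lift_definition plus_l2Z :: "l2Z \<Rightarrow> l2Z \<Rightarrow> l2Z" is "\<lambda>u v n. u n + v n"
  by (rule l2_summable_add)
lift_definition minus_l2Z :: "l2Z \<Rightarrow> l2Z \<Rightarrow> l2Z" is "\<lambda>u v n. u n - v n"
  by (rule l2_summable_diff)
lift_definition uminus_l2Z :: "l2Z \<Rightarrow> l2Z" is "\<lambda>u n. - u n"
  by (simp add: l2_summable_def)
lift_definition scaleR_l2Z :: "real \<Rightarrow> l2Z \<Rightarrow> l2Z" is "\<lambda>r u n. r *\<^sub>R u n"
  by (simp add: scaleR_conv_of_real l2_summable_cmult)
lift_definition inner_l2Z :: "l2Z \<Rightarrow> l2Z \<Rightarrow> real" is "\<lambda>u v. \<Sum>\<^sub>\<infinity>n. u n \<bullet> v n" .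

definition norm_l2Z :: "l2Z \<Rightarrow> real" where "norm_l2Z u = sqrt (u \<bullet> u)"
definition dist_l2Z :: "l2Z \<Rightarrow> l2Z \<Rightarrow> real" where "dist_l2Z u v = norm (u - v)"
definition sgn_l2Z :: "l2Z \<Rightarrow> l2Z" where "sgn_l2Z u = inverse (norm u) *\<^sub>R u"
definition uniformity_l2Z :: "(l2Z \<times> l2Z) filter" where
  "uniformity_l2Z = (INF e\<in>{0<..}. principal {(x, y). dist x y < e})"
definition open_l2Z :: "l2Z set \<Rightarrow> bool" where
  "open_l2Z U \<longleftrightarrow> (\<forall>x\<in>U. \<forall>\<^sub>F (x', y) in uniformity. x' = x \<longrightarrow> y \<in> U)"

instance
proof
  fix x y z :: l2Z and a b :: real and U :: "l2Z set"
  show "dist x y = norm (x - y)" by (rule dist_l2Z_def)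
  show "sgn x = inverse (norm x) *\<^sub>R x" by (rule sgn_l2Z_def)
  show "norm x = sqrt (x \<bullet> x)" by (rule norm_l2Z_def)
  show "uniformity = (INF e\<in>{0<..}. principal {(x, y). dist (x::l2Z) y < e})"
    by (rule uniformity_l2Z_def)
  show "open U = (\<forall>x\<in>U. \<forall>\<^sub>F (x', y) in uniformity. x' = x \<longrightarrow> y \<in> U)"
    by (rule open_l2Z_def)
  show "x + y + z = x + (y + z)" by transfer (auto simp: add.assoc)
  show "x + y = y + x" by transfer (auto simp: add.commute)
  show "0 + x = x" by transfer simp
  show "- x + x = 0" by transfer simp
  show "x - y = x + - y" by transfer simp
  show "a *\<^sub>R (x + y) = a *\<^sub>R x + a *\<^sub>R y" by transfer (simp add: scaleR_add_right)
  show "(a + b) *\<^sub>R x = a *\<^sub>R x + b *\<^sub>R x" by transfer (simp add: scaleR_add_left)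
  show "a *\<^sub>R b *\<^sub>R x = (a * b) *\<^sub>R x" by transfer simp
  show "1 *\<^sub>R x = x" by transfer simp
  show "x \<bullet> y = y \<bullet> x" by transfer (simp add: inner_commute)
  show "(x + y) \<bullet> z = x \<bullet> z + y \<bullet> z"
    by transfer (simp add: inner_add_left infsum_add l2_inner_summable)
  show "a *\<^sub>R x \<bullet> y = a * (x \<bullet> y)"
    by transfer (simp add: infsum_cmult_right l2_inner_summable)
  show "0 \<le> x \<bullet> x" by transfer (auto intro: infsum_nonneg)
  show "(x \<bullet> x = 0) = (x = 0)"
  proof transfer
    fix u :: "int \<Rightarrow> complex" assume u: "l2_summable u"
    show "((\<Sum>\<^sub>\<infinity>n. u n \<bullet> u n) = 0) = (u = (\<lambda>_. 0))"
    proof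
      assume "(\<Sum>\<^sub>\<infinity>n. u n \<bullet> u n) = 0"
      then have "u n \<bullet> u n = 0" for n
        using nonneg_infsum_le_0D[of "\<lambda>n. u n \<bullet> u n" UNIV n] l2_inner_summable[OF u u] by auto
      then show "u = (\<lambda>_. 0)" by auto
    qed simp
  qed
qed

end

lemma l2_norm_sq: "(norm u)\<^sup>2 = (\<Sum>\<^sub>\<infinity>n. (cmod (l2_coord u n))\<^sup>2)"
proof -
  have "(norm u)\<^sup>2 = u \<bullet> u" by (simp add: power2_norm_eq_inner)
  then show ?thesis by (simp add: inner_l2Z.rep_eq power2_norm_eq_inner)
qed

lemma l2_finite_sum_le:
  assumes "finite F" shows "(\<Sum>n\<in>F. (cmod (l2_coord u n))\<^sup>2) \<le> (norm u)\<^sup>2"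
  unfolding l2_norm_sq
  by (rule finite_sum_le_infsum) (use assms l2_coord_summable[of u] in \<open>auto simp: l2_summable_def\<close>)

lemma l2_coord_le_norm: "cmod (l2_coord u n) \<le> norm u"
  using l2_finite_sum_le[of "{n}" u] by (simp add: power2_le_iff_abs_le)

instance l2Z :: banach
proof
  fix X :: "nat \<Rightarrow> l2Z"
  assume X: "Cauchy X"
  have cau: "Cauchy (\<lambda>m. l2_coord (X m) n)" for n
  proof (rule CauchyI)
    fix e :: real assume "e > 0"
    then obtain M where M: "\<And>m k. m \<ge> M \<Longrightarrow> k \<ge> M \<Longrightarrow> norm (X m - X k) < e"
      using CauchyD[OF X] by blast
    have "norm (l2_coord (X m) n - l2_coord (X k) n) < e" if "m \<ge> M" "k \<ge> M" for m k
      using l2_coord_le_norm[of "X m - X k" n] M[OF that] by (simp add: minus_l2Z.rep_eq)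
    then show "\<exists>M. \<forall>m\<ge>M. \<forall>k\<ge>M. norm (l2_coord (X m) n - l2_coord (X k) n) < e" by blast
  qed
  define f where "f n = lim (\<lambda>m. l2_coord (X m) n)" for n
  have f: "(\<lambda>m. l2_coord (X m) n) \<longlonglongrightarrow> f n" for n
    using cau[of n] unfolding f_def by (simp add: Cauchy_convergent convergent_LIMSEQ_iff[symmetric])
  have bound: "(\<Sum>n\<in>F. (cmod (l2_coord (X m) n - f n))\<^sup>2) \<le> e\<^sup>2"
    if M: "\<And>m k. m \<ge> M \<Longrightarrow> k \<ge> M \<Longrightarrow> norm (X m - X k) < e" and "m \<ge> M" "finite F"
    for e M m F
  proof (rule LIMSEQ_le_const2)
    show "(\<lambda>k. \<Sum>n\<in>F. (cmod (l2_coord (X m) n - l2_coord (X k) n))\<^sup>2)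
        \<longlonglongrightarrow> (\<Sum>n\<in>F. (cmod (l2_coord (X m) n - f n))\<^sup>2)"
      by (intro tendsto_intros f)
    have "(\<Sum>n\<in>F. (cmod (l2_coord (X m) n - l2_coord (X k) n))\<^sup>2) \<le> e\<^sup>2" if "k \<ge> M" for k
    proof -
      have "(\<Sum>n\<in>F. (cmod (l2_coord (X m) n - l2_coord (X k) n))\<^sup>2) \<le> (norm (X m - X k))\<^sup>2"
        using l2_finite_sum_le[OF \<open>finite F\<close>, of "X m - X k"] by (simp add: minus_l2Z.rep_eq)
      also have "\<dots> \<le> e\<^sup>2"
        using M[OF \<open>m \<ge> M\<close> that] by (intro power_mono) auto
      finally show ?thesis .
    qed
    then show "\<exists>N. \<forall>k\<ge>N. (\<Sum>n\<in>F. (cmod (l2_coord (X m) n - l2_coord (X k) n))\<^sup>2) \<le> e\<^sup>2" by blast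
  qed
  have diff: "l2_summable (\<lambda>n. l2_coord (X m) n - f n) \<and>
      (\<Sum>\<^sub>\<infinity>n. (cmod (l2_coord (X m) n - f n))\<^sup>2) \<le> e\<^sup>2"
    if M: "\<And>m k. m \<ge> M \<Longrightarrow> k \<ge> M \<Longrightarrow> norm (X m - X k) < e" and "m \<ge> M" for e M m
  proof -
    have s: "(\<lambda>n. (cmod (l2_coord (X m) n - f n))\<^sup>2) summable_on UNIV"
      by (rule nonneg_bounded_partial_sums_imp_summable_on[where C = "e\<^sup>2"])
        (auto intro!: eventually_finite_subsets_at_top_weakI bound[OF M \<open>m \<ge> M\<close>])
    moreover have "(\<Sum>\<^sub>\<infinity>n. (cmod (l2_coord (X m) n - f n))\<^sup>2) \<le> e\<^sup>2"
      using s by (rule infsum_le_finite_sums) (auto intro: bound[OF M \<open>m \<ge> M\<close>])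
    ultimately show ?thesis by (simp add: l2_summable_def)
  qed
  obtain M1 where M1: "\<And>m k. m \<ge> M1 \<Longrightarrow> k \<ge> M1 \<Longrightarrow> norm (X m - X k) < 1"
    using CauchyD[OF X, of 1] by auto
  have "l2_summable (\<lambda>n. l2_coord (X M1) n - f n)"
    using diff[OF M1 order.refl] by blast
  from l2_summable_diff[OF l2_coord_summable[of "X M1"] this] have fs: "l2_summable f"
    by simp
  define g where "g = Abs_l2Z f"
  have g: "l2_coord g = f" using fs by (simp add: g_def Abs_l2Z_inverse)
  have "X \<longlonglongrightarrow> g"
  proof (rule LIMSEQ_I)
    fix e :: real assume "e > 0"
    then obtain M where M: "\<And>m k. m \<ge> M \<Longrightarrow> k \<ge> M \<Longrightarrow> norm (X m - X k) < e / 2"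
      using CauchyD[OF X, of "e / 2"] by auto
    have "norm (X m - g) < e" if "m \<ge> M" for m
    proof -
      have "(norm (X m - g))\<^sup>2 \<le> (e / 2)\<^sup>2"
        using diff[OF M that] by (simp add: l2_norm_sq minus_l2Z.rep_eq g)
      then have "norm (X m - g) \<le> e / 2"
        using \<open>e > 0\<close> by (simp add: power2_le_iff_abs_le)
      then show ?thesis using \<open>e > 0\<close> by simp
    qed
    then show "\<exists>M. \<forall>m\<ge>M. norm (X m - g) < e" by blast
  qed
  then show "convergent X" by (auto simp: convergent_def)
qed

lift_definition l2_delta :: "int \<Rightarrow> l2Z" is "\<lambda>k n. if n = k then 1 else 0"
proof -
  fix k :: int
  have "(\<lambda>n. (cmod (if n = k then 1 else 0))\<^sup>2) summable_on {k}" by simp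
  then show "l2_summable (\<lambda>n. if n = k then 1 else 0)"
    unfolding l2_summable_def by (rule summable_on_cong_neutral[THEN iffD1, rotated -1]) auto
qed

definition l2_herm :: "l2Z \<Rightarrow> l2Z \<Rightarrow> complex" where
  "l2_herm u v = (\<Sum>\<^sub>\<infinity>n. l2_coord u n * cnj (l2_coord v n))"

lemma l2_herm_delta: "l2_herm u (l2_delta n) = l2_coord u n"
proof -
  have "l2_herm u (l2_delta n) = (\<Sum>\<^sub>\<infinity>k\<in>{n}. l2_coord u k)"
    unfolding l2_herm_def by (rule infsum_cong_neutral) (auto simp: l2_delta.rep_eq)
  then show ?thesis by simp
qed

lift_definition cscale :: "complex \<Rightarrow> l2Z \<Rightarrow> l2Z" is "\<lambda>c u n. c * u n"
  by (rule l2_summable_cmult)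

lemma norm_cscale: "norm (cscale c u) = cmod c * norm u"
proof -
  have "(norm (cscale c u))\<^sup>2 = (cmod c * norm u)\<^sup>2"
    using l2_coord_summable[of u]
    by (simp add: l2_norm_sq cscale.rep_eq norm_mult power_mult_distrib infsum_cmult_right
        l2_summable_def)
  then show ?thesis by (simp add: power2_eq_iff_nonneg)
qed

lift_definition cscale_op :: "complex \<Rightarrow> l2Z \<Rightarrow>\<^sub>L l2Z" is cscale
proof -
  fix c
  show "bounded_linear (cscale c)"
  proof (rule bounded_linear_intro[where K = "cmod c"])
    show "cscale c (x + y) = cscale c x + cscale c y" for x y
      by transfer (simp add: distrib_left)
    show "cscale c (r *\<^sub>R x) = r *\<^sub>R cscale c x" for r x
      by transfer simp
    show "norm (cscale c x) \<le> norm x * cmod c" for x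
      by (simp add: norm_cscale mult.commute)
  qed
qed

definition op_exp :: "('a::real_normed_vector \<Rightarrow>\<^sub>L 'a) \<Rightarrow> 'a \<Rightarrow>\<^sub>L 'a" where
  "op_exp A = (\<Sum>k. ((\<lambda>B. A o\<^sub>L B) ^^ k) id_blinfun /\<^sub>R fact k)"

lemma op_exp_sums:
  fixes A :: "'a::banach \<Rightarrow>\<^sub>L 'a"
  shows "(\<lambda>k. ((\<lambda>B. A o\<^sub>L B) ^^ k) id_blinfun /\<^sub>R fact k) sums op_exp A"
proof -
  have bd: "norm (((\<lambda>B. A o\<^sub>L B) ^^ k) id_blinfun) \<le> norm A ^ k" for k
  proof (induction k)
    case 0
    show ?case by (simp add: norm_blinfun_id_le)
  next
    case (Suc k)
    have "norm (((\<lambda>B. A o\<^sub>L B) ^^ Suc k) id_blinfun)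
        \<le> norm A * norm (((\<lambda>B. A o\<^sub>L B) ^^ k) id_blinfun)"
      by (simp add: norm_blinfun_compose)
    also have "\<dots> \<le> norm A * norm A ^ k"
      by (intro mult_left_mono Suc) auto
    finally show ?case by simp
  qed
  have "summable (\<lambda>k. ((\<lambda>B. A o\<^sub>L B) ^^ k) id_blinfun /\<^sub>R fact k)"
  proof (rule summable_comparison_test')
    show "summable (\<lambda>k. norm A ^ k /\<^sub>R fact k)"
      by (rule summable_exp_generic)
    show "norm (((\<lambda>B. A o\<^sub>L B) ^^ k) id_blinfun /\<^sub>R fact k) \<le> norm A ^ k /\<^sub>R fact k" for k
      using bd[of k] by (simp add: divide_inverse mult_left_mono)
  qed
  then show ?thesis unfolding op_exp_def by (rule summable_sums)
qed

text \<open>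
  Functions on the circle are represented by their lifts, i.e. by 1-periodic functions on the
  reals. Such a function is Lipschitz on the circle iff its lift is Lipschitz on the reals.
\<close>

definition lipschitz_on_circle :: "(real \<Rightarrow> real) \<Rightarrow> bool" where
  "lipschitz_on_circle V \<longleftrightarrow> (\<forall>x. V (x + 1) = V x) \<and> (\<exists>C. C-lipschitz_on UNIV V)"

text \<open>
  For a bounded potential this is a bounded operator on \<open>l2Z\<close>, see \<open>l2_coord_schroedinger\<close>;
  otherwise the value is unspecified.
\<close>

definition schroedinger :: "(real \<Rightarrow> real) \<Rightarrow> real \<Rightarrow> real \<Rightarrow> l2Z \<Rightarrow>\<^sub>L l2Z" where
  "schroedinger V \<alpha> \<theta> = Blinfun (\<lambda>u. Abs_l2Z (\<lambda>n.
     l2_coord u (n + 1) + l2_coord u (n - 1)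
       + complex_of_real (V (\<theta> + of_int n * \<alpha>)) * l2_coord u n))"

lemma lipschitz_on_circle_bounded:
  assumes "lipschitz_on_circle V"
  obtains B where "\<And>x. \<bar>V x\<bar> \<le> B"
proof -
  from assms obtain C where per: "\<And>x. V (x + 1) = V x" and lip: "C-lipschitz_on UNIV V"
    unfolding lipschitz_on_circle_def by blast
  have "continuous_on {0..1} V"
    using lipschitz_on_continuous_on[OF lip] continuous_on_subset by blast
  then have "bounded (V ` {0..1})"
    by (intro compact_imp_bounded compact_continuous_image) auto
  then obtain B where B: "\<And>x. x \<in> {0..1} \<Longrightarrow> \<bar>V x\<bar> \<le> B"
    unfolding bounded_iff by (metis image_eqI real_norm_def)
  have nat: "V (x + real k) = V x" for x k
    by (induction k) (auto simp: per add.assoc[symmetric] add.commute[of 1])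
  have int: "V (x + of_int k) = V x" for x k
  proof (cases "k \<ge> 0")
    case True
    then show ?thesis using nat[of x "Int.nat k"] by simp
  next
    case False
    then show ?thesis using nat[of "x + of_int k" "Int.nat (- k)"] by simp
  qed
  have "\<bar>V x\<bar> \<le> B" for x
  proof -
    have "V x = V (frac x)"
      using int[of "frac x" "\<lfloor>x\<rfloor>"] by (simp add: frac_def)
    then show ?thesis
      using B[of "frac x"] frac_ge_0[of x] frac_lt_1[of x] by simp
  qed
  then show thesis by (rule that)
qed

lemma l2_coord_schroedinger:
  assumes "lipschitz_on_circle V"
  shows "l2_coord (schroedinger V \<alpha> \<theta> u) n =
    l2_coord u (n + 1) + l2_coord u (n - 1)
      + complex_of_real (V (\<theta> + of_int n * \<alpha>)) * l2_coord u n"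
proof -
  obtain B where B: "\<And>x. \<bar>V x\<bar> \<le> B"
    using lipschitz_on_circle_bounded[OF assms] by blast
  define v where "v n = complex_of_real (V (\<theta> + of_int n * \<alpha>))" for n :: int
  have v: "cmod (v n) \<le> B" for n
    using B by (simp add: v_def)
  define S where "S k u = Abs_l2Z (\<lambda>n. l2_coord u (n + k))" for k u
  have S: "l2_coord (S k u) = (\<lambda>n. l2_coord u (n + k))" for k u
    unfolding S_def by (simp add: Abs_l2Z_inverse l2_summable_shift l2_coord_summable)
  have normS: "norm (S k u) = norm u" for k u
  proof -
    have "(norm (S k u))\<^sup>2 = (norm u)\<^sup>2"
      unfolding l2_norm_sq S
      using infsum_reindex_bij_betw[OF bij_int_shift, of "\<lambda>n. (cmod (l2_coord u n))\<^sup>2"] by simp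
    then show ?thesis by (simp add: power2_eq_iff_nonneg)
  qed
  define M where "M u = Abs_l2Z (\<lambda>n. v n * l2_coord u n)" for u
  have M: "l2_coord (M u) = (\<lambda>n. v n * l2_coord u n)" for u
    unfolding M_def
    by (simp add: Abs_l2Z_inverse l2_summable_bounded_mult[OF l2_coord_summable v])
  have normM: "norm (M u) \<le> norm u * B" for u
  proof -
    have s: "(\<lambda>n. (cmod (l2_coord w n))\<^sup>2) summable_on UNIV" for w
      using l2_coord_summable[of w] by (simp add: l2_summable_def)
    have "(norm (M u))\<^sup>2 \<le> (\<Sum>\<^sub>\<infinity>n. B\<^sup>2 * (cmod (l2_coord u n))\<^sup>2)"
      unfolding l2_norm_sq
    proof (rule infsum_mono)
      show "(cmod (l2_coord (M u) n))\<^sup>2 \<le> B\<^sup>2 * (cmod (l2_coord u n))\<^sup>2" for n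
        using v[of n] by (simp add: M norm_mult power_mult_distrib mult_right_mono power_mono)
    qed (auto intro: s summable_on_cmult_right)
    also have "\<dots> = (norm u * B)\<^sup>2"
      by (simp add: infsum_cmult_right s l2_norm_sq power_mult_distrib mult.commute)
    finally show ?thesis
      using order_trans[OF norm_ge_zero v] by (simp add: power2_le_iff_abs_le)
  qed
  have bS: "bounded_linear (S k)" for k
    by (rule bounded_linear_intro[where K = 1])
      (auto simp: normS l2_coord_inject[symmetric] S plus_l2Z.rep_eq scaleR_l2Z.rep_eq)
  have bM: "bounded_linear M"
    by (rule bounded_linear_intro[OF _ _ normM])
      (auto simp: l2_coord_inject[symmetric] M plus_l2Z.rep_eq scaleR_l2Z.rep_eq distrib_left)
  have eq: "Abs_l2Z (\<lambda>n. l2_coord u (n + 1) + l2_coord u (n - 1) + v n * l2_coord u n)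
      = S 1 u + S (-1) u + M u" for u
  proof -
    have "l2_coord (S 1 u + S (-1) u + M u)
        = (\<lambda>n. l2_coord u (n + 1) + l2_coord u (n - 1) + v n * l2_coord u n)"
      by (simp add: plus_l2Z.rep_eq S M)
    then show ?thesis by (metis l2_coord_inverse)
  qed
  have "schroedinger V \<alpha> \<theta> = Blinfun (\<lambda>u. S 1 u + S (-1) u + M u)"
    unfolding schroedinger_def v_def[symmetric] eq ..
  then have "schroedinger V \<alpha> \<theta> u = S 1 u + S (-1) u + M u"
    by (simp add: bounded_linear_Blinfun_apply bounded_linear_add bS bM)
  then show ?thesis by (simp add: plus_l2Z.rep_eq S M v_def)
qed

definition transfer_matrix :: "(real \<Rightarrow> real) \<Rightarrow> real \<Rightarrow> real \<Rightarrow> real^2^2" where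
  "transfer_matrix V \<theta> E = vector [vector [E - V \<theta>, -1], vector [1, 0]]"

primrec transfer_product :: "(real \<Rightarrow> real) \<Rightarrow> real \<Rightarrow> nat \<Rightarrow> real \<Rightarrow> real \<Rightarrow> real^2^2" where
  "transfer_product V \<alpha> 0 \<theta> E = mat 1"
| "transfer_product V \<alpha> (Suc n) \<theta> E =
     transfer_matrix V (\<theta> + real (Suc n) * \<alpha>) E ** transfer_product V \<alpha> n \<theta> E"

text \<open>
  By subadditivity the limit always exists. The matrix norm is the Euclidean operator norm.
\<close>

definition lyapunov :: "(real \<Rightarrow> real) \<Rightarrow> real \<Rightarrow> real \<Rightarrow> real" where
  "lyapunov V \<alpha> E =
     lim (\<lambda>n. (LBINT \<theta>:{0..1}. ln (onorm ((*v) (transfer_product V \<alpha> n \<theta> E)))) / real n)"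

definition zero_lyapunov_set :: "(real \<Rightarrow> real) \<Rightarrow> real \<Rightarrow> real set" where
  "zero_lyapunov_set V \<alpha> = {E. lyapunov V \<alpha> E = 0}"

text \<open>
  For irrational \<open>\<alpha>\<close> the complete quotients never become integers, so the expansion
  \<open>[a\<^sub>0; a\<^sub>1, a\<^sub>2, \<dots>]\<close> with partial quotients \<open>cf_coeff \<alpha> n\<close> is infinite and \<open>cf_denom \<alpha> n\<close>
  is the denominator \<open>q\<^sub>n\<close> of its \<open>n\<close>-th convergent in lowest terms.
\<close>

primrec cf_quotient :: "real \<Rightarrow> nat \<Rightarrow> real" where
  "cf_quotient \<alpha> 0 = \<alpha>"
| "cf_quotient \<alpha> (Suc n) = 1 / frac (cf_quotient \<alpha> n)"

definition cf_coeff :: "real \<Rightarrow> nat \<Rightarrow> int" where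
  "cf_coeff \<alpha> n = \<lfloor>cf_quotient \<alpha> n\<rfloor>"

fun cf_denom :: "real \<Rightarrow> nat \<Rightarrow> int" where
  "cf_denom \<alpha> 0 = 1"
| "cf_denom \<alpha> (Suc 0) = cf_coeff \<alpha> 1"
| "cf_denom \<alpha> (Suc (Suc n)) = cf_coeff \<alpha> (Suc (Suc n)) * cf_denom \<alpha> (Suc n) + cf_denom \<alpha> n"

definition cf_beta :: "real \<Rightarrow> ereal" where
  "cf_beta \<alpha> = limsup (\<lambda>n. ereal (ln (of_int (cf_denom \<alpha> (Suc n))) / of_int (cf_denom \<alpha> n)))"

definition propagator :: "(l2Z \<Rightarrow>\<^sub>L l2Z) \<Rightarrow> real \<Rightarrow> l2Z \<Rightarrow>\<^sub>L l2Z" where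
  "propagator H t = op_exp (cscale_op (- \<i> * complex_of_real t) o\<^sub>L H)"

text \<open>
  For bounded \<open>H\<close> of finite range the sum and the integral converge, so the default value 0 for
  divergent ones never enters; the term \<open>n = 0\<close> vanishes since \<open>0 powr p = 0\<close>.
\<close>

definition position_moment :: "(l2Z \<Rightarrow>\<^sub>L l2Z) \<Rightarrow> real \<Rightarrow> real \<Rightarrow> real" where
  "position_moment H p T = 2 / T *
     (LBINT t:{0..}. exp (- 2 * t / T) *
       (\<Sum>\<^sub>\<infinity>n. \<bar>real_of_int n\<bar> powr p * (cmod (l2_herm (propagator H t (l2_delta 0)) (l2_delta n)))\<^sup>2))"

definition upper_dynamical_exponent :: "(l2Z \<Rightarrow>\<^sub>L l2Z) \<Rightarrow> real \<Rightarrow> ereal" where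
  "upper_dynamical_exponent H p =
     Limsup at_top (\<lambda>T. ereal (ln (position_moment H p T) / (p * ln T)))"

definition quasiballistic :: "(l2Z \<Rightarrow>\<^sub>L l2Z) \<Rightarrow> bool" where
  "quasiballistic H \<longleftrightarrow> (\<forall>p>0. upper_dynamical_exponent H p = 1)"

end

theory Submission
  imports Defs "HOL-Real_Asymp.Real_Asymp" "HOL-Computational_Algebra.Fundamental_Theorem_Algebra"
begin

text \<open>
  Finite range makes faster than ballistic motion impossible, so only the lower bound carries
  content: there must be arbitrarily large times \<open>T\<close> at which a part \<open>T powr - o(1)\<close> of the
  time-averaged mass sits beyond distance \<open>T powr (1 - o(1))\<close>.

  Truncate the time evolution, damp it by \<open>exp (- t / T)\<close> and take its Fourier transform at the
  energy \<open>E\<close>: the result solves the resolvent equation at \<open>E + i / T\<close> with a unit source at the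
  origin. The source keeps it from being small next to the origin, and a solution of a second order
  recurrence cannot decay faster than the transfer matrices grow (\<open>solution_lower_bound\<close>).
  Bessel's inequality in the energy then turns bounds on the transfer matrices, valid for an
  interval of energies, into mass at large distance (\<open>averaged_moment_lower_bound\<close>).

  Such bounds come from periodic approximation. Let \<open>p / q\<close> be a convergent of \<open>\<alpha>\<close> and \<open>q'\<close> the next
  denominator. Up to distances slightly below \<open>sqrt q'\<close> the potential is so close to a \<open>q\<close>-periodic one that
  the transfer matrices do not see the difference. Let \<open>B\<close> bound the transfer matrices over at most one
  period at a zero \<open>E1\<close> of the trace of the one-period matrix (the discriminant). On an interval around
  \<open>E1\<close> whose length is polynomially small in \<open>B\<close>, the discriminant stays in \<open>[- 1, 1]\<close>, powers of the
  one-period matrix stay bounded, and all transfer matrices are bounded by a power of \<open>B\<close>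
  (\<open>norm_window_near_discriminant_zero\<close>). Every loss in the argument is polynomial in \<open>B\<close>. If
  \<open>B\<close> is \<open>exp (\<gamma> q)\<close> while \<open>q' \<ge> exp (\<kappa> q)\<close> with \<open>\<kappa>\<close> much larger than \<open>\<gamma>\<close>, then \<open>B\<close> is a small power of
  \<open>T = sqrt q'\<close> and the motion is nearly ballistic at time \<open>T\<close>.

  For \<open>\<beta>(\<alpha>) = \<infinity>\<close> the rate \<open>\<kappa>\<close> is as large as desired and the trivial \<open>\<gamma>\<close> does. If only \<open>\<beta>(\<alpha>) > 0\<close>,
  then \<open>\<gamma>\<close> must be arbitrarily small, and a zero \<open>E\<close> of the Lyapunov exponent provides that in two steps.
  First, near \<open>E\<close> all transfer matrices of the approximants over at most one period are at most
  \<open>exp (K + \<gamma> q)\<close> (\<open>subexponential_windows\<close>): by submultiplicativity their logarithm is at most an average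
  over the orbit of a fixed block, and since a rational orbit is equidistributed exactly, this
  average is a Riemann sum. Second, the discriminant has a zero near \<open>E\<close>
  (\<open>discriminant_zero_near\<close>): its zeros are real, so if all of them were at distance at least \<open>d\<close>, moving from \<open>E\<close> to
  \<open>E + i\<eta>\<close> would raise the logarithm of its modulus by at most \<open>q \<eta>\<^sup>2 / (2 d\<^sup>2)\<close>, whereas an
  imaginary part \<open>\<eta>\<close> forces growth at a rate linear in \<open>\<eta>\<close> (\<open>norm_window_grows\<close>).
\<close>

section \<open>Products of transfer matrices over windows\<close>

type_synonym cmat = "complex^2^2"

lemma cmat_eq_iff: "(A::cmat) = B \<longleftrightarrow> A$1$1 = B$1$1 \<and> A$1$2 = B$1$2 \<and> A$2$1 = B$2$1 \<and> A$2$2 = B$2$2"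
  by (auto simp: vec_eq_iff forall_2)

lemma cmat_mult_nth: "((A::cmat) ** B)$i$j = A$i$1 * B$1$j + A$i$2 * B$2$j"
  by (simp add: matrix_matrix_mult_def sum_2)

lemma cmat_vec_nth: "((A::cmat) *v x)$i = A$i$1 * x$1 + A$i$2 * x$2"
  by (simp add: matrix_vector_mult_def sum_2)

lemma norm_cvec_sq: "(norm (x::complex^2))\<^sup>2 = (cmod (x$1))\<^sup>2 + (cmod (x$2))\<^sup>2"
  by (simp add: norm_vec_def L2_set_def sum_2)

lemma norm_cmat_sq:
  "(norm (A::cmat))\<^sup>2 = (cmod (A$1$1))\<^sup>2 + (cmod (A$1$2))\<^sup>2 + (cmod (A$2$1))\<^sup>2 + (cmod (A$2$2))\<^sup>2"
proof -
  have "(norm A)\<^sup>2 = (norm (A$1))\<^sup>2 + (norm (A$2))\<^sup>2"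
    by (simp add: norm_vec_def[of A] L2_set_def sum_2)
  then show ?thesis by (simp add: norm_cvec_sq)
qed

lemma cmod_two_products:
  "(cmod (a * x + b * y))\<^sup>2 \<le> ((cmod a)\<^sup>2 + (cmod b)\<^sup>2) * ((cmod x)\<^sup>2 + (cmod y)\<^sup>2)"
proof -
  have "cmod (a * x + b * y) \<le> cmod a * cmod x + cmod b * cmod y"
    by (metis norm_mult norm_triangle_ineq)
  then have "(cmod (a * x + b * y))\<^sup>2 \<le> (cmod a * cmod x + cmod b * cmod y)\<^sup>2"
    by (rule power_mono) simp
  also have "\<dots> \<le> ((cmod a)\<^sup>2 + (cmod b)\<^sup>2) * ((cmod x)\<^sup>2 + (cmod y)\<^sup>2)"
    using zero_le_power2[of "cmod a * cmod y - cmod b * cmod x"]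
    by (simp add: power2_eq_square algebra_simps)
  finally show ?thesis .
qed

lemma norm_cmat_vec: "norm ((A::cmat) *v x) \<le> norm A * norm x"
proof (rule power2_le_imp_le)
  show "(norm (A *v x))\<^sup>2 \<le> (norm A * norm x)\<^sup>2"
    using cmod_two_products[of "A$1$1" "x$1" "A$1$2" "x$2"] cmod_two_products[of "A$2$1" "x$1" "A$2$2" "x$2"]
    by (simp add: norm_cvec_sq norm_cmat_sq cmat_vec_nth power_mult_distrib algebra_simps)
qed simp

lemma norm_cmat_mult: "norm ((A::cmat) ** (B::cmat)) \<le> norm A * norm B"
proof (rule power2_le_imp_le)
  show "(norm (A ** B))\<^sup>2 \<le> (norm A * norm B)\<^sup>2"
    using cmod_two_products[of "A$1$1" "B$1$1" "A$1$2" "B$2$1"]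
      cmod_two_products[of "A$2$1" "B$1$1" "A$2$2" "B$2$1"]
      cmod_two_products[of "A$1$1" "B$1$2" "A$1$2" "B$2$2"]
      cmod_two_products[of "A$2$1" "B$1$2" "A$2$2" "B$2$2"]
    by (simp add: norm_cmat_sq cmat_mult_nth power_mult_distrib algebra_simps)
qed simp

lemma cmod_trace_le: "cmod (trace (A::cmat)) \<le> 2 * norm A"
proof -
  have "cmod (A$i$i) \<le> norm A" for i
    using order_trans[OF Finite_Cartesian_Product.norm_nth_le Finite_Cartesian_Product.norm_nth_le] .
  from this[of 1] this[of 2] show ?thesis
    unfolding trace_def sum_2 by (smt (verit) norm_triangle_ineq)
qed

text \<open>
  The adjugate, which inverts matrices of determinant 1.
\<close>
definition adj2 :: "cmat \<Rightarrow> cmat" where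
  "adj2 A = vector [vector [A$2$2, - A$1$2], vector [- A$2$1, A$1$1]]"

lemma adj2_nth [simp]:
  "adj2 A $ 1 $ 1 = A$2$2" "adj2 A $ 1 $ 2 = - A$1$2" "adj2 A $ 2 $ 1 = - A$2$1" "adj2 A $ 2 $ 2 = A$1$1"
  by (simp_all add: adj2_def)

lemma norm_adj2 [simp]: "norm (adj2 A) = norm A"
proof -
  have "(norm (adj2 A))\<^sup>2 = (norm A)\<^sup>2" by (simp add: norm_cmat_sq)
  then show ?thesis by (simp add: power2_eq_iff_nonneg)
qed

lemma adj2_left_inverse: "det A = 1 \<Longrightarrow> adj2 A ** A = mat 1"
  and adj2_right_inverse: "det A = 1 \<Longrightarrow> A ** adj2 A = mat 1"
  by (auto simp: cmat_eq_iff cmat_mult_nth det_2 mat_def algebra_simps)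

lemma norm_ge_1_of_det_1:
  assumes "det (A::cmat) = 1" shows "1 \<le> norm A"
proof -
  have "norm (mat 1 :: cmat) \<le> norm A * norm A"
    using norm_cmat_mult[of "adj2 A" A] adj2_left_inverse[OF assms] by simp
  moreover have "(norm (mat 1 :: cmat))\<^sup>2 = 2"
    by (simp add: norm_cmat_sq mat_def)
  then have "1 \<le> norm (mat 1 :: cmat)"
    by (smt (verit) norm_ge_zero power_le_one)
  ultimately have "1 \<le> (norm A)\<^sup>2" by (simp add: power2_eq_square)
  then show ?thesis by (smt (verit) norm_ge_zero power_less_one_iff zero_less_numeral abs_square_less_1)
qed

definition step :: "complex \<Rightarrow> cmat" where
  "step a = vector [vector [a, -1], vector [1, 0]]"

lemma step_nth [simp]:
  "step a $ 1 $ 1 = a" "step a $ 1 $ 2 = -1" "step a $ 2 $ 1 = 1" "step a $ 2 $ 2 = 0"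
  by (simp_all add: step_def)

lemma det_step [simp]: "det (step a) = 1"
  by (simp add: det_2)

lemma norm_step_le:
  assumes "cmod a \<le> R" shows "norm (step a) \<le> R + 2"
proof (rule power2_le_imp_le)
  have "(cmod a)\<^sup>2 \<le> R\<^sup>2" using assms by (rule power_mono) simp
  moreover have "0 \<le> R" using assms norm_ge_zero order_trans by blast
  moreover have "(norm (step a))\<^sup>2 = (cmod a)\<^sup>2 + 2" by (simp add: norm_cmat_sq)
  moreover have "(R + 2)\<^sup>2 = R\<^sup>2 + 4 * R + 4" by (simp add: power2_sum)
  ultimately show "(norm (step a))\<^sup>2 \<le> (R + 2)\<^sup>2" by linarith
  show "0 \<le> R + 2" using \<open>0 \<le> R\<close> by simp
qed

text \<open>
  The transfer matrix that carries \<open>(u j, u (j - 1))\<close> to \<open>(u (j + n), u (j + n -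
  1))\<close> for solutions of \<open>u (i + 1) = a i * u i - u (i - 1)\<close>. Complex entries are
  allowed since \<open>a i\<close> will be \<open>z - V i\<close> with \<open>z\<close> off the real
  axis.
\<close>
primrec window :: "(int \<Rightarrow> complex) \<Rightarrow> int \<Rightarrow> nat \<Rightarrow> cmat" where
  "window a j 0 = mat 1"
| "window a j (Suc n) = step (a (j + int n)) ** window a j n"

abbreviation energies :: "(real \<Rightarrow> real) \<Rightarrow> real \<Rightarrow> real \<Rightarrow> real \<Rightarrow> int \<Rightarrow> complex" where
  "energies V \<theta> \<rho> E \<equiv> (\<lambda>i. complex_of_real (E - V (\<theta> + of_int i * \<rho>)))"

lemma det_window [simp]: "det (window a j n) = 1"
  by (induction n) (auto simp: det_mul)

lemma norm_window_ge_1: "1 \<le> norm (window a j n)"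
  by (rule norm_ge_1_of_det_1) simp

lemma window_nonzero [simp]: "window a j n \<noteq> 0"
  using norm_window_ge_1[of a j n] by auto

lemma norm_window_pos: "0 < norm (window a j n)"
  by simp

lemma window_add: "window a j (m + n) = window a (j + int m) n ** window a j m"
  by (induction n) (auto simp: matrix_mul_assoc add.assoc)

lemma window_Suc_left: "window a j (Suc n) = window a (j + 1) n ** step (a j)"
  using window_add[of a j 1 n] by simp

lemma window_cong: "(\<And>i. j \<le> i \<Longrightarrow> i < j + int n \<Longrightarrow> a i = b i) \<Longrightarrow> window a j n = window b j n"
  by (induction n) auto

lemma window_shift: "window (\<lambda>i. a (i + k)) j n = window a (j + k) n"
  by (induction n) (auto simp: algebra_simps)

lemma norm_window_le_power:
  assumes "\<And>i. cmod (a i) \<le> R"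
  shows "norm (window a j n) \<le> 2 * (R + 2) ^ n"
proof (induction n)
  case 0
  have "norm (mat 1 :: cmat) \<le> 2"
    by (rule power2_le_imp_le) (simp_all add: norm_cmat_sq mat_def)
  then show ?case by simp
next
  case (Suc n)
  have "norm (window a j (Suc n)) \<le> norm (step (a (j + int n))) * norm (window a j n)"
    by (simp add: norm_cmat_mult)
  also have "\<dots> \<le> (R + 2) * (2 * (R + 2) ^ n)"
    using norm_step_le[OF assms] order_trans[OF norm_ge_zero assms]
    by (intro mult_mono Suc) auto
  finally show ?case by simp
qed

text \<open>
  The later block can be undone at the cost of its own norm, because a matrix of determinant 1 and
  its inverse have the same Frobenius norm.
\<close>
lemma window_norm_inverse:
  "norm (window a j m) \<le> norm (window a j (m + n)) * norm (window a (j + int m) n)"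
proof -
  have "window a j m = adj2 (window a (j + int m) n) ** window a j (m + n)"
    by (simp add: window_add matrix_mul_assoc adj2_left_inverse)
  then show ?thesis
    using norm_cmat_mult[of "adj2 (window a (j + int m) n)" "window a j (m + n)"]
    by (simp add: mult.commute)
qed


lemma norm_between_steps:
  fixes A C :: cmat
  shows "norm (A ** step b ** C - A ** step a ** C) \<le> cmod (b - a) * (norm A * norm C)"
proof -
  have e: "A ** step b ** C - A ** step a ** C = A ** ((step b - step a) ** C)"
    by (simp add: cmat_eq_iff cmat_mult_nth algebra_simps)
  have "(norm (step b - step a))\<^sup>2 = (cmod (b - a))\<^sup>2" by (simp add: norm_cmat_sq)
  then have n: "norm (step b - step a) = cmod (b - a)" by (simp add: power2_eq_iff_nonneg)
  have "norm (A ** ((step b - step a) ** C)) \<le> norm A * (norm (step b - step a) * norm C)"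
    by (intro order_trans[OF norm_cmat_mult] mult_left_mono norm_cmat_mult) auto
  then show ?thesis unfolding e n by (simp add: mult_ac)
qed

text \<open>
  The steps of \<open>a\<close> are replaced by those of \<open>b\<close> one at a time, from right
  to left in the product. Keeping an arbitrary unreplaced tail of length \<open>k\<close> in front
  makes the induction close: each replacement is sandwiched between an \<open>a\<close>-window and a
  \<open>b\<close>-window, and the bound for the latter is the same statement with \<open>k =
  0\<close>.
\<close>
lemma window_perturbation_mixed:
  assumes B: "\<And>j n. lo \<le> j \<Longrightarrow> j + int n \<le> hi \<Longrightarrow> n \<le> q \<Longrightarrow> norm (window a j n) \<le> B"
    and e: "\<And>i. lo \<le> i \<Longrightarrow> i < hi \<Longrightarrow> cmod (b i - a i) \<le> e" and e0: "0 \<le> e"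
    and j: "lo \<le> j" "j + int n + int k \<le> hi" "n + k \<le> q"
  shows "norm (window a (j + int n) k ** window b j n - window a j (n + k)) \<le> B * ((1 + B * e) ^ n - 1)"
  using j
proof (induction n arbitrary: k)
  case 0
  then show ?case by simp
next
  case (Suc n)
  define W where "W = window a (j + int (Suc n)) k"
  have B1: "1 \<le> B"
    using B[of j 0] Suc.prems norm_window_ge_1[of a j 0] by (simp del: window.simps)
  have IH: "norm (window a (j + int n) (Suc k) ** window b j n - window a j (n + Suc k))
      \<le> B * ((1 + B * e) ^ n - 1)"
    using Suc.prems by (intro Suc.IH) auto
  have "norm (window b j n) \<le> norm (window b j n - window a j n) + norm (window a j n)"
    by (metis add_diff_cancel diff_add_cancel norm_triangle_ineq)
  also have "\<dots> \<le> B * ((1 + B * e) ^ n - 1) + B"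
    using Suc.IH[of 0] Suc.prems B[of j n] by (intro add_mono) auto
  finally have bn: "norm (window b j n) \<le> B * (1 + B * e) ^ n" by (simp add: algebra_simps)
  have Wn: "norm W \<le> B" unfolding W_def using Suc.prems by (intro B) auto
  have "norm (W ** step (b (j + int n)) ** window b j n - W ** step (a (j + int n)) ** window b j n)
      \<le> cmod (b (j + int n) - a (j + int n)) * (norm W * norm (window b j n))"
    by (rule norm_between_steps)
  also have "\<dots> \<le> e * (B * (B * (1 + B * e) ^ n))"
    using Suc.prems B1 e0 by (intro mult_mono e Wn bn) auto
  finally have d: "norm (W ** step (b (j + int n)) ** window b j n - W ** step (a (j + int n)) ** window b j n)
      \<le> e * (B * (B * (1 + B * e) ^ n))" .
  have a: "window a (j + int n) (Suc k) = W ** step (a (j + int n))"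
    unfolding W_def window_Suc_left by (simp add: algebra_simps)
  have "window a (j + int (Suc n)) k ** window b j (Suc n) - window a j (Suc n + k)
     = (W ** step (b (j + int n)) ** window b j n - W ** step (a (j + int n)) ** window b j n)
       + (window a (j + int n) (Suc k) ** window b j n - window a j (n + Suc k))"
    by (simp only: a add_Suc add_Suc_right window.simps(2)[of b] W_def matrix_mul_assoc)
      simp
  also have "norm \<dots> \<le> e * (B * (B * (1 + B * e) ^ n)) + B * ((1 + B * e) ^ n - 1)"
    by (intro order_trans[OF norm_triangle_ineq] add_mono d IH)
  also have "\<dots> = B * ((1 + B * e) ^ Suc n - 1)"
    by (simp add: algebra_simps)
  finally show ?case .
qed

lemma power_one_plus_minus_one_le:
  fixes x :: real
  assumes "0 \<le> x" "real n * x \<le> 1"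
  shows "(1 + x) ^ n - 1 \<le> 2 * (real n * x)"
proof -
  have "(1 + x) ^ n \<le> exp x ^ n"
    using assms(1) exp_ge_add_one_self[of x] by (intro power_mono) auto
  also have "\<dots> = exp (real n * x)" by (simp add: exp_of_nat_mult)
  also have "\<dots> \<le> 1 + real n * x + (real n * x)\<^sup>2"
    using assms by (intro exp_bound) auto
  also have "(real n * x)\<^sup>2 \<le> real n * x"
    using assms by (simp add: power2_eq_square mult_left_le)
  finally show ?thesis by linarith
qed

text \<open>
  As long as the accumulated perturbation \<open>q * B * e\<close> is at most 1, the exponential
  growth of the error in \<open>window_perturbation_mixed\<close> is still linear.
\<close>
lemma window_perturbation:
  assumes B: "\<And>j n. lo \<le> j \<Longrightarrow> j + int n \<le> hi \<Longrightarrow> n \<le> q \<Longrightarrow> norm (window a j n) \<le> B"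
    and e: "\<And>i. lo \<le> i \<Longrightarrow> i < hi \<Longrightarrow> cmod (b i - a i) \<le> e" and e0: "0 \<le> e"
    and small: "real q * (B * e) \<le> 1"
    and j: "lo \<le> j" "j + int n \<le> hi" "n \<le> q"
  shows "norm (window b j n - window a j n) \<le> 2 * real q * B\<^sup>2 * e"
    and "norm (window b j n) \<le> 3 * B"
proof -
  have B1: "1 \<le> B"
    using B[of j 0] j norm_window_ge_1[of a j 0] by (simp del: window.simps)
  have nq: "real n * (B * e) \<le> real q * (B * e)" using j B1 e0 by (intro mult_right_mono) auto
  have ns: "real n * (B * e) \<le> 1" using nq small by linarith
  have Be: "0 \<le> B * e" using B1 e0 by simp
  have "norm (window b j n - window a j n) \<le> B * ((1 + B * e) ^ n - 1)"
  proof -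
    have "norm (window a (j + int n) 0 ** window b j n - window a j (n + 0)) \<le> B * ((1 + B * e) ^ n - 1)"
      by (rule window_perturbation_mixed[where lo = lo and hi = hi and q = q]) (use B e e0 j in auto)
    then show ?thesis by simp
  qed
  also have "\<dots> \<le> B * (2 * (real n * (B * e)))"
    using B1 by (intro mult_left_mono power_one_plus_minus_one_le Be ns) auto
  also have "\<dots> \<le> B * (2 * (real q * (B * e)))"
    using B1 nq by (intro mult_left_mono) auto
  finally have 1: "norm (window b j n - window a j n) \<le> B * (2 * (real q * (B * e)))" .
  then show "norm (window b j n - window a j n) \<le> 2 * real q * B\<^sup>2 * e"
    by (simp add: power2_eq_square mult_ac)
  have "B * (2 * (real q * (B * e))) \<le> B * (2 * 1)"
    using B1 small by (intro mult_left_mono) auto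
  then have "norm (window b j n - window a j n) \<le> 2 * B" using 1 by linarith
  moreover have "norm (window b j n) \<le> norm (window b j n - window a j n) + norm (window a j n)"
    by (metis diff_add_cancel norm_triangle_ineq)
  ultimately show "norm (window b j n) \<le> 3 * B" using B[OF j] by simp
qed

section \<open>Periodic potentials with a small discriminant\<close>


text \<open>The Cayley--Hamilton identity \<open>M\<^sup>2 = (tr M) M - 1\<close>, multiplied by \<open>X\<close>.\<close>
lemma recurrence_of_det_1:
  fixes M X :: cmat
  assumes M: "det M = 1"
  shows "M ** (M ** X) = mat (trace M) ** (M ** X) - X"
proof -
  have tr: "trace M = M$1$1 + M$2$2" by (simp add: trace_def sum_2)
  have d: "M$1$1 * M$2$2 = 1 + M$1$2 * M$2$1" using M by (simp add: det_2 algebra_simps)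
  have "M ** M = mat (trace M) ** M - mat 1"
    by (simp add: cmat_eq_iff cmat_mult_nth mat_def tr algebra_simps d)
  then have "M ** (M ** X) = (mat (trace M) ** M - mat 1) ** X"
    by (simp add: matrix_mul_assoc)
  also have "\<dots> = mat (trace M) ** (M ** X) - X"
    by (simp add: cmat_eq_iff cmat_mult_nth mat_def algebra_simps)
  finally show ?thesis .
qed

text \<open>
  The quadratic form \<open>|X (k + 1)|\<^sup>2 - D \<langle>X (k + 1), X k\<rangle> + |X
  k|\<^sup>2\<close> is conserved, and for \<open>|D| \<le> 1\<close> it is definite with constants
  that do not depend on \<open>D\<close>.
\<close>
lemma bounded_chebyshev_recurrence:
  fixes X :: "nat \<Rightarrow> 'a::real_inner"
  assumes rec: "\<And>k. X (Suc (Suc k)) = D *\<^sub>R X (Suc k) - X k" and D: "\<bar>D\<bar> \<le> 1"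
  shows "(norm (X k))\<^sup>2 \<le> 3 * ((norm (X 0))\<^sup>2 + (norm (X 1))\<^sup>2)"
proof -
  define Q where "Q k = (norm (X (Suc k)))\<^sup>2 - D * (X (Suc k) \<bullet> X k) + (norm (X k))\<^sup>2" for k
  have Q: "Q k = Q 0" for k
  proof (induction k)
    case (Suc k)
    have "Q (Suc k) = Q k"
      unfolding Q_def rec
      by (simp add: power2_norm_eq_inner inner_diff_left inner_diff_right inner_commute algebra_simps)
    then show ?case using Suc by simp
  qed simp
  have DX: "D * (x \<bullet> y) \<le> ((norm x)\<^sup>2 + (norm y)\<^sup>2) / 2"
    "- ((norm x)\<^sup>2 + (norm y)\<^sup>2) / 2 \<le> D * (x \<bullet> y)" for x y :: 'a
  proof -
    have "\<bar>D * (x \<bullet> y)\<bar> \<le> 1 * (norm x * norm y)"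
      unfolding abs_mult by (intro mult_mono D Cauchy_Schwarz_ineq2) auto
    also have "\<dots> \<le> ((norm x)\<^sup>2 + (norm y)\<^sup>2) / 2"
      using sum_squares_bound[of "norm x" "norm y"] by (simp add: field_simps)
    finally have *: "\<bar>D * (x \<bullet> y)\<bar> \<le> ((norm x)\<^sup>2 + (norm y)\<^sup>2) / 2" .
    show "D * (x \<bullet> y) \<le> ((norm x)\<^sup>2 + (norm y)\<^sup>2) / 2" using abs_le_D1[OF *] .
    show "- ((norm x)\<^sup>2 + (norm y)\<^sup>2) / 2 \<le> D * (x \<bullet> y)" using abs_le_D2[OF *] by (simp only: minus_divide_left[symmetric])
  qed
  have lower: "((norm (X (Suc k)))\<^sup>2 + (norm (X k))\<^sup>2) / 2 \<le> Q k" for k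
  proof -
    have gen: "P \<le> (u + w) / 2 \<Longrightarrow> (u + w) / 2 \<le> u - P + w" for P u w :: real by simp
    show ?thesis unfolding Q_def by (rule gen) (rule DX)
  qed
  have upper: "Q 0 \<le> 3 / 2 * ((norm (X 0))\<^sup>2 + (norm (X 1))\<^sup>2)"
  proof -
    have gen: "- (u + w) / 2 \<le> P \<Longrightarrow> u - P + w \<le> 3 / 2 * (w + u)" for P u w :: real by simp
    show ?thesis unfolding Q_def One_nat_def by (rule gen) (rule DX)
  qed
  have "(norm (X k))\<^sup>2 / 2 \<le> Q 0"
  proof -
    have gen: "(u + w) / 2 \<le> P \<Longrightarrow> 0 \<le> u \<Longrightarrow> w / 2 \<le> P" for P u w :: real by simp
    show ?thesis using lower[of k] Q[of k] gen zero_le_power2 by metis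
  qed
  then show ?thesis using upper by simp
qed

lemma periodic_add_mult:
  assumes "\<And>i. b (i + int q) = b i" shows "b (i + int k * int q) = b i"
proof (induction k)
  case (Suc k)
  have "b (i + int (Suc k) * int q) = b ((i + int k * int q) + int q)" by (simp add: algebra_simps)
  then show ?case using assms Suc by simp
qed simp

lemma window_periodic:
  assumes "\<And>i. b (i + int q) = b i"
  shows "window b (j + int k * int q) n = window b j n"
  using periodic_add_mult[of b q, OF assms]
  by (subst window_shift[symmetric]) simp

text \<open>
  Moving the starting point by one site conjugates the one-period matrix by a step.
\<close>
lemma trace_window_periodic:
  assumes per: "\<And>i. b (i + int q) = b i"
  shows "trace (window b j q) = trace (window b 0 q)"
proof -
  have s: "trace (window b (j + 1) q) = trace (window b j q)" for j
  proof -
    have *: "window b (j + 1) q ** step (b j) = step (b j) ** window b j q"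
      using window_Suc_left[of b j q] per[of j] by simp
    have "window b (j + 1) q = window b (j + 1) q ** (step (b j) ** adj2 (step (b j)))"
      by (simp only: adj2_right_inverse[OF det_step] matrix_mul_rid)
    also have "\<dots> = step (b j) ** window b j q ** adj2 (step (b j))"
      by (simp only: * matrix_mul_assoc)
    finally have "window b (j + 1) q = step (b j) ** window b j q ** adj2 (step (b j))" .
    then have "trace (window b (j + 1) q) = trace (adj2 (step (b j)) ** (step (b j) ** window b j q))"
      by (simp only: trace_mul_sym[of "step (b j) ** window b j q"])
    then show ?thesis by (simp only: matrix_mul_assoc adj2_left_inverse[OF det_step] matrix_mul_lid)
  qed
  show ?thesis
  proof (induction j rule: int_induct[of _ 0])
    case (step2 i) then show ?case using s[of "i - 1"] by simp
  qed (simp_all add: s)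
qed

text \<open>
  A long window consists of full periods, whose powers are bounded by
  \<open>bounded_chebyshev_recurrence\<close>, and a rest shorter than a period.
\<close>
lemma norm_long_window_periodic:
  assumes per: "\<And>i. b (i + int q) = b i" and q: "0 < q"
    and tr: "trace (window b 0 q) = complex_of_real D" and D: "\<bar>D\<bar> \<le> 1"
    and B: "\<And>j n. n \<le> q \<Longrightarrow> norm (window b j n) \<le> B"
  shows "norm (window b j n) \<le> 3 * B\<^sup>2"
proof -
  have B0: "1 \<le> B" using B[of 0 0] norm_window_ge_1[of b 0 0] by (simp del: window.simps)
  define X where "X k = window b j (k * q)" for k
  have X: "X (Suc k) = window b j q ** X k" for k
    using window_add[of b j "k * q" q] window_periodic[of b q, OF per, of j k q]
    by (simp add: X_def add.commute)
  have "trace (window b j q) = complex_of_real D"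
    using trace_window_periodic[of b q, OF per] tr by simp
  moreover have "mat (complex_of_real D) ** Y = D *\<^sub>R Y" for Y :: cmat
    by (simp add: cmat_eq_iff cmat_mult_nth mat_def scaleR_conv_of_real[where 'a = complex])
  ultimately have "X (Suc (Suc k)) = D *\<^sub>R X (Suc k) - X k" for k
    using recurrence_of_det_1[of "window b j q" "X k"] unfolding X by simp
  then have "(norm (X k))\<^sup>2 \<le> 3 * ((norm (X 0))\<^sup>2 + (norm (X 1))\<^sup>2)" for k
    using D by (rule bounded_chebyshev_recurrence)
  moreover have "(norm (X 0))\<^sup>2 = 2"
  proof -
    have "X 0 = mat 1" by (simp add: X_def)
    then show ?thesis by (simp add: norm_cmat_sq mat_def)
  qed
  moreover have "(norm (X 1))\<^sup>2 \<le> B\<^sup>2"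
    unfolding X_def mult_1 by (intro power_mono B) auto
  moreover have "1 \<le> B\<^sup>2" using B0 by simp
  ultimately have X2: "(norm (X k))\<^sup>2 \<le> 9 * B\<^sup>2" for k by (smt (verit))
  have X3: "norm (X k) \<le> 3 * B" for k
    by (rule power2_le_imp_le) (use X2[of k] B0 in \<open>auto simp: power_mult_distrib\<close>)
  have "window b j n = window b (j + int (n div q) * int q) (n mod q) ** X (n div q)"
    using window_add[of b j "n div q * q" "n mod q"] by (simp add: X_def)
  also have "window b (j + int (n div q) * int q) (n mod q) = window b j (n mod q)"
    by (rule window_periodic) (rule per)
  also have "norm (window b j (n mod q) ** X (n div q)) \<le> B * (3 * B)"
    using q B0 by (intro order_trans[OF norm_cmat_mult] mult_mono B X3) (auto intro: less_imp_le)
  finally show ?thesis by (simp add: power2_eq_square)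
qed

section \<open>Discriminants at non-real energies\<close>

text \<open>
  The quantity \<open>Im (x * cnj y)\<close> is conserved by real steps and produced at rate \<open>\<eta> |x|\<^sup>2\<close>
  by an imaginary part \<open>\<eta>\<close> of the energy; since it is itself at most \<open>|x| |y|\<close>, it must grow
  geometrically, and its rate is linear in \<open>\<eta>\<close>.
\<close>
lemma norm_window_grows:
  assumes im: "\<And>i. Im (a i) = \<eta>" and \<eta>: "0 \<le> \<eta>"
  shows "(1 + 2 * \<eta>) ^ n \<le> 2 * (norm (window a j (2 * n)))\<^sup>2"
proof -
  \<comment> \<open>Any initial vector with \<open>Im (x * cnj y) > 0\<close> would do.\<close>
  define v :: "complex^2" where "v = vector [\<i>, 1]"
  define x where "x n = (window a j n *v v)$1" for n
  define y where "y n = (window a j n *v v)$2" for n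
  have y: "y (Suc n) = x n" and x: "x (Suc n) = a (j + int n) * x n - y n" for n
    by (simp_all add: x_def y_def matrix_vector_mul_assoc[symmetric] cmat_vec_nth)
  define G where "G n = Im (x n * cnj (y n))" for n
  have G0: "G 0 = 1" by (simp add: G_def x_def y_def v_def)
  have GS: "G (Suc n) = G n + \<eta> * (cmod (x n))\<^sup>2" for n
    by (simp add: G_def x y im cmod_power2) (simp add: algebra_simps power2_eq_square)
  have mono: "G n \<le> G (Suc n)" for n using \<eta> by (simp add: GS)
  have pos: "1 \<le> G n" for n by (induction n) (use G0 mono order_trans in auto)
  have G_le: "G n \<le> cmod (x n) * cmod (y n)" for n
    unfolding G_def by (metis abs_Im_le_cmod abs_le_D1 complex_mod_cnj norm_mult)
  have two: "(1 + 2 * \<eta>) * G n \<le> G (Suc (Suc n))" for n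
  proof -
    have "2 * G (Suc n) \<le> (cmod (x (Suc n)))\<^sup>2 + (cmod (x n))\<^sup>2"
      using G_le[of "Suc n"] sum_squares_bound[of "cmod (x (Suc n))" "cmod (x n)"] by (simp add: y)
    then have "\<eta> * (2 * G (Suc n)) \<le> \<eta> * ((cmod (x (Suc n)))\<^sup>2 + (cmod (x n))\<^sup>2)"
      using \<eta> by (rule mult_left_mono)
    moreover have "\<eta> * (2 * G n) \<le> \<eta> * (2 * G (Suc n))" using \<eta> mono by (intro mult_left_mono) auto
    ultimately show ?thesis using GS[of n] GS[of "Suc n"] by (simp add: algebra_simps)
  qed
  have "(1 + 2 * \<eta>) ^ n \<le> G (2 * n)" for n
  proof (induction n)
    case (Suc n)
    have "(1 + 2 * \<eta>) ^ Suc n \<le> (1 + 2 * \<eta>) * G (2 * n)" using Suc \<eta> by simp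
    then show ?case using two[of "2 * n"] by simp
  qed (simp add: G0)
  also have "G (2 * n) \<le> (norm (window a j (2 * n) *v v))\<^sup>2"
    using G_le[of "2 * n"] sum_squares_bound[of "cmod (x (2 * n))" "cmod (y (2 * n))"] pos[of "2 * n"]
    unfolding norm_cvec_sq x_def[symmetric] y_def[symmetric] by linarith
  also have "\<dots> \<le> (norm (window a j (2 * n)) * norm v)\<^sup>2"
    by (intro power_mono norm_cmat_vec) simp
  also have "\<dots> = 2 * (norm (window a j (2 * n)))\<^sup>2"
  proof -
    have "(norm v)\<^sup>2 = 2" by (simp add: norm_cvec_sq v_def)
    then show ?thesis by (simp add: power_mult_distrib)
  qed
  finally show ?thesis .
qed

lemma norm_recurrence_of_det_1:
  fixes M X :: cmat
  assumes M: "det M = 1"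
  shows "norm (M ** (M ** X)) \<le> cmod (trace M) * norm (M ** X) + norm X"
proof -
  have "norm (M ** (M ** X)) \<le> norm (mat (trace M) ** (M ** X)) + norm X"
    unfolding recurrence_of_det_1[OF M, of X] by (rule norm_triangle_ineq4)
  moreover have "(norm (mat c ** Y))\<^sup>2 = (cmod c * norm Y)\<^sup>2" for c and Y :: cmat
    by (simp add: norm_cmat_sq cmat_mult_nth mat_def norm_mult power_mult_distrib algebra_simps)
  then have "norm (mat c ** Y) = cmod c * norm Y" for c and Y :: cmat
    by (simp add: power2_eq_iff_nonneg)
  ultimately show ?thesis by simp
qed

text \<open>
  Up to a constant factor, powers of the one-period matrix grow no faster than powers of \<open>|tr|
  + 1\<close>; together with \<open>norm_window_grows\<close> this bounds the discriminant from
  below.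
\<close>
lemma norm_window_periods_le:
  assumes per: "\<And>i. b (i + int q) = b i"
  shows "norm (window b 0 (k * q)) \<le> 2 * norm (window b 0 q) * (cmod (trace (window b 0 q)) + 1) ^ k"
proof -
  define M where "M = window b 0 q"
  define D where "D = cmod (trace M)"
  define X where "X k = window b 0 (k * q)" for k
  have X: "X (Suc k) = M ** X k" for k
    using window_add[of b 0 "k * q" q] window_periodic[of b q, OF per, of 0 k q]
    by (simp add: X_def add.commute M_def)
  have D0: "0 \<le> D" by (simp add: D_def)
  have rec: "norm (X (Suc (Suc k))) \<le> D * norm (X (Suc k)) + norm (X k)" for k
    unfolding X D_def by (rule norm_recurrence_of_det_1) (simp add: M_def)
  have M1: "1 \<le> norm M" unfolding M_def by (rule norm_window_ge_1)
  have "norm (X k) \<le> 2 * norm M * (D + 1) ^ k \<and> norm (X (Suc k)) \<le> 2 * norm M * (D + 1) ^ Suc k"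
  proof (induction k)
    case 0
    have "norm (mat 1 :: cmat) \<le> 2"
      by (rule power2_le_imp_le) (simp_all add: norm_cmat_sq mat_def)
    moreover have "norm M * 1 \<le> norm M * (2 * (D + 1))" using M1 D0 by (intro mult_left_mono) auto
    ultimately show ?case using M1 by (simp add: X_def M_def[symmetric] mult_ac)
  next
    case (Suc k)
    have "norm (X (Suc (Suc k))) \<le> D * (2 * norm M * (D + 1) ^ Suc k) + 2 * norm M * (D + 1) ^ k"
      using Suc D0 by (intro order_trans[OF rec] add_mono mult_left_mono) auto
    also have "\<dots> \<le> D * (2 * norm M * (D + 1) ^ Suc k) + 2 * norm M * (D + 1) ^ Suc k"
      using D0 M1 by (intro add_left_mono mult_left_mono power_increasing) auto
    finally show ?case using Suc by (simp add: algebra_simps)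
  qed
  then show ?thesis by (simp add: X_def M_def D_def)
qed

lemma power_le_const_power_imp_le:
  fixes x y C :: real
  assumes "\<And>k. x ^ k \<le> C * y ^ k" and "0 < y"
  shows "x \<le> y"
proof (rule ccontr)
  assume "\<not> x \<le> y"
  then have "1 < x / y" using assms(2) by simp
  then obtain k where "C < (x / y) ^ k" using real_arch_pow by blast
  then show False using assms(1)[of k] assms(2) by (simp add: power_divide field_simps)
qed

text \<open>
  Both bounds hold over \<open>k\<close> periods; comparing them for \<open>k \<rightarrow>
  \<infinity>\<close> removes all constants. The fourth power comes from the doubled length and the
  squared norm in \<open>norm_window_grows\<close>.
\<close>
lemma discriminant_lower_bound:
  assumes per: "\<And>i. a (i + int q) = a i"
    and im: "\<And>i. Im (a i) = \<eta>" and \<eta>: "0 \<le> \<eta>"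
  shows "(1 + 2 * \<eta>) ^ q \<le> (1 + cmod (trace (window a 0 q))) ^ 4"
proof (rule power_le_const_power_imp_le)
  fix k
  define D where "D = cmod (trace (window a 0 q)) + 1"
  have "((1 + 2 * \<eta>) ^ q) ^ k \<le> 2 * (norm (window a 0 ((2 * k) * q)))\<^sup>2"
    using norm_window_grows[of a, OF im \<eta>, of "q * k" 0]
    by (simp only: power_mult[symmetric] mult_ac)
  also have "\<dots> \<le> 2 * (2 * norm (window a 0 q) * D ^ (2 * k))\<^sup>2"
    unfolding D_def by (intro mult_left_mono power_mono norm_window_periods_le[of a q, OF per]) auto
  also have "\<dots> = (8 * (norm (window a 0 q))\<^sup>2) * (D ^ 4) ^ k"
    by (simp add: power_mult_distrib power_mult[symmetric] mult_ac)
  finally show "((1 + 2 * \<eta>) ^ q) ^ k \<le>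
      (8 * (norm (window a 0 q))\<^sup>2) * ((1 + cmod (trace (window a 0 q))) ^ 4) ^ k"
    by (simp add: D_def add.commute)
next
  show "0 < (1 + cmod (trace (window a 0 q))) ^ 4" by (intro zero_less_power add_pos_nonneg) auto
qed

section \<open>Zeros of the discriminant\<close>

lemma window_entry_poly:
  "\<exists>P. degree P \<le> n \<and> (\<forall>z. window (\<lambda>i. z - w i) j n $ r $ s = poly P z)"
proof (induction n arbitrary: r)
  case 0
  show ?case by (rule exI[of _ "[:mat 1 $ r $ s:]"]) simp
next
  case (Suc n)
  obtain P where P: "degree P \<le> n" "\<And>z. window (\<lambda>i. z - w i) j n $ 1 $ s = poly P z" using Suc by blast
  obtain Q where Q: "degree Q \<le> n" "\<And>z. window (\<lambda>i. z - w i) j n $ 2 $ s = poly Q z" using Suc by blast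
  consider "r = 1" | "r = 2" using exhaust_2 by blast
  then show ?case
  proof cases
    case 1
    have "degree ([:- w (j + int n), 1:] * P - Q) \<le> Suc n"
    proof (rule degree_diff_le)
      show "degree ([:- w (j + int n), 1:] * P) \<le> Suc n"
        using P(1) by (intro order_trans[OF degree_mult_le]) auto
    qed (use Q(1) in simp)
    then show ?thesis
      by (intro exI[of _ "[:- w (j + int n), 1:] * P - Q"])
        (simp add: 1 cmat_mult_nth P(2) Q(2) algebra_simps)
  next
    case 2
    show ?thesis by (rule exI[of _ P]) (use P in \<open>simp add: 2 cmat_mult_nth\<close>)
  qed
qed

lemma window_cnj: "window (\<lambda>i. cnj (a i)) j n $ r $ s = cnj (window a j n $ r $ s)"
proof (induction n arbitrary: r)
  case 0
  show ?case by (simp add: mat_def)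
next
  case (Suc n)
  consider "r = 1" | "r = 2" using exhaust_2 by blast
  then show ?case by cases (simp_all add: cmat_mult_nth Suc)
qed

lemma trace_window_cnj: "trace (window (\<lambda>i. cnj (a i)) j n) = cnj (trace (window a j n))"
  by (simp add: trace_def window_cnj)

definition discriminant :: "(int \<Rightarrow> real) \<Rightarrow> nat \<Rightarrow> complex \<Rightarrow> complex" where
  "discriminant w q z = trace (window (\<lambda>i. z - complex_of_real (w i)) 0 q)"

context
  fixes w :: "int \<Rightarrow> real" and q :: nat
  assumes per: "\<And>i. w (i + int q) = w i" and q: "0 < q"
begin

lemma discriminant_growth:
  assumes "0 \<le> Im z"
  shows "(1 + 2 * Im z) ^ q \<le> (1 + cmod (discriminant w q z)) ^ 4"
  unfolding discriminant_def
  by (rule discriminant_lower_bound) (use per assms in auto)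

lemma discriminant_cnj: "discriminant w q (cnj z) = cnj (discriminant w q z)"
  using trace_window_cnj[of "\<lambda>i. z - complex_of_real (w i)" 0 q] by (simp add: discriminant_def)

text \<open>
  Above the real axis a zero would contradict \<open>discriminant_growth\<close>; below, reflect.
\<close>
lemma discriminant_zero_real:
  assumes "discriminant w q z = 0" shows "Im z = 0"
proof -
  have *: "\<not> 0 < Im z" if "discriminant w q z = 0" for z
  proof
    assume "0 < Im z"
    then have "1 < (1 + 2 * Im z) ^ q" using q by (intro one_less_power) auto
    then show False using discriminant_growth[of z] that \<open>0 < Im z\<close> by simp
  qed
  have "discriminant w q (cnj z) = 0" using assms by (simp add: discriminant_cnj)
  then show ?thesis using *[OF assms] *[of "cnj z"] by simp
qed

lemma discriminant_factorization:
  obtains A c where "c \<noteq> 0" "size A \<le> q" "\<And>r. r \<in># A \<Longrightarrow> discriminant w q r = 0"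
    "\<And>z. discriminant w q z = c * (\<Prod>r\<in>#A. z - r)"
proof -
  obtain P where P: "degree P \<le> q" "\<And>z. window (\<lambda>i. z - complex_of_real (w i)) 0 q $ 1 $ 1 = poly P z"
    using window_entry_poly[of q "\<lambda>i. complex_of_real (w i)" 0 1 1] by blast
  obtain Q where Q: "degree Q \<le> q" "\<And>z. window (\<lambda>i. z - complex_of_real (w i)) 0 q $ 2 $ 2 = poly Q z"
    using window_entry_poly[of q "\<lambda>i. complex_of_real (w i)" 0 2 2] by blast
  define D where "D = P + Q"
  have D: "discriminant w q z = poly D z" for z
    by (simp add: discriminant_def trace_def sum_2 P Q D_def)
  have "D \<noteq> 0"
  proof
    assume "D = 0"
    then have "Im \<i> = 0" by (intro discriminant_zero_real) (simp add: D)
    then show False by simp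
  qed
  from alg_closed_imp_factorization[OF this]
  obtain A where A: "size A = degree D" "D = smult (lead_coeff D) (\<Prod>x\<in>#A. [:-x, 1:])"
    by (elim exE conjE)
  have pA: "poly D z = lead_coeff D * (\<Prod>r\<in>#A. z - r)" for z
  proof -
    have "poly (\<Prod>x\<in>#A. [:-x, 1:]) z = (\<Prod>r\<in>#A. z - r)"
      by (induction A) (auto simp: algebra_simps)
    then show ?thesis by (subst A(2)) simp
  qed
  show thesis
  proof (rule that)
    show "lead_coeff D \<noteq> 0" using \<open>D \<noteq> 0\<close> by simp
    show "size A \<le> q" unfolding A(1) D_def using P(1) Q(1) by (rule degree_add_le)
    show "discriminant w q z = lead_coeff D * (\<Prod>r\<in>#A. z - r)" for z by (simp add: D pA)
    show "discriminant w q r = 0" if "r \<in># A" for r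
      using that by (simp add: D pA prod_mset_zero_iff image_iff)
  qed
qed

text \<open>
  If the zeros, which are all real, stay at distance \<open>d\<close> from \<open>E\<close>, then moving from \<open>E\<close> to
  \<open>E + i\<eta>\<close> changes each factor only to second order in \<open>\<eta>\<close>.
\<close>
lemma discriminant_vertical_growth:
  assumes far: "\<And>E1. \<bar>E1 - E\<bar> < d \<Longrightarrow> discriminant w q (complex_of_real E1) \<noteq> 0" and d: "0 < d"
  shows "(cmod (discriminant w q (Complex E \<eta>)))\<^sup>2 \<le> (1 + \<eta>\<^sup>2 / d\<^sup>2) ^ q * (cmod (discriminant w q (complex_of_real E)))\<^sup>2"
proof -
  obtain A c where A: "c \<noteq> 0" "size A \<le> q" "\<And>r. r \<in># A \<Longrightarrow> discriminant w q r = 0"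
    "\<And>z. discriminant w q z = c * (\<Prod>r\<in>#A. z - r)"
    by (rule discriminant_factorization) blast
  have one: "(cmod (Complex E \<eta> - r))\<^sup>2 \<le> (1 + \<eta>\<^sup>2 / d\<^sup>2) * (cmod (complex_of_real E - r))\<^sup>2" if "r \<in># A" for r
  proof -
    have r: "r = complex_of_real (Re r)" using discriminant_zero_real[OF A(3)[OF that]] by (simp add: complex_eq_iff)
    have "\<not> \<bar>Re r - E\<bar> < d" using far[of "Re r"] A(3)[OF that] r by auto
    then have "d\<^sup>2 \<le> (Re r - E)\<^sup>2" using d by (simp add: abs_le_square_iff[symmetric])
    then have "\<eta>\<^sup>2 * d\<^sup>2 \<le> \<eta>\<^sup>2 * (E - Re r)\<^sup>2" by (intro mult_left_mono) (auto simp: power2_commute)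
    then have "\<eta>\<^sup>2 \<le> \<eta>\<^sup>2 / d\<^sup>2 * (E - Re r)\<^sup>2" using d by (simp add: field_simps)
    moreover have "Im r = 0" using r by (metis Im_complex_of_real)
    ultimately show ?thesis by (simp add: cmod_power2 algebra_simps)
  qed
  have "(\<Prod>r\<in>#B. (cmod (Complex E \<eta> - r))\<^sup>2) \<le> (1 + \<eta>\<^sup>2 / d\<^sup>2) ^ size B * (\<Prod>r\<in>#B. (cmod (complex_of_real E - r))\<^sup>2)"
    if "B \<subseteq># A" for B
    using that
  proof (induction B)
    case (add x B)
    have "(cmod (Complex E \<eta> - x))\<^sup>2 * (\<Prod>r\<in>#B. (cmod (Complex E \<eta> - r))\<^sup>2)
       \<le> ((1 + \<eta>\<^sup>2 / d\<^sup>2) * (cmod (complex_of_real E - x))\<^sup>2) * ((1 + \<eta>\<^sup>2 / d\<^sup>2) ^ size B * (\<Prod>r\<in>#B. (cmod (complex_of_real E - r))\<^sup>2))"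
    proof (intro mult_mono one)
      show "x \<in># A" using add.prems by (meson mset_subset_eqD union_single_eq_member)
      show "(\<Prod>r\<in>#B. (cmod (Complex E \<eta> - r))\<^sup>2) \<le> (1 + \<eta>\<^sup>2 / d\<^sup>2) ^ size B * (\<Prod>r\<in>#B. (cmod (complex_of_real E - r))\<^sup>2)"
        using add.prems by (intro add.IH) (meson mset_subset_eq_add_right subset_mset.order_trans mset_subset_eq_insertD subset_mset.less_imp_le)
      show "0 \<le> (\<Prod>r\<in>#B. (cmod (Complex E \<eta> - r))\<^sup>2)" by (induction B) auto
    qed auto
    then show ?case by (simp add: mult_ac)
  qed simp
  from this[of A] have 1: "(\<Prod>r\<in>#A. (cmod (Complex E \<eta> - r))\<^sup>2) \<le> (1 + \<eta>\<^sup>2 / d\<^sup>2) ^ size A * (\<Prod>r\<in>#A. (cmod (complex_of_real E - r))\<^sup>2)"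
    by simp
  have nn: "0 \<le> (\<Prod>r\<in>#A. (cmod (complex_of_real E - r))\<^sup>2)" by (induction A) auto
  have "(1 + \<eta>\<^sup>2 / d\<^sup>2) ^ size A \<le> (1 + \<eta>\<^sup>2 / d\<^sup>2) ^ q" using A(2) by (intro power_increasing) auto
  then have 2: "(\<Prod>r\<in>#A. (cmod (Complex E \<eta> - r))\<^sup>2) \<le> (1 + \<eta>\<^sup>2 / d\<^sup>2) ^ q * (\<Prod>r\<in>#A. (cmod (complex_of_real E - r))\<^sup>2)"
    using mult_right_mono[OF _ nn] 1 by fastforce
  have sq: "(cmod (\<Prod>r\<in>#A. z - r))\<^sup>2 = (\<Prod>r\<in>#A. (cmod (z - r))\<^sup>2)" for z
    by (induction A) (auto simp: norm_mult power_mult_distrib)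
  show ?thesis
    using mult_left_mono[OF 2, of "(cmod c)\<^sup>2"] by (simp add: A(4) norm_mult power_mult_distrib sq mult_ac)
qed

lemma discriminant_zero_near:
  assumes d: "0 < d" "d \<le> 1"
    and M: "norm (window (\<lambda>i. complex_of_real (E - w i)) 0 q) \<le> exp (K + real q * (d\<^sup>2 / 128))"
    and large: "ln 100 + 4 * K < real q * (d\<^sup>2 / 16)"
  shows "\<exists>E1. \<bar>E1 - E\<bar> < d \<and> discriminant w q (complex_of_real E1) = 0"
proof (rule ccontr)
  assume "\<nexists>E1. \<bar>E1 - E\<bar> < d \<and> discriminant w q (complex_of_real E1) = 0"
  then have far: "discriminant w q (complex_of_real E1) \<noteq> 0" if "\<bar>E1 - E\<bar> < d" for E1 using that by blast
  \<comment> \<open>With this choice the gain, at least \<open>\<eta>\<close> per site, is four times the loss \<open>2 \<eta>\<^sup>2 / d\<^sup>2\<close>.\<close>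
  define \<eta> where "\<eta> = d\<^sup>2 / 8"
  define X where "X = cmod (discriminant w q (Complex E \<eta>))"
  define m where "m = norm (window (\<lambda>i. complex_of_real (E - w i)) 0 q)"
  define y where "y = 1 + \<eta>\<^sup>2 / d\<^sup>2"
  have d2: "0 < d\<^sup>2" "d\<^sup>2 \<le> 1" using d by (auto simp: power_le_one)
  have \<eta>: "0 < \<eta>" "\<eta> \<le> 1 / 8" using d2 by (auto simp: \<eta>_def)
  have m1: "1 \<le> m" unfolding m_def by (rule norm_window_ge_1)
  have y1: "1 \<le> y" by (simp add: y_def)
  have "cmod (discriminant w q (complex_of_real E)) \<le> 2 * m"
    using cmod_trace_le[of "window (\<lambda>i. complex_of_real (E - w i)) 0 q"] by (simp add: discriminant_def m_def)
  then have "(cmod (discriminant w q (complex_of_real E)))\<^sup>2 \<le> (2 * m)\<^sup>2" by (rule power_mono) simp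
  then have "y ^ q * (cmod (discriminant w q (complex_of_real E)))\<^sup>2 \<le> y ^ q * (2 * m)\<^sup>2"
    using y1 by (intro mult_left_mono) auto
  moreover have "X\<^sup>2 \<le> y ^ q * (cmod (discriminant w q (complex_of_real E)))\<^sup>2"
    unfolding X_def y_def by (rule discriminant_vertical_growth) (use far d in auto)
  ultimately have "X\<^sup>2 \<le> y ^ q * (2 * m)\<^sup>2" by linarith
  then have X2: "X\<^sup>2 \<le> 4 * (y ^ q * m\<^sup>2)" by (simp add: power_mult_distrib)
  have ym: "1 \<le> y ^ q * m\<^sup>2"
    using one_le_power[OF y1, of q] one_le_power[OF m1, of 2] mult_mono[of 1 "y ^ q" 1 "m\<^sup>2"] by simp
  have "(1 + X)\<^sup>2 \<le> 2 + 2 * X\<^sup>2" using sum_squares_bound[of 1 X] by (simp add: power2_sum)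
  also have "\<dots> \<le> 10 * (y ^ q * m\<^sup>2)" using X2 ym by linarith
  finally have "((1 + X)\<^sup>2)\<^sup>2 \<le> (10 * (y ^ q * m\<^sup>2))\<^sup>2" by (rule power_mono) simp
  moreover have "(1 + 2 * \<eta>) ^ q \<le> (1 + X) ^ 4"
    using discriminant_growth[of "Complex E \<eta>"] \<eta> by (simp add: X_def)
  ultimately have "(1 + 2 * \<eta>) ^ q \<le> 100 * (y ^ (2 * q) * m ^ 4)"
    by (simp add: power_mult_distrib power_mult[symmetric] mult.commute)
  then have "ln ((1 + 2 * \<eta>) ^ q) \<le> ln (100 * (y ^ (2 * q) * m ^ 4))"
    using \<eta> y1 m1 by (subst ln_le_cancel_iff) (auto intro!: mult_pos_pos)
  then have "real q * ln (1 + 2 * \<eta>) \<le> ln 100 + (2 * real q * ln y + 4 * ln m)"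
    using \<eta> y1 m1 by (simp add: ln_mult ln_realpow)
  moreover have "ln y \<le> \<eta>\<^sup>2 / d\<^sup>2" unfolding y_def by (rule ln_add_one_self_le_self) simp
  then have "2 * real q * ln y \<le> 2 * real q * (\<eta>\<^sup>2 / d\<^sup>2)" by (intro mult_left_mono) auto
  moreover have "2 * real q * (\<eta>\<^sup>2 / d\<^sup>2) = real q * (d\<^sup>2 / 32)"
    using d by (simp add: \<eta>_def power2_eq_square)
  moreover have "ln m \<le> K + real q * (d\<^sup>2 / 128)"
    using M m1 unfolding m_def[symmetric] by (metis exp_gt_zero ln_exp ln_le_cancel_iff less_le_trans zero_less_one)
  moreover have "\<eta> \<le> ln (1 + 2 * \<eta>)"
  proof -
    have "2 * \<eta> - (2 * \<eta>)\<^sup>2 \<le> ln (1 + 2 * \<eta>)" using \<eta> by (intro ln_one_plus_pos_lower_bound) auto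
    moreover have "(2 * \<eta>)\<^sup>2 \<le> \<eta>" using mult_left_mono[OF \<eta>(2), of "4 * \<eta>"] \<eta> by (simp add: power2_eq_square)
    ultimately show ?thesis by linarith
  qed
  then have "real q * \<eta> \<le> real q * ln (1 + 2 * \<eta>)" by (intro mult_left_mono) auto
  moreover have "real q * \<eta> = real q * (d\<^sup>2 / 8)" by (simp add: \<eta>_def)
  moreover have "r \<le> l + (s + 4 * t) \<Longrightarrow> s \<le> s' \<Longrightarrow> s' = s'' \<Longrightarrow> t \<le> K + t' \<Longrightarrow> r' \<le> r \<Longrightarrow> r' = r''
      \<Longrightarrow> r'' \<le> l + s'' + 4 * K + 4 * t'" for l r r' r'' s s' s'' t t' :: real
    by linarith
  ultimately have "real q * (d\<^sup>2 / 8) \<le> ln 100 + real q * (d\<^sup>2 / 32) + 4 * K + 4 * (real q * (d\<^sup>2 / 128))"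
    by blast
  moreover have "real q * (d\<^sup>2 / 8) = 2 * (real q * (d\<^sup>2 / 16))" "real q * (d\<^sup>2 / 32) = (real q * (d\<^sup>2 / 16)) / 2"
    "4 * (real q * (d\<^sup>2 / 128)) = (real q * (d\<^sup>2 / 16)) / 2" by simp_all
  ultimately show False using large by linarith
qed

text \<open>
  The discriminant is a polynomial and, by \<open>discriminant_growth\<close> along the imaginary
  axis, not constant. A zero far outside the range of the potential is impossible: there the
  transfer matrices expand, while the square of the one-period matrix at a zero is \<open>-
  1\<close>.
\<close>
lemma discriminant_zero_exists:
  assumes w: "\<And>i. \<bar>w i\<bar> \<le> b"
  obtains E1 where "\<bar>E1\<bar> < b + 3" "discriminant w q (complex_of_real E1) = 0"
proof -
  have zb: "\<bar>E1\<bar> < b + 3" if "discriminant w q (complex_of_real E1) = 0" for E1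
  proof (rule ccontr)
    assume "\<not> \<bar>E1\<bar> < b + 3"
    then have far: "3 \<le> \<bar>E1 - w i\<bar>" for i using w[of i] by linarith
    define a where "a i = complex_of_real E1 - complex_of_real (w i)" for i
    have a3: "3 \<le> cmod (a i)" for i
      using far[of i] by (simp add: a_def of_real_diff[symmetric] del: of_real_diff)
    define x where "x n = window a 0 n $ 1 $ 1" for n
    have x: "x 0 = 1" "x (Suc n) = a (int n) * x n - window a 0 n $ 2 $ 1" "window a 0 (Suc n) $ 2 $ 1 = x n" "window a 0 0 $ 2 $ 1 = 0" for n
      by (simp_all add: x_def cmat_mult_nth mat_def)
    have grow: "2 ^ n \<le> cmod (x n) \<and> cmod (window a 0 n $ 2 $ 1) \<le> cmod (x n)" for n
    proof (induction n)
      case (Suc n)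
      have "3 * cmod (x n) - cmod (x n) \<le> cmod (a (int n) * x n) - cmod (window a 0 n $ 2 $ 1)"
        using mult_right_mono[OF a3[of "int n"], of "cmod (x n)"] Suc by (simp add: norm_mult)
      also have "\<dots> \<le> cmod (x (Suc n))" unfolding x(2) by (rule norm_triangle_ineq2)
      finally have "2 * cmod (x n) \<le> cmod (x (Suc n))" by simp
      moreover have "cmod (x n) \<le> 2 * cmod (x n)" by simp
      ultimately have "cmod (x n) \<le> cmod (x (Suc n))" by (rule order_trans[rotated])
      then show ?case using Suc \<open>2 * cmod (x n) \<le> cmod (x (Suc n))\<close> unfolding x(3) by simp
    qed (simp add: x(1,4) del: window.simps)
    have "2 ^ (k * q) \<le> 2 * norm (window a 0 q)" for k
    proof -
      have "2 ^ (k * q) \<le> cmod (x (k * q))" using grow by blast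
      also have "\<dots> \<le> norm (window a 0 (k * q))"
        unfolding x_def using order_trans[OF Finite_Cartesian_Product.norm_nth_le Finite_Cartesian_Product.norm_nth_le] .
      also have "\<dots> \<le> 2 * norm (window a 0 q) * (cmod (trace (window a 0 q)) + 1) ^ k"
        by (rule norm_window_periods_le) (simp add: a_def per)
      also have "trace (window a 0 q) = 0" using that by (simp add: discriminant_def a_def[abs_def])
      finally show ?thesis by simp
    qed
    then have "(2 ^ q) ^ k \<le> (2 * norm (window a 0 q)) * 1 ^ k" for k by (simp add: power_mult[symmetric] mult.commute)
    then have "(2::real) ^ q \<le> 1" by (rule power_le_const_power_imp_le) simp
    moreover have "1 < (2::real) ^ q" using q by (intro one_less_power) auto
    ultimately show False by simp
  qed
  obtain A c where A: "c \<noteq> 0" "size A \<le> q" "\<And>r. r \<in># A \<Longrightarrow> discriminant w q r = 0"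
    "\<And>z. discriminant w q z = c * (\<Prod>r\<in>#A. z - r)"
    by (rule discriminant_factorization) blast
  have "A \<noteq> {#}"
  proof
    assume "A = {#}"
    then have D: "discriminant w q z = c" for z by (simp add: A(4))
    define t where "t = (1 + cmod c) ^ 4"
    have "1 + 2 * t \<le> (1 + 2 * t) ^ q" using q by (intro self_le_power) (auto simp: t_def)
    also have "\<dots> \<le> t" using discriminant_growth[of "Complex 0 t"] by (simp add: D t_def)
    finally show False by (simp add: t_def) (smt (verit) zero_le_power norm_ge_zero)
  qed
  then obtain r where r: "r \<in># A" by blast
  have "r = complex_of_real (Re r)" using discriminant_zero_real[OF A(3)[OF r]] by (simp add: complex_eq_iff)
  then have "discriminant w q (complex_of_real (Re r)) = 0" using A(3)[OF r] by simp
  then show thesis using that zb by blast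
qed

end

section \<open>Subadditive sequences and periodic functions\<close>

text \<open>
  Fekete's lemma.
\<close>
lemma fekete_convergent:
  fixes a :: "nat \<Rightarrow> real"
  assumes sub: "\<And>m n. a (m + n) \<le> a m + a n" and nn: "\<And>n. 0 \<le> a n"
  shows "convergent (\<lambda>n. a n / real n)"
proof -
  define l where "l = (INF n\<in>{1..}. a n / real n)"
  have bdd: "bdd_below ((\<lambda>n. a n / real n) ` {1..})"
    using nn by (intro bdd_belowI2[of _ 0]) auto
  have lower: "l \<le> a n / real n" if "1 \<le> n" for n
    unfolding l_def using that by (intro cINF_lower bdd) auto
  have mult: "a (k * m + r) \<le> real k * a m + a r" for k m r
  proof (induction k)
    case (Suc k)
    have "a (Suc k * m + r) \<le> a m + a (k * m + r)" using sub[of m "k * m + r"] by (simp add: add.assoc)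
    then show ?case using Suc by (simp add: algebra_simps)
  qed simp
  have "(\<lambda>n. a n / real n) \<longlonglongrightarrow> l"
  proof (rule LIMSEQ_I)
    fix e :: real assume e: "0 < e"
    have "(INF n\<in>{1..}. a n / real n) < l + e / 2" using e by (simp add: l_def)
    then obtain m where m: "1 \<le> m" "a m / real m < l + e / 2"
      using cINF_less_iff[OF _ bdd] by (metis atLeast_iff empty_iff order_refl)
    define C where "C = Max (a ` {..<m})"
    have C: "a r \<le> C" if "r < m" for r unfolding C_def using that by (intro Max_ge) auto
    have C0: "0 \<le> C" using C[of 0] nn[of 0] m by linarith
    obtain N :: nat where N: "2 * C / e < real N" using reals_Archimedean2 by blast
    have "norm (a n / real n - l) < e" if n: "max 1 N \<le> n" for n
    proof -
      have n0: "0 < real n" "real N \<le> real n" using n by auto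
      have "a n \<le> real (n div m) * a m + a (n mod m)" using mult[of "n div m" m "n mod m"] by simp
      also have "real (n div m) * a m \<le> (real n / real m) * a m"
        using nn of_nat_div_le_of_nat[of n m, where 'a = real] by (intro mult_right_mono) auto
      also have "a (n mod m) \<le> C" using m by (intro C) auto
      finally have "a n / real n \<le> ((real n / real m) * a m + C) / real n" using n0 by (intro divide_right_mono) auto
      also have "\<dots> = a m / real m + C / real n" using n0 by (simp add: add_divide_distrib)
      also have "C / real n < e / 2"
      proof -
        have "2 * C / e < real n" using N n0 by linarith
        then show ?thesis using e n0 by (simp add: field_simps)
      qed
      finally have "a n / real n < l + e" using m(2) by linarith
      moreover have "l \<le> a n / real n" using n by (intro lower) auto
      ultimately show ?thesis by simp
    qed
    then show "\<exists>N. \<forall>n\<ge>N. norm (a n / real n - l) < e" by blast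
  qed
  then show ?thesis by (auto simp: convergent_def)
qed

lemma periodic_int_shift:
  fixes f :: "real \<Rightarrow> real"
  assumes "\<And>x. f (x + 1) = f x" shows "f (x + of_int k) = f x"
proof (induction k rule: int_induct[of _ 0])
  case (step1 i)
  then show ?case using assms[of "x + of_int i"] by (simp add: algebra_simps)
next
  case (step2 i)
  then show ?case using assms[of "x + of_int i - 1"] by (simp add: algebra_simps)
qed simp

lemma integral_periodic_shift:
  fixes f :: "real \<Rightarrow> real"
  assumes per: "\<And>x. f (x + 1) = f x" and cont: "\<And>S. continuous_on S f"
  shows "integral {0..1} (\<lambda>x. f (x + c)) = integral {0..1} f"
proof -
  define d where "d = frac c"
  have d: "0 \<le> d" "d \<le> 1" using frac_lt_1[of c] by (auto simp: d_def)
  have int: "f integrable_on {a..b}" for a b by (rule integrable_continuous_interval) (rule cont)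
  have "f (x + c) = f (x + d)" for x
  proof -
    have "x + c = (x + d) + of_int \<lfloor>c\<rfloor>" by (simp add: d_def frac_def)
    then show ?thesis by (simp only: periodic_int_shift[of f, OF per])
  qed
  then have "integral {0..1} (\<lambda>x. f (x + c)) = integral {0..1} (\<lambda>x. f (x + d))" by simp
  also have "\<dots> = integral {d..1 + d} f"
    using integral_shift_real_ivl[of d d "1 + d" f] by simp
  also have "\<dots> = integral {d..1} f + integral {1..1 + d} f"
    using Henstock_Kurzweil_Integration.integral_combine[where f = f and a = d and c = 1 and b = "1 + d"] d int by simp
  also have "integral {1..1 + d} f = integral {0..d} (\<lambda>x. f (x + 1))"
    using integral_shift_real_ivl[of 1 1 "1 + d" f] by simp
  also have "\<dots> = integral {0..d} f" by (simp add: per)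
  also have "integral {d..1} f + integral {0..d} f = integral {0..1} f"
    using Henstock_Kurzweil_Integration.integral_combine[OF d int] by simp
  finally show ?thesis .
qed

text \<open>
  The points \<open>y + i p / q\<close> are the points \<open>y + r / q\<close> in another order, so
  the left-hand side is \<open>q\<close> times a Riemann sum of mesh \<open>1 / q\<close>.
\<close>
lemma sum_rational_rotation_le:
  fixes f :: "real \<Rightarrow> real" and p :: int and q :: nat
  assumes per: "\<And>x. f (x + 1) = f x" and cont: "\<And>S. continuous_on S f"
    and q: "0 < q" and pq: "coprime p (int q)"
    and osc: "\<And>x t. 0 \<le> t \<Longrightarrow> t \<le> 1 / real q \<Longrightarrow> f x \<le> f (x + t) + 1"
  shows "(\<Sum>i<q. f (y + of_int (int i * p) / real q)) \<le> real q * integral {0..1} f + real q"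
proof -
  define g where "g x = f (y + x)" for x
  have gper: "g (x + 1) = g x" for x using per[of "y + x"] by (simp add: g_def add.assoc)
  have gcont: "continuous_on S g" for S
    unfolding g_def by (rule continuous_on_compose2[OF cont[of UNIV]]) (auto intro!: continuous_intros)
  have gint: "g integrable_on {a..b}" for a b by (rule integrable_continuous_interval) (rule gcont)
  define \<pi> where "\<pi> i = nat ((int i * p) mod int q)" for i
  have \<pi>_range: "\<pi> ` {..<q} \<subseteq> {..<q}" using q by (auto simp: \<pi>_def nat_less_iff)
  have "inj_on \<pi> {..<q}"
  proof (rule inj_onI)
    fix i j assume ij: "i \<in> {..<q}" "j \<in> {..<q}" "\<pi> i = \<pi> j"
    have "(int i * p) mod int q = (int j * p) mod int q" using ij(3) q by (simp add: \<pi>_def eq_nat_nat_iff)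
    then have "int q dvd (int i - int j) * p" by (simp add: mod_eq_dvd_iff left_diff_distrib)
    then have "int q dvd int i - int j" using pq by (simp add: coprime_dvd_mult_left_iff coprime_commute)
    moreover have "\<bar>int i - int j\<bar> < int q" using ij by auto
    ultimately show "i = j" using dvd_imp_le_int[of "int i - int j" "int q"] by fastforce
  qed
  with \<pi>_range have \<pi>: "bij_betw \<pi> {..<q} {..<q}"
    using endo_inj_surj[of "{..<q}" \<pi>] by (simp add: bij_betw_def)
  have "f (y + of_int (int i * p) / real q) = g (real (\<pi> i) / real q)" for i
  proof -
    have "int i * p = int (\<pi> i) + int q * ((int i * p) div int q)" using q by (simp add: \<pi>_def)
    then have "real_of_int (int i * p) = real (\<pi> i) + real q * of_int ((int i * p) div int q)"
      by (metis of_int_add of_int_mult of_int_of_nat_eq)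
    then have "y + of_int (int i * p) / real q = (y + real (\<pi> i) / real q) + of_int ((int i * p) div int q)"
      using q by (simp add: add_divide_distrib)
    then show ?thesis unfolding g_def by (simp only: periodic_int_shift[of f, OF per])
  qed
  then have "(\<Sum>i<q. f (y + of_int (int i * p) / real q)) = (\<Sum>i<q. g (real (\<pi> i) / real q))" by simp
  also have "\<dots> = (\<Sum>i<q. g (real i / real q))" by (rule sum.reindex_bij_betw[OF \<pi>])
  finally have sum_eq: "(\<Sum>i<q. f (y + of_int (int i * p) / real q)) = (\<Sum>i<q. g (real i / real q))" .
  have "(\<Sum>i<k. (g (real i / real q) - 1) / real q) \<le> integral {0..real k / real q} g" for k
  proof (induction k)
    case (Suc k)
    have le: "real k / real q \<le> real (Suc k) / real q" using q by (intro divide_right_mono) auto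
    have "integral {real k / real q..real (Suc k) / real q} (\<lambda>_. g (real k / real q) - 1)
        \<le> integral {real k / real q..real (Suc k) / real q} g"
    proof (rule integral_le)
      fix x assume x: "x \<in> {real k / real q..real (Suc k) / real q}"
      have "f (y + real k / real q) \<le> f ((y + real k / real q) + (x - real k / real q)) + 1"
        using x by (intro osc) (auto simp: add_divide_distrib)
      then show "g (real k / real q) - 1 \<le> g x" by (simp add: g_def)
    qed (auto intro: gint)
    also have "integral {real k / real q..real (Suc k) / real q} (\<lambda>_. g (real k / real q) - 1) = (g (real k / real q) - 1) / real q"
      using le by (simp add: add_divide_distrib)
    finally show ?case
      using Suc Henstock_Kurzweil_Integration.integral_combine[where f = g and a = 0 and c = "real k / real q" and b = "real (Suc k) / real q", OF _ le gint] by simp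
  qed simp
  from this[of q] have "(\<Sum>i<q. (g (real i / real q) - 1) / real q) \<le> integral {0..1} g" using q by simp
  then have "((\<Sum>i<q. g (real i / real q)) - real q) / real q \<le> integral {0..1} g"
    by (simp add: sum_divide_distrib[symmetric] sum_subtractf)
  then have "(\<Sum>i<q. g (real i / real q)) \<le> real q * integral {0..1} g + real q"
    using q by (simp add: field_simps)
  moreover have "integral {0..1} g = integral {0..1} f"
    using integral_periodic_shift[of f y, OF per cont] by (simp add: g_def[abs_def] add.commute)
  ultimately show ?thesis unfolding sum_eq by simp
qed

section \<open>Averaging over blocks\<close>

lemma ln_window_add:
  "ln (norm (window a j (m + n))) \<le> ln (norm (window a (j + int m) n)) + ln (norm (window a j m))"
proof -
  have "ln (norm (window a j (m + n))) \<le> ln (norm (window a (j + int m) n) * norm (window a j m))"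
  proof (subst ln_le_cancel_iff)
    show "norm (window a j (m + n)) \<le> norm (window a (j + int m) n) * norm (window a j m)"
      unfolding window_add by (rule norm_cmat_mult)
  qed (auto intro: mult_pos_pos norm_window_pos)
  also have "\<dots> = ln (norm (window a (j + int m) n)) + ln (norm (window a j m))"
    using norm_window_pos[of a "j + int m" n] norm_window_pos[of a j m] by (simp add: ln_mult)
  finally show ?thesis .
qed

text \<open>
  With \<open>F n = (\<Sum>s<m. ln |W (n + s)|)\<close>, passing from \<open>n\<close> to \<open>n + 1\<close> replaces the first summand by
  \<open>ln |W (n + m)|\<close> and so adds at most the logarithm of the block of length \<open>m\<close> at \<open>n\<close>.
\<close>
lemma ln_window_block_average:
  "(\<Sum>s<m. ln (norm (window a j (n + s)))) \<le> (\<Sum>s<m. ln (norm (window a j s))) + (\<Sum>i<n. ln (norm (window a (j + int i) m)))"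
proof (induction n)
  case (Suc n)
  have "(\<Sum>s<m. ln (norm (window a j (Suc n + s)))) + ln (norm (window a j n))
      = (\<Sum>s<Suc m. ln (norm (window a j (n + s))))"
    by (subst sum.lessThan_Suc_shift) simp
  also have "\<dots> = (\<Sum>s<m. ln (norm (window a j (n + s)))) + ln (norm (window a j (n + m)))" by simp
  also have "ln (norm (window a j (n + m))) \<le> ln (norm (window a (j + int n) m)) + ln (norm (window a j n))"
    by (rule ln_window_add)
  finally show ?case using Suc by simp
qed simp

lemma ln_norm_window_nonneg: "0 \<le> ln (norm (window a j n))"
  using norm_window_ge_1[of a j n] by simp

text \<open>
  The windows of length \<open>n\<close> and \<open>n + s\<close> with \<open>s < m\<close> differ
  by a short window, hence by a constant on the logarithmic scale; this turns the telescoped sum of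
  \<open>ln_window_block_average\<close> into a bound for a single window. Blocks beyond
  \<open>n\<close> may be added since their logarithms are nonnegative.
\<close>
lemma ln_window_le_blocks:
  assumes R: "\<And>i. cmod (a i) \<le> R" and n: "n \<le> q"
  shows "real m * ln (norm (window a j n)) \<le> (\<Sum>i<q. ln (norm (window a (j + int i) m)))
    + 2 * real m * (ln 2 + real m * ln (R + 2))"
proof -
  have R0: "0 \<le> R" using order_trans[OF norm_ge_zero R] .
  have short: "ln (norm (window a j s)) \<le> ln 2 + real m * ln (R + 2)" if "s < m" for j s
  proof -
    have "ln (norm (window a j s)) \<le> ln (2 * (R + 2) ^ s)"
      using norm_window_le_power[where a = a and R = R and j = j and n = s, OF R] norm_window_pos[of a j s] R0
      by (subst ln_le_cancel_iff) auto
    also have "\<dots> = ln 2 + real s * ln (R + 2)" using R0 by (simp add: ln_mult ln_realpow)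
    also have "real s * ln (R + 2) \<le> real m * ln (R + 2)" using that R0 by (intro mult_right_mono) auto
    finally show ?thesis by simp
  qed
  have "ln (norm (window a j n)) \<le> ln (norm (window a j (n + s))) + ln (norm (window a (j + int n) s))" for s
  proof -
    have "ln (norm (window a j n)) \<le> ln (norm (window a j (n + s)) * norm (window a (j + int n) s))"
      by (subst ln_le_cancel_iff) (auto intro: mult_pos_pos norm_window_pos window_norm_inverse)
    then show ?thesis
      using norm_window_pos[of a j "n + s"] norm_window_pos[of a "j + int n" s] by (simp add: ln_mult)
  qed
  then have "(\<Sum>s<m. ln (norm (window a j n))) \<le> (\<Sum>s<m. ln (norm (window a j (n + s))) + ln (norm (window a (j + int n) s)))"
    by (intro sum_mono)
  also have "\<dots> \<le> ((\<Sum>s<m. ln (norm (window a j s))) + (\<Sum>i<n. ln (norm (window a (j + int i) m))))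
      + (\<Sum>s<m. ln (norm (window a (j + int n) s)))"
    unfolding sum.distrib by (intro add_right_mono ln_window_block_average)
  also have "\<dots> \<le> ((\<Sum>s<m. ln 2 + real m * ln (R + 2)) + (\<Sum>i<q. ln (norm (window a (j + int i) m))))
      + (\<Sum>s<m. ln 2 + real m * ln (R + 2))"
    using n by (intro add_mono sum_mono sum_mono2 short ln_norm_window_nonneg) auto
  finally show ?thesis by (simp add: algebra_simps)
qed

section \<open>The Lyapunov exponent as an average\<close>

definition cmat_of_real :: "real^2^2 \<Rightarrow> cmat" where
  "cmat_of_real A = (\<chi> i j. complex_of_real (A $ i $ j))"

lemma cmat_of_real_mult: "cmat_of_real (A ** B) = cmat_of_real A ** cmat_of_real B"
  by (simp add: cmat_eq_iff cmat_of_real_def cmat_mult_nth matrix_matrix_mult_def sum_2)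

lemma cmat_of_real_transfer_product:
  "cmat_of_real (transfer_product V \<alpha> n \<theta> E) = window (energies V \<theta> \<alpha> E) 1 n"
proof (induction n)
  case 0
  show ?case by (simp add: cmat_of_real_def mat_def vec_eq_iff)
next
  case (Suc n)
  have "cmat_of_real (transfer_matrix V (\<theta> + real (Suc n) * \<alpha>) E) = step (complex_of_real (E - V (\<theta> + of_int (1 + int n) * \<alpha>)))"
    by (simp add: cmat_eq_iff cmat_of_real_def transfer_matrix_def)
  then show ?case using Suc by (simp add: cmat_of_real_mult)
qed

lemma onorm_le_norm_cmat: "onorm ((*v) (A::real^2^2)) \<le> norm (cmat_of_real A)"
proof (rule onorm_bound)
  fix x :: "real^2"
  define c where "c y = (\<chi> i. complex_of_real (y $ i))" for y :: "real^2"
  have nc: "norm (c y) = norm y" for y by (simp add: c_def norm_vec_def)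
  have "c (A *v x) = cmat_of_real A *v c x"
    by (simp add: vec_eq_iff c_def cmat_of_real_def matrix_vector_mult_def)
  then show "norm (A *v x) \<le> norm (cmat_of_real A) * norm x"
    using norm_cmat_vec[of "cmat_of_real A" "c x"] nc by metis
qed simp

text \<open>
  The columns are images of unit vectors. Up to this factor 2, which disappears in the Lyapunov
  exponent, the Frobenius norm replaces the operator norm.
\<close>
lemma norm_cmat_le_onorm: "norm (cmat_of_real A) \<le> 2 * onorm ((*v) (A::real^2^2))"
proof (rule power2_le_imp_le)
  have col: "(norm (A *v axis k 1))\<^sup>2 \<le> (onorm ((*v) A))\<^sup>2" for k
    using onorm[OF matrix_vector_mul_bounded_linear[of A], of "axis k 1"] by (intro power_mono) auto
  have "(norm (A *v axis k 1))\<^sup>2 = (A$1$k)\<^sup>2 + (A$2$k)\<^sup>2" for k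
    unfolding matrix_vector_mul_component
    by (simp add: norm_vec_def L2_set_def sum_2 matrix_vector_mult_basis column_def)
  then have "(norm (cmat_of_real A))\<^sup>2 = (norm (A *v axis 1 1))\<^sup>2 + (norm (A *v axis 2 1))\<^sup>2"
    by (simp add: norm_cmat_sq cmat_of_real_def)
  also have "\<dots> \<le> (2 * onorm ((*v) A))\<^sup>2"
  proof -
    have "(2 * onorm ((*v) A))\<^sup>2 = 4 * (onorm ((*v) A))\<^sup>2" by (simp add: power_mult_distrib)
    then show ?thesis using col[of 1] col[of 2] zero_le_power2[of "onorm ((*v) A)"] by linarith
  qed
  finally show "(norm (cmat_of_real A))\<^sup>2 \<le> (2 * onorm ((*v) A))\<^sup>2" .
qed (simp add: onorm_pos_le)

lemma continuous_on_onorm_matrix: "continuous_on S (\<lambda>A::real^2^2. onorm ((*v) A))"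
proof (rule continuous_on_subset[OF _ subset_UNIV], rule lipschitz_on_continuous_on)
  have tri: "onorm ((*v) A) \<le> onorm ((*v) B) + dist A B" for A B :: "real^2^2"
  proof -
    have e: "(*v) A = (\<lambda>x. B *v x + (A - B) *v x)" by (simp add: matrix_vector_mult_add_rdistrib[symmetric])
    have "onorm ((*v) A) \<le> onorm ((*v) B) + onorm ((*v) (A - B))"
      by (subst e) (intro onorm_triangle matrix_vector_mul_bounded_linear)
    also have "onorm ((*v) (A - B)) \<le> norm (cmat_of_real (A - B))" by (rule onorm_le_norm_cmat)
    also have "\<dots> = dist A B" by (simp add: dist_norm cmat_of_real_def norm_vec_def of_real_diff[symmetric] del: of_real_diff)
    finally show ?thesis by simp
  qed
  show "1-lipschitz_on UNIV (\<lambda>A::real^2^2. onorm ((*v) A))"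
  proof (rule lipschitz_onI)
    fix A B :: "real^2^2"
    show "dist (onorm ((*v) A)) (onorm ((*v) B)) \<le> 1 * dist A B"
      using tri[of A B] tri[of B A] by (simp add: dist_real_def dist_commute abs_le_iff)
  qed simp
qed

lemma lipschitz_potential_diff:
  assumes "\<Lambda>-lipschitz_on UNIV V"
  shows "\<bar>V (\<theta> + of_int i * \<alpha>) - V (\<theta> + of_int i * \<rho>)\<bar> \<le> \<Lambda> * (\<bar>real_of_int i\<bar> * \<bar>\<alpha> - \<rho>\<bar>)"
proof -
  have "dist (V (\<theta> + of_int i * \<alpha>)) (V (\<theta> + of_int i * \<rho>)) \<le> \<Lambda> * dist (\<theta> + of_int i * \<alpha>) (\<theta> + of_int i * \<rho>)"
    using assms by (rule lipschitz_onD) auto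
  also have "dist (\<theta> + of_int i * \<alpha>) (\<theta> + of_int i * \<rho>) = \<bar>real_of_int i\<bar> * \<bar>\<alpha> - \<rho>\<bar>"
    by (simp add: dist_real_def abs_mult[symmetric] algebra_simps)
  finally show ?thesis by (simp add: dist_real_def)
qed

lemma ln_window_perturb:
  assumes R: "\<And>i. cmod (a i) \<le> R" and e: "\<And>i. j \<le> i \<Longrightarrow> i < j + int m \<Longrightarrow> cmod (b i - a i) \<le> e" and e0: "0 \<le> e"
    and small: "2 * real m * (2 * (R + 2) ^ m)\<^sup>2 * e \<le> 1"
  shows "ln (norm (window b j m)) \<le> ln (norm (window a j m)) + 1"
proof -
  define B where "B = 2 * (R + 2) ^ m"
  have R0: "0 \<le> R" using order_trans[OF norm_ge_zero R] .
  have "1 \<le> (R + 2) ^ m" using R0 by (intro one_le_power) simp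
  then have B1: "1 \<le> B" unfolding B_def by linarith
  have wB: "norm (window a i n) \<le> B" if "n \<le> m" for i n
  proof -
    have "norm (window a i n) \<le> 2 * (R + 2) ^ n" by (rule norm_window_le_power) (rule R)
    also have "\<dots> \<le> B" unfolding B_def using that R0 by (intro mult_left_mono power_increasing) auto
    finally show ?thesis .
  qed
  have me: "0 \<le> real m * e" using e0 by simp
  have "1 * (B * (real m * e)) \<le> B * (B * (real m * e))" using B1 me by (intro mult_right_mono) auto
  also have "\<dots> = B\<^sup>2 * (real m * e)" by (simp add: power2_eq_square)
  also have "\<dots> \<le> 1"
  proof -
    have "2 * (B\<^sup>2 * (real m * e)) \<le> 1" using small unfolding B_def[symmetric] by (simp only: mult_ac)
    moreover have "0 \<le> B\<^sup>2 * (real m * e)" using me by simp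
    ultimately show ?thesis by linarith
  qed
  finally have sm: "real m * (B * e) \<le> 1" by (simp add: mult_ac)
  have "norm (window b j m - window a j m) \<le> 2 * real m * B\<^sup>2 * e"
    by (rule window_perturbation(1)[where lo = j and hi = "j + int m" and q = m]) (use wB e e0 sm in auto)
  then have d: "norm (window b j m - window a j m) \<le> 1" using small unfolding B_def by linarith
  have "norm (window b j m) \<le> norm (window b j m - window a j m) + norm (window a j m)"
    by (metis diff_add_cancel norm_triangle_ineq)
  also have "\<dots> \<le> 2 * norm (window a j m)" using d norm_window_ge_1[of a j m] by linarith
  finally have "ln (norm (window b j m)) \<le> ln (2 * norm (window a j m))"
    using norm_window_ge_1[of a j m] norm_window_ge_1[of b j m] by (subst ln_le_cancel_iff) auto
  also have "\<dots> = ln 2 + ln (norm (window a j m))" using less_le_trans[OF zero_less_one norm_window_ge_1[of a j m]] by (simp add: ln_mult)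
  also have "ln 2 \<le> (1::real)" using ln_2_less_1 by simp
  finally show ?thesis by simp
qed

lemma continuous_on_window_entry:
  assumes "\<And>i. continuous_on S (\<lambda>x. a x i)"
  shows "continuous_on S (\<lambda>x. window (a x) j n $ r $ s)"
proof (induction n arbitrary: r)
  case (Suc n)
  consider "r = 1" | "r = 2" using exhaust_2 by blast
  then show ?case
    by cases (simp_all add: cmat_mult_nth, intro continuous_intros assms Suc, rule Suc)
qed simp

context
  fixes V :: "real \<Rightarrow> real" and \<alpha> \<Lambda> b E :: real
  assumes per: "\<And>x. V (x + 1) = V x" and lip: "\<Lambda>-lipschitz_on UNIV V" and bV: "\<And>x. \<bar>V x\<bar> \<le> b"
begin

definition log_norm :: "nat \<Rightarrow> real \<Rightarrow> real" where
  "log_norm n x = ln (norm (window (energies V x \<alpha> E) 1 n))"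

lemma continuous_on_V: "continuous_on S (\<lambda>x. V (x + c))"
  by (rule continuous_on_compose2[OF lipschitz_on_continuous_on[OF lip]]) (auto intro!: continuous_intros)

lemma continuous_on_log_norm_entry:
  "continuous_on S (\<lambda>x. window (energies V x \<alpha> E) 1 n $ r $ s)"
  by (rule continuous_on_window_entry) (intro continuous_intros continuous_on_V)

lemma continuous_on_log_norm: "continuous_on S (log_norm n)"
proof -
  let ?W = "\<lambda>x. window (energies V x \<alpha> E) 1 n"
  have e: "norm A = sqrt ((cmod (A$1$1))\<^sup>2 + (cmod (A$1$2))\<^sup>2 + (cmod (A$2$1))\<^sup>2 + (cmod (A$2$2))\<^sup>2)" for A :: cmat
    by (simp add: norm_cmat_sq[symmetric])
  have c: "continuous_on S (\<lambda>x. norm (?W x))"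
    unfolding e by (intro continuous_intros continuous_on_log_norm_entry)
  have nz: "norm (?W x) \<noteq> 0" for x
    using norm_window_ge_1[of "\<lambda>i. complex_of_real (E - V (x + of_int i * \<alpha>))" 1 n] by linarith
  have "continuous_on S (\<lambda>x. ln (norm (?W x)))"
    by (rule continuous_on_ln[OF c]) (use nz in blast)
  then show ?thesis by (simp add: log_norm_def[abs_def])
qed

lemma log_norm_periodic: "log_norm n (x + 1) = log_norm n x"
proof -
  have "V (x + 1 + of_int i * \<alpha>) = V (x + of_int i * \<alpha>)" for i
    using per[of "x + of_int i * \<alpha>"] by (simp add: algebra_simps)
  then show ?thesis by (simp add: log_norm_def)
qed

lemma log_norm_nonneg: "0 \<le> log_norm n x"
  unfolding log_norm_def by (rule ln_norm_window_nonneg)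

lemma log_norm_add: "log_norm (m + n) x \<le> log_norm m x + log_norm n (x + real m * \<alpha>)"
proof -
  let ?a = "\<lambda>i. complex_of_real (E - V (x + of_int i * \<alpha>))"
  have "window (energies V (x + real m * \<alpha>) \<alpha> E) 1 n = window (\<lambda>i. ?a (i + int m)) 1 n"
    by (rule window_cong) (simp add: algebra_simps)
  also have "\<dots> = window ?a (1 + int m) n" by (rule window_shift)
  finally have s: "window (energies V (x + real m * \<alpha>) \<alpha> E) 1 n = window ?a (1 + int m) n" .
  have "ln (norm (window ?a 1 (m + n))) \<le> ln (norm (window ?a (1 + int m) n)) + ln (norm (window ?a 1 m))"
    by (rule ln_window_add)
  then show ?thesis unfolding log_norm_def s by (simp only: add.commute)
qed

lemma integrable_log_norm: "log_norm n integrable_on {u..w}"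
  by (rule integrable_continuous_interval) (rule continuous_on_log_norm)

lemma integral_log_norm_convergent: "convergent (\<lambda>n. integral {0..1} (log_norm n) / real n)"
proof (rule fekete_convergent)
  fix m n
  have i2: "(\<lambda>x. log_norm n (x + real m * \<alpha>)) integrable_on {0..1}"
    by (rule integrable_continuous_interval, rule continuous_on_compose2[OF continuous_on_log_norm[of UNIV]])
      (auto intro!: continuous_intros)
  have "integral {0..1} (log_norm (m + n)) \<le> integral {0..1} (\<lambda>x. log_norm m x + log_norm n (x + real m * \<alpha>))"
    by (intro integral_le integrable_add integrable_log_norm i2 log_norm_add)
  also have "\<dots> = integral {0..1} (log_norm m) + integral {0..1} (\<lambda>x. log_norm n (x + real m * \<alpha>))"
    by (intro integral_add integrable_log_norm i2)
  also have "integral {0..1} (\<lambda>x. log_norm n (x + real m * \<alpha>)) = integral {0..1} (log_norm n)"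
    by (rule integral_periodic_shift[OF log_norm_periodic continuous_on_log_norm])
  finally show "integral {0..1} (log_norm (m + n)) \<le> integral {0..1} (log_norm m) + integral {0..1} (log_norm n)" .
  show "0 \<le> integral {0..1} (log_norm n)" by (intro integral_nonneg integrable_log_norm log_norm_nonneg)
qed

text \<open>
  The Lyapunov exponent is defined through \<open>lim\<close>, so it carries information only once
  convergence is known; that is Fekete's lemma for the Frobenius norm, and the operator norm differs
  from it by at most \<open>ln 2\<close> on the logarithmic scale.
\<close>
lemma lyapunov_eq_limit: "(\<lambda>n. integral {0..1} (log_norm n) / real n) \<longlonglongrightarrow> lyapunov V \<alpha> E"
proof -
  define f where "f n \<theta> = ln (onorm ((*v) (transfer_product V \<alpha> n \<theta> E)))" for n \<theta>
  define A where "A n \<theta> = norm (cmat_of_real (transfer_product V \<alpha> n \<theta> E))" for n \<theta>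
  have A: "log_norm n \<theta> = ln (A n \<theta>)" "1 \<le> A n \<theta>" for n \<theta>
    unfolding A_def cmat_of_real_transfer_product by (simp_all add: log_norm_def norm_window_ge_1 del: of_real_diff)
  have o: "onorm ((*v) (transfer_product V \<alpha> n \<theta> E)) \<le> A n \<theta>" "A n \<theta> \<le> 2 * onorm ((*v) (transfer_product V \<alpha> n \<theta> E))"
    for n \<theta> unfolding A_def by (rule onorm_le_norm_cmat, rule norm_cmat_le_onorm)
  have opos: "0 < onorm ((*v) (transfer_product V \<alpha> n \<theta> E))" for n \<theta>
    using o(2)[of n \<theta>] A(2)[of n \<theta>] by linarith
  have fle: "f n \<theta> \<le> log_norm n \<theta>" "log_norm n \<theta> \<le> ln 2 + f n \<theta>" for n \<theta>
  proof -
    show "f n \<theta> \<le> log_norm n \<theta>" unfolding A(1) f_def using o opos A(2)[of n \<theta>] by (subst ln_le_cancel_iff) auto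
    have "ln (A n \<theta>) \<le> ln (2 * onorm ((*v) (transfer_product V \<alpha> n \<theta> E)))"
      using o opos A(2)[of n \<theta>] by (subst ln_le_cancel_iff) auto
    also have "\<dots> = ln 2 + f n \<theta>" unfolding f_def using opos[of n \<theta>] by (simp add: ln_mult)
    finally show "log_norm n \<theta> \<le> ln 2 + f n \<theta>" unfolding A(1) .
  qed
  have fc: "continuous_on S (f n)" for S n
  proof -
    have "continuous_on S (\<lambda>\<theta>. transfer_product V \<alpha> n \<theta> E)"
    proof -
      have "transfer_product V \<alpha> n \<theta> E = (\<chi> i j. Re (cmat_of_real (transfer_product V \<alpha> n \<theta> E) $ i $ j))" for \<theta>
        by (simp add: cmat_of_real_def vec_eq_iff)
      then show ?thesis unfolding cmat_of_real_transfer_product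
        by (simp only:) (intro continuous_on_vec_lambda continuous_on_Re continuous_on_log_norm_entry)
    qed
    from continuous_on_compose2[OF continuous_on_onorm_matrix[of UNIV] this]
    have "continuous_on S (\<lambda>\<theta>. onorm ((*v) (transfer_product V \<alpha> n \<theta> E)))" by simp
    from continuous_on_ln[OF this] show ?thesis using opos by (simp add: f_def[abs_def] less_imp_neq[symmetric])
  qed
  have fint: "f n integrable_on {0..1}" for n by (rule integrable_continuous_interval) (rule fc)
  have L: "(LBINT \<theta>:{0..1}. f n \<theta>) = integral {0..1} (f n)" for n
    by (rule set_borel_integral_eq_integral(2)[OF borel_integrable_atLeastAtMost'[OF fc]])
  define g where "g n = integral {0..1} (log_norm n)" for n
  have up: "integral {0..1} (f n) \<le> g n" for n
    unfolding g_def by (intro integral_le fint integrable_log_norm fle)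
  have "g n \<le> integral {0..1} (\<lambda>\<theta>. ln 2 + f n \<theta>)" for n
    unfolding g_def by (intro integral_le integrable_add integrable_const_ivl fint integrable_log_norm fle)
  also have "integral {0..1} (\<lambda>\<theta>. ln 2 + f n \<theta>) = ln 2 + integral {0..1} (f n)" for n
    by (subst integral_add) (auto intro: fint)
  finally have down: "g n \<le> ln 2 + integral {0..1} (f n)" for n .
  obtain l where l: "(\<lambda>n. g n / real n) \<longlonglongrightarrow> l"
    using integral_log_norm_convergent unfolding g_def convergent_def by blast
  have "(\<lambda>n. integral {0..1} (f n) / real n - g n / real n) \<longlonglongrightarrow> 0"
  proof (rule Lim_null_comparison)
    show "\<forall>\<^sub>F n in sequentially. norm (integral {0..1} (f n) / real n - g n / real n) \<le> ln 2 / real n"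
    proof (rule always_eventually, rule allI)
      fix n
      have "\<bar>integral {0..1} (f n) - g n\<bar> \<le> ln 2" using up[of n] down[of n] by (simp add: abs_le_iff)
      then have "\<bar>integral {0..1} (f n) - g n\<bar> / real n \<le> ln 2 / real n" by (intro divide_right_mono) auto
      then show "norm (integral {0..1} (f n) / real n - g n / real n) \<le> ln 2 / real n"
        by (simp add: diff_divide_distrib[symmetric])
    qed
    show "(\<lambda>n. ln 2 / real n) \<longlonglongrightarrow> 0" by (rule lim_const_over_n)
  qed
  from tendsto_add[OF this l] have "(\<lambda>n. integral {0..1} (f n) / real n) \<longlonglongrightarrow> l" by simp
  then have "lyapunov V \<alpha> E = l" unfolding lyapunov_def f_def[symmetric] L by (rule limI)
  then show ?thesis using l by (simp add: g_def)
qed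

text \<open>
  Fix one block length \<open>m\<close> for which the mean of \<open>log_norm m / m\<close> is below
  \<open>\<gamma> / 2\<close>. Blocks of length \<open>m\<close> depend continuously on energy and
  frequency, so they can be compared with those at \<open>E\<close> and \<open>\<alpha>\<close>, and
  their sum over the rational orbit is controlled by \<open>sum_rational_rotation_le\<close>.
\<close>
lemma subexponential_windows:
  assumes zero: "lyapunov V \<alpha> E = 0" and \<gamma>: "0 < \<gamma>"
  obtains \<delta> K q0 where "0 < \<delta>"
    "\<And>q p E' \<theta> j n. q0 \<le> q \<Longrightarrow> coprime p (int q) \<Longrightarrow> \<bar>\<alpha> - of_int p / real q\<bar> \<le> 1 / real q \<Longrightarrow> \<bar>E' - E\<bar> \<le> \<delta> \<Longrightarrow> n \<le> q
      \<Longrightarrow> norm (window (energies V \<theta> (of_int p / real q) E') j n) \<le> exp (K + \<gamma> * real q)"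
proof -
  have "\<forall>\<^sub>F n in sequentially. integral {0..1} (log_norm n) / real n < \<gamma> / 2"
    using lyapunov_eq_limit zero \<gamma> by (intro order_tendstoD(2)) auto
  then obtain m0 where m0: "\<And>n. m0 \<le> n \<Longrightarrow> integral {0..1} (log_norm n) / real n < \<gamma> / 2"
    unfolding eventually_sequentially by blast
  define m where "m = max m0 (Suc (nat \<lceil>4 / \<gamma>\<rceil>))"
  have m: "1 \<le> m" "integral {0..1} (log_norm m) / real m < \<gamma> / 2" "4 / \<gamma> \<le> real m"
  proof -
    show "1 \<le> m" by (simp add: m_def)
    show "integral {0..1} (log_norm m) / real m < \<gamma> / 2" by (intro m0) (simp add: m_def)
    have "4 / \<gamma> \<le> real (Suc (nat \<lceil>4 / \<gamma>\<rceil>))" by linarith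
    also have "\<dots> \<le> real m" unfolding m_def by (simp only: of_nat_le_iff max.cobounded2)
    finally show "4 / \<gamma> \<le> real m" .
  qed
  have \<Lambda>: "0 \<le> \<Lambda>" using lip by (rule lipschitz_on_nonneg)
  have b0: "0 \<le> b" using order_trans[OF abs_ge_zero bV[of 0]] .
  define R where "R = \<bar>E\<bar> + 1 + b"
  define C where "C = 2 * real m * (2 * (R + 2) ^ m)\<^sup>2"
  have C: "1 \<le> C"
  proof -
    have "1 \<le> (R + 2) ^ m" using b0 by (intro one_le_power) (simp add: R_def)
    then have "1 \<le> 2 * (R + 2) ^ m" by linarith
    then have "1 \<le> (2 * (R + 2) ^ m)\<^sup>2" by (rule one_le_power)
    then have "1 * 1 \<le> 2 * real m * (2 * (R + 2) ^ m)\<^sup>2" using m by (intro mult_mono) auto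
    then show ?thesis by (simp add: C_def)
  qed
  \<comment> \<open>Half of the tolerance \<open>1 / C\<close> of \<open>ln_window_perturb\<close> goes to the energy, half to the frequency.\<close>
  define \<delta> where "\<delta> = 1 / (2 * C)"
  have \<delta>: "0 < \<delta>" "\<delta> \<le> 1" "C * \<delta> = 1 / 2" using C by (auto simp: \<delta>_def)
  define q0 where "q0 = Suc (nat \<lceil>2 * C * \<Lambda> * real m\<rceil>)"
  define K where "K = 2 * (ln 2 + real m * ln (R + 2))"
  show thesis
  proof (rule that[OF \<delta>(1)])
    fix q :: nat and p :: int and E' \<theta> :: real and j :: int and n :: nat
    assume q: "q0 \<le> q" and pq: "coprime p (int q)" and close: "\<bar>\<alpha> - of_int p / real q\<bar> \<le> 1 / real q"
      and E': "\<bar>E' - E\<bar> \<le> \<delta>" and n: "n \<le> q"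
    define \<rho> where "\<rho> = of_int p / real q"
    define a where "a i = complex_of_real (E' - V (\<theta> + of_int i * \<rho>))" for i :: int
    define y where "y = \<theta> + of_int (j - 1) * \<rho>"
    have q_pos: "0 < q" using q by (simp add: q0_def)
    have qm: "C * (\<Lambda> * (real m / real q)) \<le> 1 / 2"
    proof -
      have "2 * C * \<Lambda> * real m \<le> real q0" unfolding q0_def by linarith
      also have "\<dots> \<le> real q" using q by simp
      finally show ?thesis using q_pos by (simp add: field_simps)
    qed
    have aR: "cmod (a i) \<le> R" for i
    proof -
      have "cmod (a i) = \<bar>E' - V (\<theta> + of_int i * \<rho>)\<bar>" unfolding a_def by (rule norm_of_real)
      also have "\<dots> \<le> R" using bV[of "\<theta> + of_int i * \<rho>"] E' \<delta>(2) unfolding R_def by linarith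
      finally show ?thesis .
    qed
    have ER: "cmod (complex_of_real (E - V x)) \<le> R" for x
    proof -
      have "cmod (complex_of_real (E - V x)) = \<bar>E - V x\<bar>" by (rule norm_of_real)
      also have "\<dots> \<le> R" using bV[of x] unfolding R_def by linarith
      finally show ?thesis .
    qed
    have block: "ln (norm (window a (j + int i) m)) \<le> log_norm m (y + of_int (int i * p) / real q) + 1" for i :: nat
    proof -
      define x where "x = y + of_int (int i * p) / real q"
      have xe: "x + of_int k * \<rho> = \<theta> + of_int (k + (j + int i - 1)) * \<rho>" for k :: int
        by (simp add: x_def y_def \<rho>_def algebra_simps add_divide_distrib diff_divide_distrib)
      have "window (energies V x \<rho> E') 1 m = window (\<lambda>k. a (k + (j + int i - 1))) 1 m"
        by (rule window_cong) (simp only: xe a_def)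
      also have "\<dots> = window a (j + int i) m" by (simp add: window_shift)
      finally have w: "window a (j + int i) m = window (energies V x \<rho> E') 1 m" by simp
      show ?thesis unfolding w log_norm_def x_def[symmetric]
      proof (rule ln_window_perturb[where R = R and e = "\<delta> + \<Lambda> * (real m / real q)"])
        show "cmod (complex_of_real (E - V (x + of_int i * \<alpha>))) \<le> R" for i by (rule ER)
        show "cmod (complex_of_real (E' - V (x + of_int k * \<rho>)) - complex_of_real (E - V (x + of_int k * \<alpha>))) \<le> \<delta> + \<Lambda> * (real m / real q)"
          if k: "1 \<le> k" "k < 1 + int m" for k
        proof -
          have "cmod (complex_of_real (E' - V (x + of_int k * \<rho>)) - complex_of_real (E - V (x + of_int k * \<alpha>)))
            = \<bar>(E' - E) + (V (x + of_int k * \<alpha>) - V (x + of_int k * \<rho>))\<bar>"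
            unfolding of_real_diff[symmetric] norm_of_real by (simp add: algebra_simps)
          also have "\<dots> \<le> \<bar>E' - E\<bar> + \<bar>V (x + of_int k * \<alpha>) - V (x + of_int k * \<rho>)\<bar>" by (rule abs_triangle_ineq)
          also have "\<bar>V (x + of_int k * \<alpha>) - V (x + of_int k * \<rho>)\<bar> \<le> \<Lambda> * (\<bar>real_of_int k\<bar> * \<bar>\<alpha> - \<rho>\<bar>)"
            by (rule lipschitz_potential_diff[OF lip])
          also have "\<bar>real_of_int k\<bar> * \<bar>\<alpha> - \<rho>\<bar> \<le> real m * (1 / real q)"
            using k close unfolding \<rho>_def by (intro mult_mono) linarith+
          finally show ?thesis using E' \<Lambda> by (simp add: mult_left_mono)
        qed
        show "0 \<le> \<delta> + \<Lambda> * (real m / real q)" using \<delta> \<Lambda> by simp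
        show "2 * real m * (2 * (R + 2) ^ m)\<^sup>2 * (\<delta> + \<Lambda> * (real m / real q)) \<le> 1"
          unfolding C_def[symmetric] distrib_left using \<delta>(3) qm by linarith
      qed
    qed
    have osc: "log_norm m x \<le> log_norm m (x + t) + 1" if t: "0 \<le> t" "t \<le> 1 / real q" for x t
      unfolding log_norm_def
    proof (rule ln_window_perturb[where R = R and e = "\<Lambda> * (1 / real q)"])
      show "cmod (complex_of_real (E - V (x + t + of_int i * \<alpha>))) \<le> R" for i by (rule ER)
      show "cmod (complex_of_real (E - V (x + of_int i * \<alpha>)) - complex_of_real (E - V (x + t + of_int i * \<alpha>))) \<le> \<Lambda> * (1 / real q)" for i
      proof -
        have "cmod (complex_of_real (E - V (x + of_int i * \<alpha>)) - complex_of_real (E - V (x + t + of_int i * \<alpha>)))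
          = \<bar>V (x + t + of_int i * \<alpha>) - V (x + of_int i * \<alpha>)\<bar>"
          unfolding of_real_diff[symmetric] norm_of_real by (simp add: algebra_simps)
        also have "\<dots> \<le> \<Lambda> * t"
          using lipschitz_onD[OF lip, of "x + t + of_int i * \<alpha>" "x + of_int i * \<alpha>"] t by (simp add: dist_real_def)
        also have "\<dots> \<le> \<Lambda> * (1 / real q)" using t \<Lambda> by (intro mult_left_mono)
        finally show ?thesis .
      qed
      have "C * (\<Lambda> * (1 / real q)) \<le> C * (\<Lambda> * (real m / real q))"
        using C \<Lambda> m by (intro mult_left_mono divide_right_mono) auto
      then show "2 * real m * (2 * (R + 2) ^ m)\<^sup>2 * (\<Lambda> * (1 / real q)) \<le> 1"
        unfolding C_def[symmetric] using qm by linarith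
    qed (use \<Lambda> in simp)
    have "real m * ln (norm (window a j n)) \<le> (\<Sum>i<q. ln (norm (window a (j + int i) m))) + real m * K"
      using ln_window_le_blocks[where a = a and R = R and n = n and q = q and j = j and m = m, OF aR n] by (simp add: K_def mult_ac)
    also have "(\<Sum>i<q. ln (norm (window a (j + int i) m))) \<le> (\<Sum>i<q. log_norm m (y + of_int (int i * p) / real q) + 1)"
      by (intro sum_mono block)
    also have "\<dots> = (\<Sum>i<q. log_norm m (y + of_int (int i * p) / real q)) + real q" by (simp add: sum.distrib)
    also have "(\<Sum>i<q. log_norm m (y + of_int (int i * p) / real q)) \<le> real q * integral {0..1} (log_norm m) + real q"
      by (rule sum_rational_rotation_le[OF log_norm_periodic continuous_on_log_norm q_pos pq osc])
    finally have "real m * ln (norm (window a j n)) \<le> real q * integral {0..1} (log_norm m) + 2 * real q + real m * K" by simp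
    also have "integral {0..1} (log_norm m) \<le> real m * (\<gamma> / 2)" using m(1,2) by (simp add: field_simps)
    then have "real q * integral {0..1} (log_norm m) \<le> real q * (real m * (\<gamma> / 2))" by (rule mult_left_mono) simp
    also have "2 * real q \<le> real q * (real m * (\<gamma> / 2))"
    proof -
      have "2 \<le> real m * (\<gamma> / 2)" using m(3) \<gamma> by (simp add: field_simps)
      then have "real q * 2 \<le> real q * (real m * (\<gamma> / 2))" by (rule mult_left_mono) simp
      then show ?thesis by simp
    qed
    finally have "real m * ln (norm (window a j n)) \<le> real m * (K + \<gamma> * real q)" by (simp add: algebra_simps)
    then have "ln (norm (window a j n)) \<le> K + \<gamma> * real q" using m(1) by simp
    then have "norm (window a j n) \<le> exp (K + \<gamma> * real q)"
      using norm_window_ge_1[of a j n] by (metis exp_le_cancel_iff exp_ln less_le_trans zero_less_one)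
    then show "norm (window (energies V \<theta> (of_int p / real q) E') j n) \<le> exp (K + \<gamma> * real q)"
      by (simp add: a_def[abs_def] \<rho>_def)
  qed
qed

end

section \<open>Continued fraction approximation\<close>

text \<open>
  Numerators of the convergents whose denominators are \<open>cf_denom\<close>.
\<close>
fun cf_num :: "real \<Rightarrow> nat \<Rightarrow> int" where
  "cf_num \<alpha> 0 = cf_coeff \<alpha> 0"
| "cf_num \<alpha> (Suc 0) = cf_coeff \<alpha> 1 * cf_coeff \<alpha> 0 + 1"
| "cf_num \<alpha> (Suc (Suc n)) = cf_coeff \<alpha> (Suc (Suc n)) * cf_num \<alpha> (Suc n) + cf_num \<alpha> n"

context
  fixes \<alpha> :: real
  assumes irrational: "\<alpha> \<notin> \<rat>"
begin

lemma cf_quotient_irrational: "cf_quotient \<alpha> n \<notin> \<rat>"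
proof (induction n)
  case (Suc n)
  have "frac (cf_quotient \<alpha> n) \<notin> \<rat>"
  proof
    assume "frac (cf_quotient \<alpha> n) \<in> \<rat>"
    then have "frac (cf_quotient \<alpha> n) + of_int \<lfloor>cf_quotient \<alpha> n\<rfloor> \<in> \<rat>" by simp
    then show False using Suc by (simp add: frac_def)
  qed
  then have "inverse (1 / frac (cf_quotient \<alpha> n)) \<notin> \<rat>" by simp
  then show ?case using Rats_inverse[of "cf_quotient \<alpha> (Suc n)"] by auto
qed (use irrational in simp)

lemma cf_frac_bounds: "0 < frac (cf_quotient \<alpha> n)" "frac (cf_quotient \<alpha> n) < 1"
proof -
  have "cf_quotient \<alpha> n \<notin> \<int>" using cf_quotient_irrational[of n] Ints_subset_Rats by blast
  then show "0 < frac (cf_quotient \<alpha> n)" by (simp add: frac_gt_0_iff)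
qed (rule frac_lt_1)

lemma cf_quotient_eq: "cf_quotient \<alpha> n = of_int (cf_coeff \<alpha> n) + 1 / cf_quotient \<alpha> (Suc n)"
  using cf_frac_bounds[of n] by (simp add: cf_coeff_def frac_def)

lemma cf_quotient_Suc_gt_1: "1 < cf_quotient \<alpha> (Suc n)"
  using cf_frac_bounds[of n] by simp

lemma cf_coeff_Suc_ge_1: "1 \<le> cf_coeff \<alpha> (Suc n)"
  using cf_quotient_Suc_gt_1[of n] unfolding cf_coeff_def by (simp add: le_floor_iff del: cf_quotient.simps)

lemma cf_denom_pos: "0 < cf_denom \<alpha> n"
proof (induction n rule: less_induct)
  case (less n)
  consider "n = 0" | "n = Suc 0" | m where "n = Suc (Suc m)" by (metis not0_implies_Suc)
  then show ?case
  proof cases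
    case 2
    then show ?thesis using cf_coeff_Suc_ge_1[of 0] by simp
  next
    case (3 m)
    then show ?thesis
      using less.IH[of m] less.IH[of "Suc m"] cf_coeff_Suc_ge_1[of "Suc m"]
      by (auto intro!: add_pos_pos mult_pos_pos)
  qed auto
qed

lemma cf_denom_growth: "int n \<le> cf_denom \<alpha> n"
proof (induction n rule: less_induct)
  case (less n)
  consider "n = 0" | "n = Suc 0" | m where "n = Suc (Suc m)" by (metis not0_implies_Suc)
  then show ?case
  proof cases
    case 2
    then show ?thesis using cf_coeff_Suc_ge_1[of 0] by simp
  next
    case (3 m)
    have "1 * cf_denom \<alpha> (Suc m) \<le> cf_coeff \<alpha> (Suc (Suc m)) * cf_denom \<alpha> (Suc m)"
      using cf_coeff_Suc_ge_1[of "Suc m"] cf_denom_pos[of "Suc m"] by (intro mult_right_mono) auto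
    moreover have "int (Suc m) \<le> cf_denom \<alpha> (Suc m)" using less.IH[of "Suc m"] 3 by simp
    ultimately show ?thesis
      using cf_denom_pos[of m] unfolding 3 cf_denom.simps by linarith
  qed auto
qed

lemma cf_determinant: "cf_num \<alpha> (Suc n) * cf_denom \<alpha> n - cf_num \<alpha> n * cf_denom \<alpha> (Suc n) = (- 1) ^ n"
proof (induction n)
  case (Suc n)
  have "cf_num \<alpha> (Suc (Suc n)) * cf_denom \<alpha> (Suc n) - cf_num \<alpha> (Suc n) * cf_denom \<alpha> (Suc (Suc n))
      = - (cf_num \<alpha> (Suc n) * cf_denom \<alpha> n - cf_num \<alpha> n * cf_denom \<alpha> (Suc n))"
    by (simp add: algebra_simps)
  then show ?case using Suc by simp
qed simp

lemma coprime_cf_num_denom: "coprime (cf_num \<alpha> n) (cf_denom \<alpha> n)"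
proof (rule coprimeI)
  fix d assume "d dvd cf_num \<alpha> n" "d dvd cf_denom \<alpha> n"
  then have "d dvd cf_num \<alpha> (Suc n) * cf_denom \<alpha> n - cf_num \<alpha> n * cf_denom \<alpha> (Suc n)"
    by (intro dvd_diff) auto
  then show "is_unit d" unfolding cf_determinant by (cases "even n") auto
qed

text \<open>
  This is \<open>\<alpha> = (x p\<^sub>n + p\<^sub>n\<^sub>-\<^sub>1) / (x q\<^sub>n +
  q\<^sub>n\<^sub>-\<^sub>1)\<close>, where \<open>x\<close> is the complete quotient following the
  \<open>n\<close>-th convergent, with the denominator cleared.
\<close>
lemma cf_complete_quotient:
  "\<alpha> * (cf_quotient \<alpha> (Suc (Suc n)) * of_int (cf_denom \<alpha> (Suc n)) + of_int (cf_denom \<alpha> n))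
    = cf_quotient \<alpha> (Suc (Suc n)) * of_int (cf_num \<alpha> (Suc n)) + of_int (cf_num \<alpha> n)"
proof (induction n)
  case 0
  define x where "x = cf_quotient \<alpha> (Suc 0)"
  define y where "y = cf_quotient \<alpha> (Suc (Suc 0))"
  have x: "\<alpha> = of_int (cf_coeff \<alpha> 0) + 1 / x" using cf_quotient_eq[of 0] by (simp add: x_def)
  have y: "x = of_int (cf_coeff \<alpha> 1) + 1 / y" using cf_quotient_eq[of 1] by (simp add: x_def y_def del: cf_quotient.simps)
  have pos: "1 < x" "1 < y" unfolding x_def y_def by (rule cf_quotient_Suc_gt_1)+
  have "y * of_int (cf_coeff \<alpha> 1) + 1 = x * y" using y pos by (simp add: field_simps)
  moreover have "\<alpha> * (x * y) = x * y * of_int (cf_coeff \<alpha> 0) + y" using pos by (subst x) (simp add: field_simps)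
  moreover have "y * of_int (cf_num \<alpha> 1) + of_int (cf_num \<alpha> 0) = (y * of_int (cf_coeff \<alpha> 1) + 1) * of_int (cf_coeff \<alpha> 0) + y"
    by (simp add: algebra_simps)
  moreover have "y * of_int (cf_denom \<alpha> 1) + of_int (cf_denom \<alpha> 0) = y * of_int (cf_coeff \<alpha> 1) + 1"
    by simp
  ultimately show ?case
    unfolding y_def[symmetric] unfolding One_nat_def[symmetric] by (simp del: cf_num.simps cf_denom.simps)
next
  case (Suc n)
  define x where "x = cf_quotient \<alpha> (Suc (Suc n))"
  define y where "y = cf_quotient \<alpha> (Suc (Suc (Suc n)))"
  have y: "x = of_int (cf_coeff \<alpha> (Suc (Suc n))) + 1 / y"
    using cf_quotient_eq[of "Suc (Suc n)"] by (simp add: x_def y_def del: cf_quotient.simps)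
  have pos: "1 < y" unfolding y_def by (rule cf_quotient_Suc_gt_1)
  have xy: "y * of_int (cf_coeff \<alpha> (Suc (Suc n))) = x * y - 1" using y pos by (simp add: field_simps)
  have "y * of_int (cf_denom \<alpha> (Suc (Suc n))) + of_int (cf_denom \<alpha> (Suc n))
      = (y * of_int (cf_coeff \<alpha> (Suc (Suc n)))) * of_int (cf_denom \<alpha> (Suc n)) + y * of_int (cf_denom \<alpha> n) + of_int (cf_denom \<alpha> (Suc n))"
    by (simp add: algebra_simps)
  also have "\<dots> = y * (x * of_int (cf_denom \<alpha> (Suc n)) + of_int (cf_denom \<alpha> n))"
    unfolding xy by (simp add: algebra_simps)
  finally have d: "y * of_int (cf_denom \<alpha> (Suc (Suc n))) + of_int (cf_denom \<alpha> (Suc n))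
      = y * (x * of_int (cf_denom \<alpha> (Suc n)) + of_int (cf_denom \<alpha> n))" .
  have "y * of_int (cf_num \<alpha> (Suc (Suc n))) + of_int (cf_num \<alpha> (Suc n))
      = (y * of_int (cf_coeff \<alpha> (Suc (Suc n)))) * of_int (cf_num \<alpha> (Suc n)) + y * of_int (cf_num \<alpha> n) + of_int (cf_num \<alpha> (Suc n))"
    by (simp add: algebra_simps)
  also have "\<dots> = y * (x * of_int (cf_num \<alpha> (Suc n)) + of_int (cf_num \<alpha> n))"
    unfolding xy by (simp add: algebra_simps)
  finally have nn: "y * of_int (cf_num \<alpha> (Suc (Suc n))) + of_int (cf_num \<alpha> (Suc n))
      = y * (x * of_int (cf_num \<alpha> (Suc n)) + of_int (cf_num \<alpha> n))" .
  show ?case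
    unfolding y_def[symmetric] d nn Suc[folded x_def, symmetric] by simp
qed

lemma cf_approximation:
  assumes "1 \<le> n"
  shows "\<bar>\<alpha> - of_int (cf_num \<alpha> n) / of_int (cf_denom \<alpha> n)\<bar>
    \<le> 1 / (of_int (cf_denom \<alpha> n) * of_int (cf_denom \<alpha> (Suc n)))"
proof -
  obtain m where n: "n = Suc m" using assms by (cases n) auto
  define x where "x = cf_quotient \<alpha> (Suc (Suc m))"
  define q where "q = real_of_int (cf_denom \<alpha> (Suc m))"
  define q0 where "q0 = real_of_int (cf_denom \<alpha> m)"
  define p where "p = real_of_int (cf_num \<alpha> (Suc m))"
  define p0 where "p0 = real_of_int (cf_num \<alpha> m)"
  have pos: "0 < q" "0 < q0" using cf_denom_pos by (auto simp: q_def q0_def)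
  have x: "of_int (cf_coeff \<alpha> (Suc (Suc m))) \<le> x" by (simp add: x_def cf_coeff_def del: cf_quotient.simps)
  have x1: "1 < x" unfolding x_def by (rule cf_quotient_Suc_gt_1)
  have e: "\<alpha> * (x * q + q0) = x * p + p0"
    using cf_complete_quotient[of m] unfolding x_def q_def q0_def p_def p0_def .
  have d: "p * q0 - p0 * q = (- 1) ^ m"
    using arg_cong[OF cf_determinant[of m], of real_of_int] by (simp add: q_def q0_def p_def p0_def)
  have S: "of_int (cf_denom \<alpha> (Suc (Suc m))) \<le> x * q + q0"
    using mult_right_mono[OF x, of q] pos by (simp add: q_def q0_def)
  have S0: "0 < real_of_int (cf_denom \<alpha> (Suc (Suc m)))" using cf_denom_pos[of "Suc (Suc m)"] by (simp del: cf_denom.simps)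
  have "(\<alpha> - p / q) * (q * (x * q + q0)) = q * (\<alpha> * (x * q + q0)) - p * (x * q + q0)"
    using pos by (simp add: field_simps)
  also have "\<dots> = - ((- 1) ^ m)" unfolding e d[symmetric] by (simp add: algebra_simps)
  finally have "\<bar>\<alpha> - p / q\<bar> * \<bar>q * (x * q + q0)\<bar> = 1"
    unfolding abs_mult[symmetric] by simp
  then have "\<bar>\<alpha> - p / q\<bar> * (q * (x * q + q0)) = 1"
    using S S0 pos by simp
  then have "\<bar>\<alpha> - p / q\<bar> = 1 / (q * (x * q + q0))"
    by (metis divide_eq_eq mult_zero_right zero_neq_one)
  also have "\<dots> \<le> 1 / (q * of_int (cf_denom \<alpha> (Suc (Suc m))))"
    using S S0 pos by (intro divide_left_mono mult_left_mono mult_pos_pos) auto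
  finally show ?thesis unfolding n p_def q_def .
qed

lemma frequently_good_approximant:
  assumes "ereal \<kappa> < cf_beta \<alpha>"
  obtains p q q' :: int where "int N \<le> q" "coprime p q" "0 < q'"
    "exp (\<kappa> * of_int q) \<le> of_int q'" "\<bar>\<alpha> - of_int p / of_int q\<bar> \<le> 1 / (of_int q * of_int q')"
proof -
  have "\<exists>\<^sub>F n in sequentially. ereal \<kappa> < ereal (ln (of_int (cf_denom \<alpha> (Suc n))) / of_int (cf_denom \<alpha> n))"
  proof (rule ccontr)
    assume "\<not> ?thesis"
    then have "\<forall>\<^sub>F n in sequentially. ereal (ln (of_int (cf_denom \<alpha> (Suc n))) / of_int (cf_denom \<alpha> n)) \<le> ereal \<kappa>"
      by (simp add: not_frequently not_less)
    then have "cf_beta \<alpha> \<le> ereal \<kappa>" unfolding cf_beta_def by (rule Limsup_bounded)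
    then show False using assms by simp
  qed
  then obtain n where n: "Suc N \<le> n" "\<kappa> < ln (of_int (cf_denom \<alpha> (Suc n))) / of_int (cf_denom \<alpha> n)"
    unfolding frequently_sequentially by auto
  show thesis
  proof (rule that)
    show "int N \<le> cf_denom \<alpha> n" using cf_denom_growth[of n] n(1) by linarith
    show "coprime (cf_num \<alpha> n) (cf_denom \<alpha> n)" by (rule coprime_cf_num_denom)
    show "0 < cf_denom \<alpha> (Suc n)" by (rule cf_denom_pos)
    have "\<kappa> * of_int (cf_denom \<alpha> n) \<le> ln (of_int (cf_denom \<alpha> (Suc n)))"
      using n(2) cf_denom_pos[of n] by (simp add: field_simps)
    then show "exp (\<kappa> * of_int (cf_denom \<alpha> n)) \<le> of_int (cf_denom \<alpha> (Suc n))"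
      using cf_denom_pos[of "Suc n"] by (simp add: ln_ge_iff)
    show "\<bar>\<alpha> - of_int (cf_num \<alpha> n) / of_int (cf_denom \<alpha> n)\<bar>
      \<le> 1 / (of_int (cf_denom \<alpha> n) * of_int (cf_denom \<alpha> (Suc n)))"
      using n(1) by (intro cf_approximation) simp
  qed
qed

end

section \<open>The amplitudes of the evolved state\<close>

text \<open>
  The \<open>n\<close>-th coordinate of \<open>H ^ k\<close> applied to
  \<open>\<delta>\<^sub>0\<close>. For \<open>v = 0\<close> it counts the paths of length
  \<open>k\<close> from 0 to \<open>n\<close>.
\<close>
primrec path_count :: "(int \<Rightarrow> real) \<Rightarrow> nat \<Rightarrow> int \<Rightarrow> complex" where
  path_count_0: "path_count v 0 = (\<lambda>n. if n = 0 then 1 else 0)"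
| path_count_Suc: "path_count v (Suc k) = (\<lambda>n. path_count v k (n + 1) + path_count v k (n - 1)
     + complex_of_real (v n) * path_count v k n)"

definition amplitude :: "(int \<Rightarrow> real) \<Rightarrow> real \<Rightarrow> int \<Rightarrow> complex" where
  "amplitude v t n = (\<Sum>k. path_count v k n / fact k * (- \<i> * of_real t) ^ k)"

abbreviation site_prob :: "(int \<Rightarrow> real) \<Rightarrow> real \<Rightarrow> int \<Rightarrow> real" where
  "site_prob v t n \<equiv> (cmod (amplitude v t n))\<^sup>2"

lemma path_count_zero: "int k < \<bar>n\<bar> \<Longrightarrow> path_count v k n = 0"
proof (induction k arbitrary: n)
  case (Suc k)
  then have "int k < \<bar>n + 1\<bar>" "int k < \<bar>n - 1\<bar>" "int k < \<bar>n\<bar>" by auto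
  then show ?case by (simp add: path_count_Suc Suc.IH)
qed (simp add: path_count_0)

context
  fixes v :: "int \<Rightarrow> real" and h :: real
  assumes v: "\<And>n. \<bar>v n\<bar> + 2 \<le> h"
begin

lemma hop_bound_ge_2: "2 \<le> h"
  using v[of 0] abs_ge_zero[of "v 0"] by linarith

lemma path_count_le: "cmod (path_count v k n) \<le> h ^ k"
proof (induction k arbitrary: n)
  case (Suc k)
  have "cmod (path_count v (Suc k) n) \<le> cmod (path_count v k (n + 1)) + cmod (path_count v k (n - 1))
      + \<bar>v n\<bar> * cmod (path_count v k n)"
    unfolding path_count_Suc by (intro order_trans[OF norm_triangle_ineq] add_mono norm_triangle_ineq) (simp add: norm_mult)
  also have "\<dots> \<le> h ^ k + h ^ k + \<bar>v n\<bar> * h ^ k"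
    by (intro add_mono mult_left_mono Suc.IH) auto
  also have "\<dots> = (\<bar>v n\<bar> + 2) * h ^ k" by (simp add: algebra_simps)
  also have "\<dots> \<le> h * h ^ k" using v hop_bound_ge_2 by (intro mult_right_mono) auto
  finally show ?case by simp
qed (simp add: path_count_0)

lemma amplitude_summable:
  "summable (\<lambda>k. path_count v k n / fact k * z ^ k)" (is ?A)
  "summable (\<lambda>k. (h * cmod z) ^ k / fact k)" (is ?B)
proof -
  show B: ?B using summable_exp[of "h * cmod z"] by (simp add: field_simps)
  show ?A
  proof (rule summable_comparison_test'[OF B])
    show "cmod (path_count v k n / fact k * z ^ k) \<le> (h * cmod z) ^ k / fact k" for k
      using mult_right_mono[OF path_count_le[of k n], of "cmod z ^ k"]
      by (simp add: norm_mult norm_divide norm_power power_mult_distrib divide_right_mono)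
  qed
qed

lemma amplitude_0: "amplitude v 0 n = (if n = 0 then 1 else 0)"
proof -
  have "(\<lambda>k. path_count v k n / fact k * 0 ^ k) sums (path_count v 0 n / fact 0)"
    by (rule powser_sums_zero)
  then show ?thesis by (simp add: amplitude_def path_count_0 sums_iff)
qed

lemma has_vector_derivative_amplitude:
  "((\<lambda>t. amplitude v t n) has_vector_derivative
     - \<i> * (amplitude v t (n + 1) + amplitude v t (n - 1) + complex_of_real (v n) * amplitude v t n))
   (at t within S)"
proof -
  define F where "F n z = (\<Sum>k. path_count v k n / fact k * z ^ k)" for n and z :: complex
  define z where "z = - \<i> * complex_of_real t"
  have "(F n has_field_derivative (\<Sum>k. diffs (\<lambda>k. path_count v k n / fact k) k * z ^ k)) (at z)"
    unfolding F_def by (rule termdiffs_strong_converges_everywhere) (rule amplitude_summable(1))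
  also have "(\<Sum>k. diffs (\<lambda>k. path_count v k n / fact k) k * z ^ k)
     = (\<Sum>k. path_count v k (n + 1) / fact k * z ^ k + path_count v k (n - 1) / fact k * z ^ k
         + of_real (v n) * (path_count v k n / fact k * z ^ k))"
    by (rule suminf_cong) (simp add: diffs_def path_count_Suc field_simps del: of_nat_Suc)
  also have "\<dots> = F (n + 1) z + F (n - 1) z + of_real (v n) * F n z"
  proof (rule sums_unique[symmetric])
    have "(\<lambda>k. path_count v k m / fact k * z ^ k) sums F m z" for m
      unfolding F_def by (rule summable_sums[OF amplitude_summable(1)])
    then show "(\<lambda>k. path_count v k (n + 1) / fact k * z ^ k + path_count v k (n - 1) / fact k * z ^ k
         + of_real (v n) * (path_count v k n / fact k * z ^ k)) sums
        (F (n + 1) z + F (n - 1) z + of_real (v n) * F n z)"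
      by (intro sums_add sums_mult)
  qed
  finally have D: "(F n has_field_derivative (F (n + 1) z + F (n - 1) z + of_real (v n) * F n z)) (at z)" .
  have "((\<lambda>t. - \<i> * complex_of_real t) has_vector_derivative - \<i>) (at t within S)"
    by (auto intro!: derivative_eq_intros)
  from field_vector_diff_chain_within[OF this has_field_derivative_at_within[OF D[unfolded z_def]]]
  show ?thesis by (simp add: o_def F_def amplitude_def)
qed

lemma continuous_on_amplitude: "continuous_on S (\<lambda>t. amplitude v t n)"
  by (rule continuous_on_vector_derivative) (rule has_vector_derivative_amplitude)

text \<open>
  The exponential series starts at \<open>k = |n|\<close>, because in \<open>k\<close> steps the
  particle moves at most \<open>k\<close> sites. Multiplying its terms by \<open>exp (k - |n|) \<ge>
  1\<close> gives an exponential series again.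
\<close>
lemma amplitude_tail:
  assumes "0 \<le> t"
  shows "cmod (amplitude v t n) \<le> exp (exp 1 * h * t - \<bar>real_of_int n\<bar>)"
proof -
  have h: "0 \<le> h" using hop_bound_ge_2 by simp
  define g where "g k = exp (- \<bar>real_of_int n\<bar>) * ((exp 1 * h * t) ^ k / fact k)" for k
  have "(\<lambda>k. (exp 1 * h * t) ^ k / fact k) sums exp (exp 1 * h * t)"
    using exp_converges[of "exp 1 * h * t"] by (simp add: divide_inverse mult.commute)
  then have g: "g sums (exp (- \<bar>real_of_int n\<bar>) * exp (exp 1 * h * t))"
    unfolding g_def by (rule sums_mult)
  have "cmod (path_count v k n / fact k * (- \<i> * of_real t) ^ k) \<le> g k" for k
  proof (cases "int k < \<bar>n\<bar>")
    case True
    then show ?thesis using h assms by (simp add: path_count_zero g_def)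
  next
    case False
    then have "\<bar>real_of_int n\<bar> \<le> real k" by linarith
    then have "1 \<le> exp (- \<bar>real_of_int n\<bar>) * exp 1 ^ k"
      by (simp add: exp_of_nat_mult[symmetric] exp_add[symmetric])
    have "cmod (path_count v k n / fact k * (- \<i> * of_real t) ^ k) \<le> 1 * (h ^ k * t ^ k / fact k)"
      using mult_right_mono[OF path_count_le[of k n], of "t ^ k"] assms
      by (simp add: norm_mult norm_divide norm_power divide_right_mono)
    also have "\<dots> \<le> (exp (- \<bar>real_of_int n\<bar>) * exp 1 ^ k) * (h ^ k * t ^ k / fact k)"
      using \<open>1 \<le> _\<close> h assms by (intro mult_right_mono) auto
    finally show ?thesis by (simp add: g_def power_mult_distrib mult_ac)
  qed
  then have "cmod (amplitude v t n) \<le> suminf g"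
    unfolding amplitude_def by (intro norm_suminf_le) (use g sums_summable in auto)
  also have "\<dots> = exp (exp 1 * h * t - \<bar>real_of_int n\<bar>)"
    using g by (simp add: sums_iff exp_diff exp_minus field_simps)
  finally show ?thesis .
qed

lemma sum_int_diff: "(\<Sum>n\<in>{- int K..int K}. g n - g (n - 1)) = g (int K) - g (- int K - 1)"
  for g :: "int \<Rightarrow> real"
proof (induction K)
  case (Suc K)
  have "{- int (Suc K)..int (Suc K)} = insert (- int (Suc K)) (insert (int (Suc K)) {- int K..int K})"
    by auto
  then have "(\<Sum>n\<in>{- int (Suc K)..int (Suc K)}. g n - g (n - 1))
      = (g (- int (Suc K)) - g (- int (Suc K) - 1)) + ((g (int (Suc K)) - g (int (Suc K) - 1))
        + (\<Sum>n\<in>{- int K..int K}. g n - g (n - 1)))"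
    by (simp del: of_nat_Suc)
  moreover have "- int (Suc K) = - int K - 1" "int (Suc K) - 1 = int K" by auto
  moreover have e: "- 1 - int K = - int K - 1" by simp
  ultimately show ?case unfolding Suc.IH by (simp add: e)
qed simp

text \<open>
  Up to the sites \<open>\<plusminus>K\<close> the mass changes only through the current across the two boundary bonds,
  which is negligible by the tail bound.
\<close>
lemma sum_amplitude_le_1:
  assumes t: "0 \<le> t" and F: "finite F"
  shows "(\<Sum>n\<in>F. site_prob v t n) \<le> 1"
proof -
  define A where "A = exp 1 * h * t"
  define G where "G K s = (\<Sum>n\<in>{- int K..int K}. (cmod (amplitude v s n))\<^sup>2)" for K s
  define J where "J s n = Im (cnj (amplitude v s n) * amplitude v s (n + 1))" for s n
  have deriv: "((\<lambda>s. G K s) has_vector_derivative 2 * (J s (int K) - J s (- int K - 1))) (at s within S)" for K s S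
  proof -
    have "((\<lambda>s. (cmod (amplitude v s n))\<^sup>2) has_vector_derivative 2 * (J s n - J s (n - 1))) (at s within S)" for n
    proof -
      have eq: "(\<lambda>s. (cmod (amplitude v s n))\<^sup>2) = (\<lambda>s. amplitude v s n \<bullet> amplitude v s n)"
        by (simp add: power2_norm_eq_inner)
      show ?thesis unfolding eq
        by (rule has_vector_derivative_eq_rhs[OF bounded_bilinear.has_vector_derivative[OF bounded_bilinear_inner has_vector_derivative_amplitude has_vector_derivative_amplitude]])
          (simp add: J_def inner_complex_def algebra_simps)
    qed
    then have "((\<lambda>s. G K s) has_vector_derivative (\<Sum>n\<in>{- int K..int K}. 2 * (J s n - J s (n - 1)))) (at s within S)"
      unfolding G_def by (intro has_vector_derivative_sum)
    then show ?thesis by (simp only: sum_distrib_left[symmetric] sum_int_diff)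
  qed
  have J: "\<bar>J s n\<bar> \<le> exp (A - real K)" if "0 \<le> s" "s \<le> t" "int K \<le> \<bar>n\<bar>" "int K \<le> \<bar>n + 1\<bar>" "A \<le> real K" for s n K
  proof -
    have sA: "exp 1 * h * s \<le> A" unfolding A_def using that hop_bound_ge_2 by (intro mult_left_mono) auto
    have m: "cmod (amplitude v s m) \<le> exp (A - real K)" if "int K \<le> \<bar>m\<bar>" for m
    proof -
      have "real K \<le> \<bar>real_of_int m\<bar>" using that by linarith
      then show ?thesis by (intro order_trans[OF amplitude_tail[OF \<open>0 \<le> s\<close>]]) (use sA in simp)
    qed
    have "\<bar>J s n\<bar> \<le> cmod (amplitude v s n) * cmod (amplitude v s (n + 1))"
      unfolding J_def by (metis abs_Im_le_cmod complex_mod_cnj norm_mult)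
    also have "\<dots> \<le> 1 * exp (A - real K)"
      by (intro mult_mono m that order_trans[OF m[of n]]) (use that in auto)
    finally show ?thesis by simp
  qed
  have bound: "G K t \<le> 1 + t * (4 * exp (A - real K))" if "A \<le> real K" for K
  proof -
    define c where "c = 4 * exp (A - real K)"
    have "G K t - c * t \<le> G K 0 - c * 0"
    proof (rule DERIV_nonpos_imp_nonincreasing[OF t, of "\<lambda>s. G K s - c * s"])
      fix s assume s: "0 \<le> s" "s \<le> t"
      have "((\<lambda>s. G K s - c * s) has_real_derivative 2 * (J s (int K) - J s (- int K - 1)) - c) (at s)"
        using deriv[of K s UNIV] unfolding has_real_derivative_iff_has_vector_derivative
        by (auto intro!: derivative_eq_intros)
      moreover have "2 * (J s (int K) - J s (- int K - 1)) - c \<le> 0"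
        using J[of s K "int K"] J[of s K "- int K - 1"] s that unfolding c_def by simp
      ultimately show "\<exists>y. ((\<lambda>s. G K s - c * s) has_real_derivative y) (at s) \<and> y \<le> 0" by blast
    qed
    moreover have "G K 0 = 1"
      unfolding G_def by (simp add: amplitude_0 if_distrib[of "\<lambda>z. (cmod z)\<^sup>2"] sum.delta cong: if_cong)
    ultimately show ?thesis by (simp add: c_def mult.commute)
  qed
  have "(\<lambda>K. 1 + t * (4 * exp (A - real K))) \<longlonglongrightarrow> 1" by real_asymp
  moreover have "\<exists>K0. \<forall>K\<ge>K0. (\<Sum>n\<in>F. site_prob v t n) \<le> 1 + t * (4 * exp (A - real K))"
  proof (intro exI allI impI)
    fix K assume K: "Max (insert 0 ((nat \<circ> abs) ` F)) + nat \<lceil>A\<rceil> \<le> K"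
    have "F \<subseteq> {- int K..int K}"
    proof
      fix n assume "n \<in> F"
      then have "(nat \<circ> abs) n \<le> Max (insert 0 ((nat \<circ> abs) ` F))" using F by (intro Max_ge) auto
      then show "n \<in> {- int K..int K}" using K by auto
    qed
    then have "(\<Sum>n\<in>F. site_prob v t n) \<le> G K t"
      unfolding G_def by (intro sum_mono2) auto
    also have "\<dots> \<le> 1 + t * (4 * exp (A - real K))"
      using K by (intro bound) linarith
    finally show "(\<Sum>n\<in>F. site_prob v t n) \<le> 1 + t * (4 * exp (A - real K))" .
  qed
  ultimately show ?thesis by (rule LIMSEQ_le_const)
qed

end

lemma bounded_linear_l2_coord: "bounded_linear (\<lambda>u. l2_coord u n)"
  by (rule bounded_linear_intro[where K = 1])
    (auto simp: plus_l2Z.rep_eq scaleR_l2Z.rep_eq l2_coord_le_norm)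

lemma propagator_eq_amplitude:
  assumes V: "lipschitz_on_circle V"
  shows "l2_herm (propagator (schroedinger V \<alpha> \<theta>) t (l2_delta 0)) (l2_delta n)
    = amplitude (\<lambda>n. V (\<theta> + of_int n * \<alpha>)) t n"
proof -
  define v where "v n = V (\<theta> + of_int n * \<alpha>)" for n :: int
  define A where "A = cscale_op (- \<i> * complex_of_real t) o\<^sub>L schroedinger V \<alpha> \<theta>"
  define P where "P k = ((\<lambda>B. A o\<^sub>L B) ^^ k) id_blinfun" for k
  have P: "l2_coord (P k (l2_delta 0)) n = (- \<i> * of_real t) ^ k * path_count v k n" for k n
  proof (induction k arbitrary: n)
    case (Suc k)
    have "l2_coord (P (Suc k) (l2_delta 0)) n = (- \<i> * of_real t) * l2_coord (schroedinger V \<alpha> \<theta> (P k (l2_delta 0))) n"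
      by (simp add: P_def A_def cscale_op.rep_eq cscale.rep_eq)
    then show ?case
      unfolding l2_coord_schroedinger[OF V] Suc.IH v_def[symmetric] by (simp add: path_count_Suc algebra_simps)
  qed (simp add: P_def path_count_0 l2_delta.rep_eq)
  have "(\<lambda>k. P k /\<^sub>R fact k) sums op_exp A"
    unfolding P_def by (rule op_exp_sums)
  from bounded_linear.sums[OF bounded_linear_compose[OF bounded_linear_l2_coord blinfun.bounded_linear_left] this]
  have "(\<lambda>k. l2_coord ((P k /\<^sub>R fact k) (l2_delta 0)) n) sums l2_coord (op_exp A (l2_delta 0)) n"
    by simp
  moreover have "l2_coord ((P k /\<^sub>R fact k) (l2_delta 0)) n = path_count v k n / fact k * (- \<i> * of_real t) ^ k" for k
    by (simp add: scaleR_blinfun.rep_eq scaleR_l2Z.rep_eq P scaleR_conv_of_real field_simps)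
  ultimately have "l2_coord (op_exp A (l2_delta 0)) n = amplitude v t n"
    by (simp add: sums_iff amplitude_def)
  then show ?thesis
    by (simp add: l2_herm_delta propagator_def A_def v_def[abs_def])
qed

section \<open>Moments\<close>

lemma powr_le_exp:
  fixes s p a :: real
  assumes "0 \<le> s" "0 < p" "0 < a"
  shows "s powr p \<le> (p / a) powr p * exp (a * s)"
proof -
  have "s \<le> p / a * exp (a * s / p)"
  proof -
    have "a * s / p \<le> exp (a * s / p)" using exp_ge_add_one_self[of "a * s / p"] by linarith
    then have "p / a * (a * s / p) \<le> p / a * exp (a * s / p)" using assms by (intro mult_left_mono) auto
    then show ?thesis using assms by simp
  qed
  then have "s powr p \<le> (p / a * exp (a * s / p)) powr p" using assms by (intro powr_mono2) auto
  also have "\<dots> = (p / a) powr p * exp (a * s)"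
    using assms by (subst powr_mult) (auto simp: exp_powr_real)
  finally show ?thesis .
qed

lemma summable_on_int_exp:
  assumes "0 < a" shows "(\<lambda>n::int. exp (- a * \<bar>real_of_int n\<bar>)) summable_on UNIV"
proof -
  let ?f = "\<lambda>n::int. exp (- a * \<bar>real_of_int n\<bar>)"
  have g: "(\<lambda>n::nat. exp (- a * real n)) summable_on UNIV"
  proof (rule summable_nonneg_imp_summable_on)
    have "summable (\<lambda>n. exp (- a) ^ n)" using assms by (intro summable_geometric) auto
    then show "summable (\<lambda>n. exp (- a * real n))" by (simp add: exp_of_nat_mult[symmetric] mult.commute)
  qed simp
  have "?f summable_on range int"
    by (subst summable_on_reindex) (use g in \<open>auto simp: o_def\<close>)
  moreover have "?f summable_on range (\<lambda>n. - int n - 1)"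
  proof (subst summable_on_reindex)
    show "inj (\<lambda>n. - int n - 1)" by (auto intro: injI)
    have "(\<lambda>n. exp (- a) * exp (- a * real n)) summable_on UNIV"
      using g by (rule summable_on_cmult_right)
    also have "(\<lambda>n. exp (- a) * exp (- a * real n)) = ?f \<circ> (\<lambda>n. - int n - 1)"
      by (auto simp: o_def exp_add[symmetric] algebra_simps)
    finally show "?f \<circ> (\<lambda>n. - int n - 1) summable_on UNIV" .
  qed
  moreover have "range int \<inter> range (\<lambda>n. - int n - 1) = {}" by auto
  ultimately have "?f summable_on range int \<union> range (\<lambda>n. - int n - 1)"
    by (rule summable_on_Un_disjoint)
  also have "range int \<union> range (\<lambda>n. - int n - 1) = UNIV"
  proof -
    have "n \<in> range int \<union> range (\<lambda>n. - int n - 1)" for n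
    proof (cases "0 \<le> n")
      case True then have "n = int (nat n)" by simp
      then show ?thesis by blast
    next
      case False
      then have "n = - int (nat (- n - 1)) - 1" by simp
      then show ?thesis by blast
    qed
    then show ?thesis by auto
  qed
  finally show ?thesis .
qed

lemma set_integrable_exp_decay:
  fixes T :: real
  assumes "0 < T"
  shows "set_integrable lborel {0..} (\<lambda>t. exp (- t / T))"
    and "(LBINT t:{0..}. exp (- t / T)) = T"
proof -
  have h: "((\<lambda>x::real. exp (- x / T)) has_integral T) {0..}"
    using has_integral_exp_minus_to_infinity[of "1 / T" 0] assms by simp
  have "(\<lambda>x::real. exp (- x / T)) absolutely_integrable_on {0..}"
    by (rule nonnegative_absolutely_integrable_1) (use h in \<open>auto simp: integrable_on_def\<close>)
  moreover have m: "(\<lambda>x. indicat_real {0..} x *\<^sub>R exp (- x / T)) \<in> borel_measurable lborel"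
    by measurable
  ultimately show i: "set_integrable lborel {0..} (\<lambda>t. exp (- t / T))"
    unfolding set_integrable_def by (simp add: integrable_completion)
  show "(LBINT t:{0..}. exp (- t / T)) = T"
    using set_borel_integral_eq_integral(2)[OF i] h by (simp add: integral_unique)
qed

definition moment :: "(int \<Rightarrow> real) \<Rightarrow> real \<Rightarrow> real \<Rightarrow> real" where
  "moment v p t = (\<Sum>\<^sub>\<infinity>n. \<bar>real_of_int n\<bar> powr p * site_prob v t n)"

abbreviation averaged_moment :: "(int \<Rightarrow> real) \<Rightarrow> real \<Rightarrow> real \<Rightarrow> real" where
  "averaged_moment v p T \<equiv> 2 / T * (LBINT t:{0..}. exp (- 2 * t / T) * moment v p t)"

context
  fixes v :: "int \<Rightarrow> real" and h p :: real
  assumes v: "\<And>n. \<bar>v n\<bar> + 2 \<le> h" and p: "0 < p"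
begin

text \<open>
  Inside the light cone \<open>|n| \<le> 2 e h t\<close> the weight is bounded; outside,
  \<open>amplitude_tail\<close> leaves \<open>exp (- |n| / 2)\<close> for the amplitude.
\<close>
lemma weighted_amplitude_le:
  assumes t: "0 \<le> t"
  shows "\<bar>real_of_int n\<bar> powr p * site_prob v t n
    \<le> (2 * exp 1 * h * t) powr p * site_prob v t n
        + (2 * p) powr p * exp (- (1/2) * \<bar>real_of_int n\<bar>)"
proof (cases "\<bar>real_of_int n\<bar> \<le> 2 * exp 1 * h * t")
  case True
  then have "\<bar>real_of_int n\<bar> powr p * site_prob v t n
      \<le> (2 * exp 1 * h * t) powr p * site_prob v t n"
    using p by (intro mult_right_mono powr_mono2) auto
  moreover have "0 \<le> (2 * p) powr p * exp (- (1/2) * \<bar>real_of_int n\<bar>)" by simp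
  ultimately show ?thesis by linarith
next
  case False
  have "cmod (amplitude v t n) \<le> exp (- (1/2) * \<bar>real_of_int n\<bar>)"
    by (rule order_trans[OF amplitude_tail[OF v t]]) (use False in simp)
  then have "site_prob v t n \<le> (exp (- (1/2) * \<bar>real_of_int n\<bar>))\<^sup>2"
    by (intro power_mono) auto
  also have "\<dots> = exp (- \<bar>real_of_int n\<bar>)" by (simp add: exp_double[symmetric])
  finally have "\<bar>real_of_int n\<bar> powr p * site_prob v t n
      \<le> ((p / (1/2)) powr p * exp (1/2 * \<bar>real_of_int n\<bar>)) * exp (- \<bar>real_of_int n\<bar>)"
    using p by (intro mult_mono powr_le_exp) auto
  also have "\<dots> = (2 * p) powr p * exp (- (1/2) * \<bar>real_of_int n\<bar>)"
    by (simp add: mult.assoc exp_add[symmetric] mult.commute)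
  finally show ?thesis by (simp add: add_increasing)
qed

text \<open>
  The contribution from outside the light cone, summed over all sites; it does not depend on time.
\<close>
definition moment_const :: real where
  "moment_const = (\<Sum>\<^sub>\<infinity>n::int. (2 * p) powr p * exp (- (1/2) * \<bar>real_of_int n\<bar>))"

lemma moment_const_summable: "(\<lambda>n::int. (2 * p) powr p * exp (- (1/2) * \<bar>real_of_int n\<bar>)) summable_on UNIV"
  by (intro summable_on_cmult_right summable_on_int_exp) simp

lemma moment_const_nonneg: "0 \<le> moment_const"
  unfolding moment_const_def by (rule infsum_nonneg) simp

lemma moment_summable_le:
  assumes t: "0 \<le> t"
  shows "(\<lambda>n. \<bar>real_of_int n\<bar> powr p * site_prob v t n) summable_on UNIV"
    and "moment v p t \<le> (2 * exp 1 * h * t) powr p + moment_const"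
proof -
  let ?f = "\<lambda>n. \<bar>real_of_int n\<bar> powr p * site_prob v t n"
  have fin: "sum ?f F \<le> (2 * exp 1 * h * t) powr p + moment_const" if F: "finite F" for F
  proof -
    have "sum ?f F \<le> (2 * exp 1 * h * t) powr p * (\<Sum>n\<in>F. site_prob v t n)
        + (\<Sum>n\<in>F. (2 * p) powr p * exp (- (1/2) * \<bar>real_of_int n\<bar>))"
      unfolding sum_distrib_left sum.distrib[symmetric] by (intro sum_mono weighted_amplitude_le t)
    also have "\<dots> \<le> (2 * exp 1 * h * t) powr p * 1 + moment_const"
      unfolding moment_const_def
      by (intro add_mono mult_left_mono sum_amplitude_le_1[OF v t F] finite_sum_le_infsum moment_const_summable F) auto
    finally show ?thesis by simp
  qed
  show s: "?f summable_on UNIV"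
    by (rule nonneg_bounded_partial_sums_imp_summable_on[where C = "(2 * exp 1 * h * t) powr p + moment_const"])
      (auto intro!: eventually_finite_subsets_at_top_weakI fin)
  show "moment v p t \<le> (2 * exp 1 * h * t) powr p + moment_const"
    unfolding moment_def by (rule infsum_le_finite_sums[OF s fin])
qed

lemma moment_nonneg: "0 \<le> moment v p t"
  unfolding moment_def by (rule infsum_nonneg) simp

lemma moment_measurable:
  "(\<lambda>t. indicat_real {0..} t *\<^sub>R (exp (- 2 * t / T) * moment v p t)) \<in> borel_measurable lborel"
proof -
  define f where "f t n = \<bar>real_of_int n\<bar> powr p * site_prob v t n" for t n
  define u where "u i t = indicat_real {0..} t *\<^sub>R (exp (- 2 * t / T) * (\<Sum>n\<in>{- int i..int i}. f t n))" for i :: nat and t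
  have cf: "continuous_on {0..} (\<lambda>t. f t n)" for n
    unfolding f_def by (intro continuous_intros continuous_on_amplitude[OF v])
  have ce: "continuous_on {0..} (\<lambda>t. exp ((- 2 / T) * t))"
    by (intro continuous_intros)
  have "continuous_on {0..} (\<lambda>t. exp ((- 2 / T) * t) * (\<Sum>n\<in>{- int i..int i}. f t n))" for i :: nat
    by (intro continuous_on_mult ce continuous_on_sum cf)
  then have "(\<lambda>t. indicat_real {0..} t *\<^sub>R (exp ((- 2 / T) * t) * (\<Sum>n\<in>{- int i..int i}. f t n))) \<in> borel_measurable borel" for i :: nat
    by (intro borel_measurable_continuous_on_indicator) auto
  then have mu: "u i \<in> borel_measurable lborel" for i
    by (simp add: u_def[abs_def])
  have lim: "(\<lambda>i::nat. (\<Sum>n\<in>{- int i..int i}. f t n)) \<longlonglongrightarrow> moment v p t" if "0 \<le> t" for t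
  proof -
    have "filterlim (\<lambda>i::nat. {- int i..int i}) (finite_subsets_at_top UNIV) sequentially"
      unfolding filterlim_finite_subsets_at_top
    proof (intro allI impI)
      fix X :: "int set" assume X: "finite X \<and> X \<subseteq> UNIV"
      have "X \<subseteq> {- int i..int i}" if "Max (insert 0 ((nat \<circ> abs) ` X)) \<le> i" for i
      proof
        fix n assume "n \<in> X"
        then have "(nat \<circ> abs) n \<le> Max (insert 0 ((nat \<circ> abs) ` X))" using X by (intro Max_ge) auto
        then show "n \<in> {- int i..int i}" using that by auto
      qed
      then show "\<forall>\<^sub>F i in sequentially. finite {- int i..int i} \<and> X \<subseteq> {- int i..int i} \<and> {- int i..int i} \<subseteq> UNIV"
        by (intro eventually_sequentiallyI[where c = "Max (insert 0 ((nat \<circ> abs) ` X))"]) simp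
    qed
    from filterlim_compose[OF infsum_tendsto[OF moment_summable_le(1)[OF that]] this]
    show ?thesis by (simp add: moment_def f_def)
  qed
  have "(\<lambda>i. u i t) \<longlonglongrightarrow> indicat_real {0..} t *\<^sub>R (exp (- 2 * t / T) * moment v p t)" for t
  proof (cases "0 \<le> t")
    case True
    show ?thesis unfolding u_def by (intro tendsto_scaleR tendsto_mult tendsto_const lim True)
  qed (simp add: u_def)
  then show ?thesis by (rule borel_measurable_LIMSEQ_real) (rule mu)
qed

text \<open>
  Half of the damping pays for the growth \<open>t powr p\<close> of the moment, at the natural
  scale \<open>t / T\<close>; the other half remains for the integration over time.
\<close>
lemma weighted_moment_le:
  assumes t: "0 \<le> t" and T: "1 \<le> T"
  shows "exp (- 2 * t / T) * moment v p t
    \<le> ((2 * exp 1 * h) powr p * p powr p + moment_const) * T powr p * exp (- t / T)"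
proof -
  have h: "0 \<le> h" using hop_bound_ge_2[OF v] by simp
  have T0: "0 < T" using T by simp
  have TT: "exp (- 2 * t / T) = exp (- t / T) * exp (- t / T)" by (simp add: exp_add[symmetric])
  have "(2 * exp 1 * h * t) powr p = (2 * exp 1 * h) powr p * T powr p * (t / T) powr p"
    using h t T0 by (simp add: powr_mult[symmetric] mult.assoc)
  also have "\<dots> \<le> (2 * exp 1 * h) powr p * T powr p * (p powr p * exp (t / T))"
    using powr_le_exp[of "t / T" p 1] t T0 p by (intro mult_left_mono) auto
  finally have 1: "exp (- t / T) * (2 * exp 1 * h * t) powr p \<le> exp (- t / T) * ((2 * exp 1 * h) powr p * T powr p * (p powr p * exp (t / T)))"
    by (intro mult_left_mono) auto
  also have "\<dots> = (2 * exp 1 * h) powr p * p powr p * T powr p"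
    by (simp add: exp_minus)
  finally have 1: "exp (- t / T) * (2 * exp 1 * h * t) powr p \<le> (2 * exp 1 * h) powr p * p powr p * T powr p" .
  have "exp (- t / T) \<le> 1" using t T0 by simp
  moreover have "1 \<le> T powr p" using T p by (simp add: ge_one_powr_ge_zero)
  ultimately have 2: "exp (- t / T) * moment_const \<le> T powr p * moment_const"
    by (intro mult_right_mono moment_const_nonneg) linarith
  have "exp (- 2 * t / T) * moment v p t = exp (- t / T) * (exp (- t / T) * moment v p t)"
    unfolding TT by (simp only: mult.assoc)
  also have "\<dots> \<le> exp (- t / T) * (exp (- t / T) * ((2 * exp 1 * h * t) powr p + moment_const))"
    by (intro mult_left_mono moment_summable_le(2) t) auto
  also have "\<dots> \<le> exp (- t / T) * ((2 * exp 1 * h) powr p * p powr p * T powr p + T powr p * moment_const)"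
    using 1 2 by (intro mult_left_mono) (auto simp: distrib_left)
  finally show ?thesis by (simp add: algebra_simps)
qed

lemma moment_integrable:
  assumes T: "1 \<le> T"
  shows "set_integrable lborel {0..} (\<lambda>t. exp (- 2 * t / T) * moment v p t)"
proof (rule set_integrable_bound)
  let ?c = "((2 * exp 1 * h) powr p * p powr p + moment_const) * T powr p"
  show "set_integrable lborel {0..} (\<lambda>t. ?c * exp (- t / T))"
    using set_integrable_exp_decay(1)[of T] T by (intro set_integrable_mult_right) auto
  show "set_borel_measurable lborel {0..} (\<lambda>t. exp (- 2 * t / T) * moment v p t)"
    unfolding set_borel_measurable_def by (rule moment_measurable)
  have "norm (exp (- 2 * t / T) * moment v p t) \<le> norm (?c * exp (- t / T))" if "0 \<le> t" for t
  proof -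
    have "norm (exp (- 2 * t / T) * moment v p t) = exp (- 2 * t / T) * moment v p t"
      using moment_nonneg by (simp add: abs_mult)
    also have "\<dots> \<le> norm (?c * exp (- t / T))"
      using weighted_moment_le[OF that T] by (simp only: real_norm_def)
    finally show ?thesis .
  qed
  then show "AE t in lborel. t \<in> {0..} \<longrightarrow> norm (exp (- 2 * t / T) * moment v p t) \<le> norm (?c * exp (- t / T))"
    by auto
qed

lemma averaged_moment_le:
  assumes T: "1 \<le> T"
  shows "averaged_moment v p T
    \<le> 2 * ((2 * exp 1 * h) powr p * p powr p + moment_const) * T powr p"
proof -
  let ?c = "((2 * exp 1 * h) powr p * p powr p + moment_const) * T powr p"
  have "(LBINT t:{0..}. exp (- 2 * t / T) * moment v p t) \<le> (LBINT t:{0..}. ?c * exp (- t / T))"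
    using weighted_moment_le[OF _ T] T set_integrable_exp_decay(1)[of T]
    by (intro set_integral_mono moment_integrable set_integrable_mult_right) auto
  also have "\<dots> = ?c * T" using set_integrable_exp_decay(2)[of T] T by simp
  finally have "averaged_moment v p T \<le> 2 / T * (?c * T)"
    using T by (intro mult_left_mono) auto
  then show ?thesis using T by (simp add: mult_ac)
qed

text \<open>
  Truncating the time integral and keeping finitely many sites at distance at least \<open>R\<close>
  leaves integrals of continuous functions.
\<close>
lemma averaged_moment_ge:
  assumes T: "1 \<le> T" and L: "0 \<le> L" and F: "finite F" and R: "0 \<le> R" "\<And>n. n \<in> F \<Longrightarrow> R \<le> \<bar>real_of_int n\<bar>"
  shows "2 / T * (R powr p * (\<Sum>n\<in>F. integral {0..L} (\<lambda>t. exp (- 2 * t / T) * site_prob v t n)))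
    \<le> averaged_moment v p T"
proof (rule mult_left_mono)
  let ?g = "\<lambda>t. R powr p * (\<Sum>n\<in>F. exp (- 2 * t / T) * site_prob v t n)"
  have cont: "continuous_on S (\<lambda>t. exp (- 2 * t / T) * site_prob v t n)" for n S
    using T by (intro continuous_intros continuous_on_amplitude[OF v]) auto
  then have cg: "continuous_on S ?g" for S by (intro continuous_on_mult_left continuous_on_sum)
  have ig: "set_integrable lborel {0..L} ?g" by (rule borel_integrable_atLeastAtMost'[OF cg])
  have "R powr p * (\<Sum>n\<in>F. integral {0..L} (\<lambda>t. exp (- 2 * t / T) * site_prob v t n)) = integral {0..L} ?g"
    by (simp only: integral_sum[OF F integrable_continuous_interval[OF cont]] integral_mult_right)
  also have "\<dots> = (LBINT t:{0..L}. ?g t)" by (rule set_borel_integral_eq_integral(2)[OF ig, symmetric])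
  also have "\<dots> \<le> (LBINT t:{0..}. exp (- 2 * t / T) * moment v p t)"
    unfolding set_lebesgue_integral_def
  proof (rule integral_mono)
    show "integrable lborel (\<lambda>t. indicat_real {0..L} t *\<^sub>R ?g t)" using ig by (simp add: set_integrable_def)
    show "integrable lborel (\<lambda>t. indicat_real {0..} t *\<^sub>R (exp (- 2 * t / T) * moment v p t))"
      using moment_integrable[OF T] by (simp add: set_integrable_def)
    fix t :: real
    have "?g t \<le> exp (- 2 * t / T) * moment v p t" if t: "0 \<le> t"
    proof -
      have "?g t = exp (- 2 * t / T) * (\<Sum>n\<in>F. R powr p * site_prob v t n)"
        by (simp add: sum_distrib_left mult_ac)
      also have "\<dots> \<le> exp (- 2 * t / T) * (\<Sum>n\<in>F. \<bar>real_of_int n\<bar> powr p * site_prob v t n)"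
        using R p by (intro mult_left_mono sum_mono mult_right_mono powr_mono2) auto
      also have "\<dots> \<le> exp (- 2 * t / T) * moment v p t"
        unfolding moment_def by (intro mult_left_mono finite_sum_le_infsum moment_summable_le t F) auto
      finally show ?thesis .
    qed
    moreover have "0 \<le> exp (- 2 * t / T) * moment v p t" using moment_nonneg by simp
    ultimately show "indicat_real {0..L} t *\<^sub>R ?g t \<le> indicat_real {0..} t *\<^sub>R (exp (- 2 * t / T) * moment v p t)"
      by (auto simp: indicator_def simp del: times_divide_eq_left)
  qed
  finally show "R powr p * (\<Sum>n\<in>F. integral {0..L} (\<lambda>t. exp (- 2 * t / T) * site_prob v t n))
    \<le> (LBINT t:{0..}. exp (- 2 * t / T) * moment v p t)" .
qed (use T in simp)

end

section \<open>The resolvent equation on a finite time interval\<close>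

lemma integral_cis_period:
  fixes k :: int
  assumes L: "0 < L" and k: "k \<noteq> 0"
  shows "((\<lambda>t. exp (\<i> * of_real (2 * pi * of_int k / L * t))) has_integral 0) {0..L}"
proof -
  define w where "w = 2 * pi * of_int k / L"
  have w: "w \<noteq> 0" using L k by (simp add: w_def)
  have "((\<lambda>t. exp (\<i> * of_real (w * t))) has_integral
      (exp (\<i> * of_real (w * L)) / (\<i> * of_real w) - exp (\<i> * of_real (w * 0)) / (\<i> * of_real w))) {0..L}"
  proof (rule fundamental_theorem_of_calculus)
    show "0 \<le> L" using L by simp
    fix t
    have "((\<lambda>z. exp (\<i> * of_real w * z) / (\<i> * of_real w)) has_field_derivative exp (\<i> * of_real w * of_real t)) (at (of_real t))"
      using w by (auto intro!: derivative_eq_intros)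
    from has_vector_derivative_real_field[OF this, of "{0..L}"]
    show "((\<lambda>t. exp (\<i> * of_real (w * t)) / (\<i> * of_real w)) has_vector_derivative exp (\<i> * of_real (w * t))) (at t within {0..L})"
      by (simp add: mult.assoc)
  qed
  moreover have "exp (\<i> * of_real (w * L)) = 1"
  proof -
    have "\<i> * complex_of_real (w * L) = (2 * of_int k * pi) * \<i>"
      using L by (simp add: w_def)
    then have "exp (\<i> * complex_of_real (w * L)) = exp ((2 * of_int k * pi) * \<i>)" by (simp only:)
    also have "\<dots> = 1" by (rule exp_integer_2pi) simp
    finally show ?thesis .
  qed
  ultimately show ?thesis by (simp add: w_def)
qed

text \<open>
  On \<open>[0, L]\<close> the exponentials with frequencies in \<open>E + (2 \<pi> / L)
  \<int>\<close> are orthogonal. The integrals on the left are the coefficients of \<open>f\<close>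
  with respect to them.
\<close>
lemma bessel_inequality_grid:
  fixes f :: "real \<Rightarrow> complex"
  assumes L: "0 < L" and f: "continuous_on {0..L} f"
  shows "(\<Sum>j<K. (cmod (integral {0..L} (\<lambda>t. exp (\<i> * of_real ((E + 2 * pi * real j / L) * t)) * f t)))\<^sup>2)
    \<le> L * integral {0..L} (\<lambda>t. (cmod (f t))\<^sup>2)"
proof -
  define e where "e j t = exp (\<i> * of_real ((E + 2 * pi * real j / L) * t))" for j :: nat and t
  define c where "c j = integral {0..L} (\<lambda>t. e j t * f t)" for j
  define g where "g t = (\<Sum>j<K. c j * cnj (e j t))" for t
  have ce: "continuous_on {0..L} (e j)" for j unfolding e_def by (intro continuous_intros)
  have cg: "continuous_on {0..L} g" unfolding g_def by (intro continuous_intros ce)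
  have orth: "integral {0..L} (\<lambda>t. cnj (e j t) * e k t) = (if j = k then of_real L else 0)" for j k
  proof -
    have eq: "cnj (e j t) * e k t = exp (\<i> * of_real (2 * pi * of_int (int k - int j) / L * t))" for t
      by (simp add: e_def exp_cnj exp_add[symmetric]) (simp add: algebra_simps diff_divide_distrib)
    show ?thesis
    proof (cases "j = k")
      case True
      then show ?thesis unfolding eq using L by (simp add: scaleR_conv_of_real)
    next
      case False
      then show ?thesis unfolding eq using integral_unique[OF integral_cis_period[OF L, of "int k - int j"]] by simp
    qed
  qed
  have c: "integral {0..L} (\<lambda>t. e j t * f t) = c j" for j by (simp add: c_def)
  have fg: "integral {0..L} (\<lambda>t. cnj (g t) * f t) = of_real (\<Sum>j<K. (cmod (c j))\<^sup>2)"
  proof -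
    have "integral {0..L} (\<lambda>t. cnj (g t) * f t) = integral {0..L} (\<lambda>t. \<Sum>j<K. cnj (c j) * (e j t * f t))"
      by (simp add: g_def sum_distrib_right mult.assoc)
    also have "\<dots> = (\<Sum>j<K. integral {0..L} (\<lambda>t. cnj (c j) * (e j t * f t)))"
      by (rule integral_sum) (auto intro!: integrable_continuous_interval continuous_intros ce f)
    also have "\<dots> = (\<Sum>j<K. cnj (c j) * c j)" by (simp add: c)
    also have "\<dots> = of_real (\<Sum>j<K. (cmod (c j))\<^sup>2)"
      by (simp only: of_real_sum complex_norm_square mult.commute)
    finally show ?thesis .
  qed
  have eg: "integral {0..L} (\<lambda>t. e k t * g t) = of_real L * c k" if "k < K" for k
  proof -
    have "integral {0..L} (\<lambda>t. e k t * g t) = integral {0..L} (\<lambda>t. \<Sum>j<K. c j * (cnj (e j t) * e k t))"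
      by (simp add: g_def sum_distrib_left mult_ac)
    also have "\<dots> = (\<Sum>j<K. integral {0..L} (\<lambda>t. c j * (cnj (e j t) * e k t)))"
      by (rule integral_sum) (auto intro!: integrable_continuous_interval continuous_intros ce)
    also have "\<dots> = (\<Sum>j<K. if j = k then of_real L * c k else 0)"
      by (intro sum.cong) (auto simp: orth)
    also have "\<dots> = of_real L * c k" using that by simp
    finally show ?thesis .
  qed
  have gg: "integral {0..L} (\<lambda>t. cnj (g t) * g t) = of_real (L * (\<Sum>j<K. (cmod (c j))\<^sup>2))"
  proof -
    have "integral {0..L} (\<lambda>t. cnj (g t) * g t) = integral {0..L} (\<lambda>t. \<Sum>j<K. cnj (c j) * (e j t * g t))"
      by (simp add: g_def[of _] sum_distrib_right mult.assoc)
    also have "\<dots> = (\<Sum>j<K. integral {0..L} (\<lambda>t. cnj (c j) * (e j t * g t)))"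
      by (rule integral_sum) (auto intro!: integrable_continuous_interval continuous_intros ce cg)
    also have "\<dots> = (\<Sum>j<K. cnj (c j) * (of_real L * c j))"
      by (intro sum.cong refl) (simp add: eg)
    also have "\<dots> = (\<Sum>j<K. of_real L * (c j * cnj (c j)))" by (simp only: mult_ac)
    also have "\<dots> = of_real (L * (\<Sum>j<K. (cmod (c j))\<^sup>2))"
      by (simp only: of_real_mult of_real_sum complex_norm_square sum_distrib_left)
    finally show ?thesis .
  qed
  define S where "S = (\<Sum>j<K. (cmod (c j))\<^sup>2)"
  have ig: "(\<lambda>t. cnj (g t) * f t) integrable_on {0..L}" "(\<lambda>t. cnj (g t) * g t) integrable_on {0..L}"
    by (auto intro!: integrable_continuous_interval continuous_intros cg f)
  have rfg: "integral {0..L} (\<lambda>t. g t \<bullet> f t) = S"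
    using integral_linear[OF ig(1) bounded_linear_Re] fg by (simp add: S_def o_def inner_complex_def)
  have rgg: "integral {0..L} (\<lambda>t. g t \<bullet> g t) = L * S"
    using integral_linear[OF ig(2) bounded_linear_Re] gg by (simp add: S_def o_def inner_complex_def)
  have "0 \<le> integral {0..L} (\<lambda>t. (L *\<^sub>R f t - g t) \<bullet> (L *\<^sub>R f t - g t))"
    by (intro integral_nonneg integrable_continuous_interval continuous_intros f cg) auto
  also have "(\<lambda>t. (L *\<^sub>R f t - g t) \<bullet> (L *\<^sub>R f t - g t)) = (\<lambda>t. L\<^sup>2 * (f t \<bullet> f t) - 2 * L * (g t \<bullet> f t) + g t \<bullet> g t)"
    by (simp add: inner_diff_left inner_diff_right inner_commute algebra_simps power2_eq_square fun_eq_iff)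
  also have "integral {0..L} \<dots> = L\<^sup>2 * integral {0..L} (\<lambda>t. f t \<bullet> f t) - 2 * L * S + L * S"
  proof -
    have i: "(\<lambda>t. L\<^sup>2 * (f t \<bullet> f t)) integrable_on {0..L}" "(\<lambda>t. 2 * L * (g t \<bullet> f t)) integrable_on {0..L}"
      "(\<lambda>t. g t \<bullet> g t) integrable_on {0..L}"
      by (intro integrable_continuous_interval continuous_intros f cg)+
    show ?thesis
      by (simp only: integral_add[OF integrable_diff[OF i(1,2)] i(3)] integral_diff[OF i(1,2)] integral_mult_right rfg rgg)
  qed
  finally have "L * S \<le> L * (L * integral {0..L} (\<lambda>t. f t \<bullet> f t))"
    by (simp add: power2_eq_square algebra_simps)
  then have "S \<le> L * integral {0..L} (\<lambda>t. f t \<bullet> f t)" using L by simp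
  then show ?thesis by (simp add: S_def c_def e_def power2_norm_eq_inner)
qed

definition time_transform :: "(int \<Rightarrow> real) \<Rightarrow> real \<Rightarrow> complex \<Rightarrow> int \<Rightarrow> complex" where
  "time_transform v L z n = integral {0..L} (\<lambda>t. exp (\<i> * z * of_real t) * amplitude v t n)"

text \<open>
  Integrate the derivative of \<open>exp (i z t) * amplitude v t n\<close> over \<open>[0,
  L]\<close>. The boundary term at \<open>t = 0\<close> is the source at the origin; the one at
  \<open>t = L\<close> is damped by \<open>exp (- L * Im z)\<close>.
\<close>
lemma time_transform_recurrence:
  assumes v: "\<And>n. \<bar>v n\<bar> + 2 \<le> h" and L: "0 \<le> L"
  shows "time_transform v L z (n + 1) = (z - of_real (v n)) * time_transform v L z n - time_transform v L z (n - 1)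
    + \<i> * (exp (\<i> * z * of_real L) * amplitude v L n - (if n = 0 then 1 else 0))"
proof -
  define e where "e t = exp (\<i> * z * complex_of_real t)" for t
  have ce: "continuous_on {0..L} (\<lambda>t. e t)" unfolding e_def by (intro continuous_intros)
  have ca: "continuous_on {0..L} (\<lambda>t. amplitude v t m)" for m by (rule continuous_on_amplitude[OF v])
  have i: "((\<lambda>t. e t * amplitude v t m) has_integral time_transform v L z m) {0..L}" for m
    unfolding time_transform_def e_def[symmetric]
    by (intro integrable_integral integrable_continuous_interval continuous_on_mult ce ca)
  have de: "(e has_vector_derivative \<i> * z * e t) (at t within {0..L})" for t
  proof -
    have "((\<lambda>w. exp (\<i> * z * w)) has_field_derivative \<i> * z * exp (\<i> * z * of_real t)) (at (of_real t))"
      by (auto intro!: derivative_eq_intros)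
    from has_vector_derivative_real_field[OF this, of "{0..L}"] show ?thesis by (simp add: e_def[abs_def])
  qed
  let ?D = "\<lambda>t. e t * (- \<i> * (amplitude v t (n + 1) + amplitude v t (n - 1) + of_real (v n) * amplitude v t n))
      + (\<i> * z * e t) * amplitude v t n"
  have "(?D has_integral (e L * amplitude v L n - e 0 * amplitude v 0 n)) {0..L}"
    by (intro fundamental_theorem_of_calculus L has_vector_derivative_mult de has_vector_derivative_amplitude[OF v])
  also have "?D = (\<lambda>t. - \<i> * (e t * amplitude v t (n + 1)) + (- \<i> * (e t * amplitude v t (n - 1))
      + (\<i> * (z - of_real (v n))) * (e t * amplitude v t n)))"
    by (simp add: algebra_simps fun_eq_iff)
  finally have 1: "(\<dots> has_integral (e L * amplitude v L n - e 0 * amplitude v 0 n)) {0..L}" .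
  have 2: "((\<lambda>t. - \<i> * (e t * amplitude v t (n + 1)) + (- \<i> * (e t * amplitude v t (n - 1))
      + (\<i> * (z - of_real (v n))) * (e t * amplitude v t n))) has_integral
     - \<i> * time_transform v L z (n + 1) + (- \<i> * time_transform v L z (n - 1)
      + (\<i> * (z - of_real (v n))) * time_transform v L z n)) {0..L}"
    by (intro has_integral_add has_integral_mult_right i)
  have "e L * amplitude v L n - e 0 * amplitude v 0 n = - \<i> * time_transform v L z (n + 1) + (- \<i> * time_transform v L z (n - 1)
      + (\<i> * (z - of_real (v n))) * time_transform v L z n)"
    by (rule has_integral_unique[OF 1 2])
  then have "\<i> * (e L * amplitude v L n - e 0 * amplitude v 0 n) = time_transform v L z (n + 1) + (time_transform v L z (n - 1)
      - (z - of_real (v n)) * time_transform v L z n)"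
    by (simp only:) (simp add: algebra_simps)
  then show ?thesis
    by (simp add: e_def amplitude_0[OF v] algebra_simps)
qed

section \<open>Transport from bounds on transfer matrices\<close>

definition site_pair :: "(int \<Rightarrow> complex) \<Rightarrow> int \<Rightarrow> complex^2" where
  "site_pair u j = vector [u j, u (j - 1)]"

lemma site_pair_nth [simp]: "site_pair u j $ 1 = u j" "site_pair u j $ 2 = u (j - 1)"
  by (simp_all add: site_pair_def)

lemma norm_site_pair_sq: "(norm (site_pair u j))\<^sup>2 = (cmod (u j))\<^sup>2 + (cmod (u (j - 1)))\<^sup>2"
  by (simp add: norm_cvec_sq)

lemma cmod_le_norm_site_pair: "cmod (u j) \<le> norm (site_pair u j)" "cmod (u (j - 1)) \<le> norm (site_pair u j)"
  using Finite_Cartesian_Product.norm_nth_le[of "site_pair u j" 1] Finite_Cartesian_Product.norm_nth_le[of "site_pair u j" 2] by simp_all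

text \<open>
  Duhamel's formula: each source term is transported by a window.
\<close>
lemma inhomogeneous_window:
  assumes rec: "\<And>i. lo \<le> i \<Longrightarrow> i < hi \<Longrightarrow> u (i + 1) = a i * u i - u (i - 1) + \<sigma> i"
    and s: "\<And>i. lo \<le> i \<Longrightarrow> i < hi \<Longrightarrow> cmod (\<sigma> i) \<le> s"
    and B: "\<And>j n. lo \<le> j \<Longrightarrow> j + int n \<le> hi \<Longrightarrow> norm (window a j n) \<le> B"
    and j: "lo \<le> j" "j + int n \<le> hi"
  shows "norm (site_pair u (j + int n) - window a j n *v site_pair u j) \<le> real n * (B * s)"
  using j
proof (induction n arbitrary: j)
  case (Suc n)
  define d where "d = site_pair u (j + 1) - step (a j) *v site_pair u j"
  have d: "norm d \<le> s"
  proof (rule power2_le_imp_le)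
    have "d$1 = \<sigma> j" "d$2 = 0" using rec[of j] Suc.prems by (simp_all add: d_def cmat_vec_nth)
    then show "(norm d)\<^sup>2 \<le> s\<^sup>2" using s[of j] Suc.prems by (simp add: norm_cvec_sq power_mono)
    show "0 \<le> s" using order_trans[OF norm_ge_zero s[of j]] Suc.prems by simp
  qed
  have "site_pair u (j + int (Suc n)) - window a j (Suc n) *v site_pair u j
     = (site_pair u ((j + 1) + int n) - window a (j + 1) n *v site_pair u (j + 1)) + window a (j + 1) n *v d"
    unfolding window_Suc_left d_def
    by (simp add: matrix_vector_mult_diff_distrib matrix_vector_mul_assoc algebra_simps)
  also have "norm \<dots> \<le> real n * (B * s) + B * s"
  proof (intro order_trans[OF norm_triangle_ineq] add_mono)
    show "norm (site_pair u (j + 1 + int n) - window a (j + 1) n *v site_pair u (j + 1)) \<le> real n * (B * s)"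
      using Suc.prems by (intro Suc.IH) auto
    have "norm (window a (j + 1) n) \<le> B" using Suc.prems by (intro B) auto
    then show "norm (window a (j + 1) n *v d) \<le> B * s"
      using d order_trans[OF norm_ge_zero] by (intro order_trans[OF norm_cmat_vec] mult_mono) auto
  qed
  finally show ?case by (simp add: algebra_simps)
qed simp

text \<open>
  The source at the origin forces the solution to be of order one next to the origin on at least
  one side, and a solution decays no faster than the norms of the transfer matrices permit.
\<close>
lemma solution_lower_bound:
  assumes rec: "\<And>i. u (i + 1) = a i * u i - u (i - 1) + \<sigma> i"
    and s: "\<And>i. i \<noteq> 0 \<Longrightarrow> cmod (\<sigma> i) \<le> s"
    and \<sigma>0: "1 / 2 \<le> cmod (\<sigma> 0)" and R: "cmod (a 0) \<le> R"
    and B: "\<And>j n. - int M \<le> j \<Longrightarrow> j + int n \<le> int M + 1 \<Longrightarrow> norm (window a j n) \<le> B"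
    and small: "(1 + R) * B * (2 * (real M * (B * s))) \<le> 1 / 4"
    and n: "n \<le> M"
  shows "1 / (32 * ((1 + R) * B)\<^sup>2) \<le> (cmod (u (int n)))\<^sup>2 + (cmod (u (- int n)))\<^sup>2
    + ((cmod (u (int n + 1)))\<^sup>2 + (cmod (u (- int n - 1)))\<^sup>2)"
proof -
  define P where "P j = norm (site_pair u j)" for j
  have B1: "1 \<le> B" using B[of 0 0] norm_window_ge_1[of a 0 0] by (simp del: window.simps)
  have R0: "0 \<le> R" using order_trans[OF norm_ge_zero R] .
  have s0: "0 \<le> s" using order_trans[OF norm_ge_zero s[of 1]] by simp
  have nM: "real n * (B * s) \<le> real M * (B * s)" using n B1 s0 by (intro mult_right_mono) auto
  have right: "P 1 \<le> B * (P (int n + 1) + real M * (B * s))"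
  proof -
    have e: "norm (site_pair u (1 + int n) - window a 1 n *v site_pair u 1) \<le> real n * (B * s)"
      by (rule inhomogeneous_window[where lo = 1 and hi = "int M + 1" and \<sigma> = \<sigma>])
        (use rec s B n in \<open>auto simp del: window.simps\<close>)
    have "P 1 = norm (adj2 (window a 1 n) *v (window a 1 n *v site_pair u 1))"
      by (simp add: P_def matrix_vector_mul_assoc adj2_left_inverse)
    also have "\<dots> \<le> norm (window a 1 n) * norm (window a 1 n *v site_pair u 1)"
      using norm_cmat_vec[of "adj2 (window a 1 n)"] by simp
    also have "\<dots> \<le> B * (P (int n + 1) + real M * (B * s))"
    proof (intro mult_mono)
      show "norm (window a 1 n) \<le> B" using n by (intro B) auto
      have "norm (window a 1 n *v site_pair u 1) \<le> norm (site_pair u (1 + int n))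
          + norm (site_pair u (1 + int n) - window a 1 n *v site_pair u 1)"
        using norm_triangle_ineq4[of "site_pair u (1 + int n)" "site_pair u (1 + int n) - window a 1 n *v site_pair u 1"] by simp
      then show "norm (window a 1 n *v site_pair u 1) \<le> P (int n + 1) + real M * (B * s)"
        using e nM by (simp add: P_def add.commute)
    qed (use B1 in auto)
    finally show ?thesis .
  qed
  have left: "P 0 \<le> B * (P (- int n) + real M * (B * s))"
  proof -
    have e: "norm (site_pair u (- int n + int n) - window a (- int n) n *v site_pair u (- int n)) \<le> real n * (B * s)"
      by (rule inhomogeneous_window[where lo = "- int M" and hi = 0 and \<sigma> = \<sigma>])
        (use rec s B n in \<open>auto simp del: window.simps\<close>)
    have "P 0 \<le> norm (window a (- int n) n *v site_pair u (- int n)) + real n * (B * s)"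
      using e norm_triangle_sub[of "site_pair u 0" "window a (- int n) n *v site_pair u (- int n)"] by (simp add: P_def)
    also have "norm (window a (- int n) n *v site_pair u (- int n)) \<le> B * P (- int n)"
      unfolding P_def using n B1 by (intro order_trans[OF norm_cmat_vec] mult_right_mono B) auto
    also have "real n * (B * s) \<le> B * (real M * (B * s))"
    proof -
      have "1 * (real M * (B * s)) \<le> B * (real M * (B * s))" using B1 s0 by (intro mult_right_mono) auto
      then show ?thesis using nM by linarith
    qed
    finally show ?thesis by (simp add: distrib_left)
  qed
  have "\<sigma> 0 = u 1 + u (0 - 1) - a 0 * u 0" using rec[of 0] by simp
  then have "cmod (\<sigma> 0) \<le> cmod (u 1) + cmod (u (0 - 1)) + cmod (a 0) * cmod (u 0)"
    using norm_triangle_ineq4[of "u 1 + u (0 - 1)" "a 0 * u 0"] norm_triangle_ineq[of "u 1" "u (0 - 1)"]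
    by (simp add: norm_mult)
  also have "\<dots> \<le> P 1 + P 0 + R * P 0"
    unfolding P_def using cmod_le_norm_site_pair[of u 0] cmod_le_norm_site_pair[of u 1] R R0
    by (intro add_mono mult_mono) auto
  also have "\<dots> \<le> (1 + R) * (P 1 + P 0)"
    using R0 by (simp add: algebra_simps P_def)
  also have "\<dots> \<le> (1 + R) * (B * (P (int n + 1) + real M * (B * s)) + B * (P (- int n) + real M * (B * s)))"
    using R0 by (intro mult_left_mono add_mono left right) auto
  also have "\<dots> = (1 + R) * B * (P (int n + 1) + P (- int n)) + (1 + R) * B * (2 * (real M * (B * s)))"
    by (simp add: algebra_simps)
  finally have "1 / 4 \<le> (1 + R) * B * (P (int n + 1) + P (- int n))" using \<sigma>0 small by linarith
  then have "(1 / 4)\<^sup>2 \<le> ((1 + R) * B * (P (int n + 1) + P (- int n)))\<^sup>2" by (rule power_mono) simp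
  also have "\<dots> = ((1 + R) * B)\<^sup>2 * (P (int n + 1) + P (- int n))\<^sup>2" by (simp add: power_mult_distrib)
  also have "\<dots> \<le> ((1 + R) * B)\<^sup>2 * (2 * ((P (int n + 1))\<^sup>2 + (P (- int n))\<^sup>2))"
    using sum_squares_bound[of "P (int n + 1)" "P (- int n)"] by (intro mult_left_mono) (auto simp: power2_sum)
  finally have "1 / 16 \<le> ((1 + R) * B)\<^sup>2 * (2 * ((P (int n + 1))\<^sup>2 + (P (- int n))\<^sup>2))" by (simp add: power_divide)
  moreover have "0 < ((1 + R) * B)\<^sup>2" using R0 B1 by (intro zero_less_power mult_pos_pos) auto
  moreover have "1 / 16 \<le> y * (2 * x) \<Longrightarrow> 0 < y \<Longrightarrow> 1 / (32 * y) \<le> x" for x y :: real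
    by (simp add: field_simps)
  ultimately have "1 / (32 * ((1 + R) * B)\<^sup>2) \<le> (P (int n + 1))\<^sup>2 + (P (- int n))\<^sup>2" by blast
  then show ?thesis unfolding P_def norm_site_pair_sq by (simp add: algebra_simps)
qed

lemma sum_consecutive_le:
  fixes g :: "nat \<Rightarrow> real"
  assumes "\<And>n. 0 \<le> g n"
  shows "(\<Sum>n\<in>{N..<2*N}. g n + g (Suc n)) \<le> 2 * (\<Sum>n\<in>{N..2*N}. g n)"
proof -
  have "(\<Sum>n\<in>{N..<2*N}. g n) \<le> (\<Sum>n\<in>{N..2*N}. g n)" using assms by (intro sum_mono2) auto
  moreover have "(\<Sum>n\<in>{N..<2*N}. g (Suc n)) = (\<Sum>n\<in>{Suc N..<Suc (2*N)}. g n)"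
    by (rule sum.shift_bounds_Suc_ivl[symmetric])
  moreover have "\<dots> \<le> (\<Sum>n\<in>{N..2*N}. g n)" using assms by (intro sum_mono2) auto
  ultimately show ?thesis by (simp add: sum.distrib)
qed

text \<open>
  For each energy of a grid in \<open>[E0, E0 + l]\<close>, \<open>solution_lower_bound\<close>
  bounds the squared norm of the transform from below by order \<open>N / B\<^sup>2\<close> on the
  sites with \<open>N \<le> |n| \<le> 2 N\<close>. The grid has about \<open>l * L / (2
  \<pi>)\<close> points, so in Bessel's inequality the cutoff \<open>L\<close> cancels.
\<close>
lemma averaged_moment_lower_bound:
  fixes v :: "int \<Rightarrow> real"
  assumes v: "\<And>n. \<bar>v n\<bar> + 2 \<le> h" and p: "0 < p" and T: "1 \<le> T" and l: "0 < l" and N: "1 \<le> N"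
    and R: "\<And>E. E0 \<le> E \<Longrightarrow> E \<le> E0 + l \<Longrightarrow> cmod (Complex (E - v 0) (1 / T)) \<le> R"
    and B: "\<And>E j n. E0 \<le> E \<Longrightarrow> E \<le> E0 + l \<Longrightarrow> - int (2 * N) \<le> j \<Longrightarrow> j + int n \<le> int (2 * N) + 1
      \<Longrightarrow> norm (window (\<lambda>i. Complex (E - v i) (1 / T)) j n) \<le> B"
  shows "real N powr p * (real N / T) * (l / (128 * pi * ((1 + R) * B)\<^sup>2))
    \<le> averaged_moment v p T"
proof -
  have T0: "0 < T" using T by simp
  have B1: "1 \<le> B"
    by (rule order_trans[OF norm_window_ge_1 B[of E0 0 0]]) (use l in auto)
  have R0: "0 \<le> R" using order_trans[OF norm_ge_zero R[of E0]] l by simp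
  define M where "M = 2 * N"
  define C where "C = (1 + R) * B * (2 * (real M * B))"
  \<comment> \<open>The cutoff is so large that the boundary term at \<open>t = L\<close> cannot compete with the source.\<close>
  have "\<forall>\<^sub>F L in at_top. exp (- L / T) \<le> 1 / 2 \<and> C * exp (- L / T) \<le> 1 / 4 \<and> 4 * pi / l \<le> L \<and> 0 < L"
  proof (intro eventually_conj)
    show "\<forall>\<^sub>F L in at_top. exp (- L / T) \<le> 1 / 2" "\<forall>\<^sub>F L in at_top. 4 * pi / l \<le> L"
      "\<forall>\<^sub>F L in at_top. 0 < (L::real)" using T0 by real_asymp+
    have "((\<lambda>L. C * exp (- L / T)) \<longlongrightarrow> 0) at_top" using T0 by real_asymp
    then have "\<forall>\<^sub>F L in at_top. C * exp (- L / T) < 1 / 4" by (rule order_tendstoD) simp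
    then show "\<forall>\<^sub>F L in at_top. C * exp (- L / T) \<le> 1 / 4" by (rule eventually_mono) simp
  qed
  from eventually_happens'[OF _ this] obtain L where L: "exp (- L / T) \<le> 1 / 2" "C * exp (- L / T) \<le> 1 / 4"
    "4 * pi / l \<le> L" "0 < L" by auto
  define K where "K = nat \<lfloor>l * L / (2 * pi)\<rfloor>"
  have lL: "2 \<le> l * L / (2 * pi)" using L(3) l by (simp add: field_simps)
  have K1: "real K \<le> l * L / (2 * pi)" and K2: "l * L / (4 * pi) \<le> real K"
  proof -
    have "real K = of_int \<lfloor>l * L / (2 * pi)\<rfloor>" using lL unfolding K_def by (simp add: le_floor_iff)
    then show "real K \<le> l * L / (2 * pi)" by simp
    have "l * L / (2 * pi) - 1 \<le> real K" using \<open>real K = _\<close> by linarith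
    moreover have "l * L / (4 * pi) = (l * L / (2 * pi)) / 2" by simp
    ultimately show "l * L / (4 * pi) \<le> real K" using lL by linarith
  qed
  define E where "E j = E0 + 2 * pi * real j / L" for j :: nat
  have E: "E0 \<le> E j" "E j \<le> E0 + l" if "j < K" for j
  proof -
    show "E0 \<le> E j" using L by (simp add: E_def)
    have "real j \<le> l * L / (2 * pi)" using that K1 by linarith
    then have "2 * pi * real j / L \<le> l" using L by (simp add: field_simps)
    then show "E j \<le> E0 + l" by (simp add: E_def)
  qed
  define u where "u j = time_transform v L (Complex (E j) (1 / T))" for j
  define c where "c = 1 / (32 * ((1 + R) * B)\<^sup>2)"
  define F where "F = {int N..int (2 * N)} \<union> {- int (2 * N)..- int N}"
  have amp1: "cmod (amplitude v L n) \<le> 1" for n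
    by (rule power2_le_imp_le) (use sum_amplitude_le_1[of v h, OF v, of L "{n}"] L in auto)
  have lower: "real N * c / 2 \<le> (\<Sum>n\<in>F. (cmod (u j n))\<^sup>2)" if j: "j < K" for j
  proof -
    define z where "z = Complex (E j) (1 / T)"
    define g where "g n = (cmod (u j (int n)))\<^sup>2 + (cmod (u j (- int n)))\<^sup>2" for n
    define \<sigma> where "\<sigma> n = \<i> * (exp (\<i> * z * of_real L) * amplitude v L n - (if n = 0 then 1 else 0))" for n
    have ez: "cmod (exp (\<i> * z * of_real L) * amplitude v L n) \<le> exp (- L / T)" for n
    proof -
      have "cmod (exp (\<i> * z * of_real L)) = exp (- L / T)"
        by (simp add: z_def)
      then show ?thesis using mult_left_mono[OF amp1[of n], of "exp (- L / T)"] by (simp add: norm_mult)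
    qed
    have g: "c \<le> g n + g (Suc n)" if n: "n \<le> M" for n
    proof -
      have "c \<le> (cmod (u j (int n)))\<^sup>2 + (cmod (u j (- int n)))\<^sup>2
          + ((cmod (u j (int n + 1)))\<^sup>2 + (cmod (u j (- int n - 1)))\<^sup>2)"
        unfolding c_def
      proof (rule solution_lower_bound[where u = "u j" and n = n and R = R and B = B and a = "\<lambda>i. Complex (E j - v i) (1 / T)" and \<sigma> = \<sigma> and s = "exp (- L / T)" and M = M])
        show "u j (i + 1) = Complex (E j - v i) (1 / T) * u j i - u j (i - 1) + \<sigma> i" for i
        proof -
          have "z - of_real (v i) = Complex (E j - v i) (1 / T)" by (simp add: z_def complex_eq_iff)
          then show ?thesis
            using time_transform_recurrence[of v h L z i, OF v] L unfolding u_def \<sigma>_def z_def[symmetric] by simp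
        qed
        show "cmod (\<sigma> i) \<le> exp (- L / T)" if "i \<noteq> 0" for i
          using ez[of i] that by (simp add: \<sigma>_def norm_mult)
        have "1 \<le> cmod (1 - exp (\<i> * z * of_real L) * amplitude v L 0) + cmod (exp (\<i> * z * of_real L) * amplitude v L 0)"
          using norm_triangle_ineq[of "1 - exp (\<i> * z * of_real L) * amplitude v L 0" "exp (\<i> * z * of_real L) * amplitude v L 0"] by simp
        moreover have "cmod (\<sigma> 0) = cmod (1 - exp (\<i> * z * of_real L) * amplitude v L 0)"
          unfolding \<sigma>_def by (simp only: norm_mult norm_ii if_True mult_1 norm_minus_commute simp_thms)
        ultimately show "1 / 2 \<le> cmod (\<sigma> 0)" using ez[of 0] L(1) by linarith
        show "cmod (Complex (E j - v 0) (1 / T)) \<le> R" by (rule R[OF E[OF j]])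
        show "norm (window (\<lambda>i. Complex (E j - v i) (1 / T)) i n) \<le> B" if "- int M \<le> i" "i + int n \<le> int M + 1" for i n
          using that by (intro B E j) (auto simp: M_def)
        show "(1 + R) * B * (2 * (real M * (B * exp (- L / T)))) \<le> 1 / 4"
          using L(2) by (simp add: C_def algebra_simps)
        show "n \<le> M" by (rule n)
      qed
      moreover have "int (Suc n) = int n + 1" "- (int n + 1) = - int n - 1" by simp_all
      ultimately show ?thesis unfolding g_def by presburger
    qed
    have "real N * c = (\<Sum>n\<in>{N..<2*N}. c)" by simp
    also have "\<dots> \<le> (\<Sum>n\<in>{N..<2*N}. g n + g (Suc n))"
      by (intro sum_mono g) (auto simp: M_def)
    also have "\<dots> \<le> 2 * (\<Sum>n\<in>{N..2*N}. g n)" by (rule sum_consecutive_le) (simp add: g_def)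
    also have "(\<Sum>n\<in>{N..2*N}. g n) = (\<Sum>n\<in>F. (cmod (u j n))\<^sup>2)"
    proof -
      have 1: "(\<Sum>n\<in>{N..2*N}. (cmod (u j (int n)))\<^sup>2) = (\<Sum>n\<in>{int N..int (2 * N)}. (cmod (u j n))\<^sup>2)"
        by (rule sum.reindex_bij_witness[of _ nat int]) auto
      have 2: "(\<Sum>n\<in>{N..2*N}. (cmod (u j (- int n)))\<^sup>2) = (\<Sum>n\<in>{- int (2 * N)..- int N}. (cmod (u j n))\<^sup>2)"
        by (rule sum.reindex_bij_witness[of _ "\<lambda>n. nat (- n)" "\<lambda>n. - int n"]) auto
      show ?thesis unfolding F_def g_def sum.distrib 1 2
        by (rule sum.union_disjoint[symmetric]) (use N in auto)
    qed
    finally show ?thesis by simp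
  qed
  have bessel: "(\<Sum>j<K. (cmod (u j n))\<^sup>2) \<le> L * integral {0..L} (\<lambda>t. exp (- 2 * t / T) * site_prob v t n)" for n
  proof -
    define f where "f t = exp (of_real (- t / T)) * amplitude v t n" for t
    have "continuous_on {0..L} f"
      unfolding f_def using T0 by (intro continuous_intros continuous_on_amplitude[where v = v and h = h, OF v]) auto
    from bessel_inequality_grid[OF L(4) this, where K = K and E = E0]
    have "(\<Sum>j<K. (cmod (integral {0..L} (\<lambda>t. exp (\<i> * of_real (E j * t)) * f t)))\<^sup>2)
      \<le> L * integral {0..L} (\<lambda>t. (cmod (f t))\<^sup>2)" unfolding E_def .
    moreover have "exp (\<i> * of_real (E j * t)) * f t = exp (\<i> * Complex (E j) (1 / T) * of_real t) * amplitude v t n" for j t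
    proof -
      have "\<i> * Complex (E j) (1 / T) * of_real t = \<i> * of_real (E j * t) + of_real (- t / T)"
        by (simp add: complex_eq_iff)
      then show ?thesis unfolding f_def by (simp only: exp_add mult.assoc)
    qed
    moreover have "(cmod (f t))\<^sup>2 = exp (- 2 * t / T) * site_prob v t n" for t
      by (simp add: f_def norm_mult power_mult_distrib exp_double[symmetric])
    ultimately show ?thesis by (simp add: u_def time_transform_def)
  qed
  define I where "I n = integral {0..L} (\<lambda>t. exp (- 2 * t / T) * site_prob v t n)" for n
  have "real K * (real N * c / 2) \<le> (\<Sum>j<K. \<Sum>n\<in>F. (cmod (u j n))\<^sup>2)"
    using sum_mono[of "{..<K}" "\<lambda>_. real N * c / 2"] lower by simp
  also have "\<dots> = (\<Sum>n\<in>F. \<Sum>j<K. (cmod (u j n))\<^sup>2)" by (rule sum.swap)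
  also have "\<dots> \<le> (\<Sum>n\<in>F. L * I n)" unfolding I_def by (intro sum_mono bessel)
  finally have "real K * (real N * c / 2) \<le> L * (\<Sum>n\<in>F. I n)" by (simp add: sum_distrib_left)
  moreover have "l * L / (4 * pi) * (real N * c / 2) \<le> real K * (real N * c / 2)"
    using K2 by (intro mult_right_mono) (auto simp: c_def)
  ultimately have "L * (l / (4 * pi) * (real N * c / 2)) \<le> L * (\<Sum>n\<in>F. I n)" by (simp add: mult_ac)
  then have I: "l / (4 * pi) * (real N * c / 2) \<le> (\<Sum>n\<in>F. I n)"
    using L(4) by (simp only: mult_le_cancel_left_pos)
  have "real N powr p * (real N / T) * (l / (128 * pi * ((1 + R) * B)\<^sup>2))
      \<le> 2 / T * (real N powr p * (l / (4 * pi) * (real N * c / 2)))"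
    using T0 l by (simp add: c_def) (simp add: field_simps)
  also have "\<dots> \<le> 2 / T * (real N powr p * (\<Sum>n\<in>F. I n))"
    using T0 by (intro mult_left_mono I) auto
  also have "\<dots> \<le> averaged_moment v p T"
    unfolding I_def
    by (rule averaged_moment_ge[where v = v and h = h, OF v p T]) (use L(4) in \<open>auto simp: F_def\<close>)
  finally show ?thesis .
qed

section \<open>A criterion for quasiballistic motion\<close>

lemma trace_window_real:
  assumes "\<And>i. Im (a i) = 0" shows "trace (window a j n) = complex_of_real (Re (trace (window a j n)))"
proof -
  have "(\<lambda>i. cnj (a i)) = a" using assms by (simp add: complex_eq_iff fun_eq_iff)
  then have "cnj (trace (window a j n)) = trace (window a j n)"
    using trace_window_cnj[of a j n] by simp
  then show ?thesis by (simp add: complex_eq_iff)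
qed

text \<open>
  Around a zero \<open>E1\<close> of the discriminant the discriminant stays in \<open>[-1, 1]\<close> on an interval whose
  length is only polynomially small in the bound \<open>B\<close> for one period.
\<close>
lemma norm_window_near_discriminant_zero:
  fixes w :: "int \<Rightarrow> real"
  assumes per: "\<And>i. w (i + int q) = w i" and q: "0 < q"
    and zero: "trace (window (\<lambda>i. complex_of_real (E1 - w i)) 0 q) = 0"
    and B: "\<And>j n. n \<le> q \<Longrightarrow> norm (window (\<lambda>i. complex_of_real (E1 - w i)) j n) \<le> B"
    and E: "\<bar>E - E1\<bar> \<le> 1 / (4 * real q * B\<^sup>2)"
  shows "norm (window (\<lambda>i. complex_of_real (E - w i)) j n) \<le> 27 * B\<^sup>2"
proof -
  let ?a = "\<lambda>i. complex_of_real (E - w i)" and ?a1 = "\<lambda>i. complex_of_real (E1 - w i)"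
  define e where "e = 1 / (4 * real q * B\<^sup>2)"
  have B1: "1 \<le> B" by (rule order_trans[OF norm_window_ge_1 B[of 0 0]]) simp
  have e0: "0 \<le> e" by (simp add: e_def)
  have diff: "cmod (?a i - ?a1 i) \<le> e" for i
    using E by (simp add: of_real_diff[symmetric] e_def del: of_real_diff)
  have small: "real q * (B * e) \<le> 1"
  proof -
    have "real q * (B * e) = 1 / (4 * B)" using q B1 by (simp add: e_def power2_eq_square)
    also have "\<dots> \<le> 1" using B1 by simp
    finally show ?thesis .
  qed
  have pert: "norm (window ?a j n - window ?a1 j n) \<le> 2 * real q * B\<^sup>2 * e" "norm (window ?a j n) \<le> 3 * B" if "n \<le> q" for j n
    using that window_perturbation[where lo = j and hi = "j + int n" and q = q and a = ?a1 and b = ?a and B = B and e = e, of j n]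
      B diff e0 small by auto
  have half: "2 * real q * B\<^sup>2 * e = 1 / 2" using q B1 by (simp add: e_def)
  \<comment> \<open>The discriminant moves by at most twice the change of the one-period matrix, hence by at most 1.\<close>
  define D where "D = Re (trace (window ?a 0 q))"
  have tr: "trace (window ?a 0 q) = complex_of_real D" unfolding D_def by (rule trace_window_real) simp
  have "trace (window ?a 0 q) = trace (window ?a 0 q - window ?a1 0 q)"
    unfolding trace_sub zero by simp
  then have "\<bar>D\<bar> \<le> 2 * norm (window ?a 0 q - window ?a1 0 q)"
    using cmod_trace_le[of "window ?a 0 q - window ?a1 0 q"] tr by simp
  also have "\<dots> \<le> 1" using pert(1)[of q 0] half by simp
  finally have D: "\<bar>D\<bar> \<le> 1" .
  have "norm (window ?a j n) \<le> 3 * (3 * B)\<^sup>2"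
    by (rule norm_long_window_periodic[where q = q and D = D]) (use per q tr D pert(2) in auto)
  then show ?thesis by (simp add: power_mult_distrib)
qed

text \<open>
  Here \<open>N\<close> is of order \<open>T / B\<^sup>2\<close>: up to this distance both
  perturbations of the periodic problem, the imaginary part \<open>1 / T\<close> and the error
  \<open>\<Lambda> * N * |\<alpha> - pn / q|\<close> of the potential, stay harmless when
  accumulated over \<open>4 N + 1\<close> steps with transfer matrices of size \<open>27
  B\<^sup>2\<close>. The perturbed matrices are then at most \<open>81 B\<^sup>2\<close>. The
  interval of energies has length \<open>1 / (4 q B\<^sup>2)\<close>, and \<open>q \<le> B\<close>
  makes this a power of \<open>B\<close> too.
\<close>
lemma averaged_moment_periodic_approximation:
  fixes V :: "real \<Rightarrow> real" and pn :: int and p \<alpha> \<theta> :: real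
  defines "v \<equiv> \<lambda>n::int. V (\<theta> + of_int n * \<alpha>)"
  assumes per: "\<And>x. V (x + 1) = V x" and lip: "\<Lambda>-lipschitz_on UNIV V" and h: "\<And>x. \<bar>V x\<bar> + 2 \<le> h"
    and p: "0 < p" and q: "0 < q"
    and zero: "trace (window (energies V \<theta> (of_int pn / real q) E1) 0 q) = 0"
    and B: "\<And>j n. n \<le> q \<Longrightarrow> norm (window (energies V \<theta> (of_int pn / real q) E1) j n) \<le> B"
    and qB: "real q \<le> B" and E1: "\<bar>E1\<bar> \<le> h + 1"
    and T: "270 * B\<^sup>2 \<le> T" "(1 + \<Lambda>) * T\<^sup>2 * \<bar>\<alpha> - of_int pn / real q\<bar> \<le> 1"
  shows "T powr p / (540 powr p * (540 * 512 * pi * (3 + 2 * h)\<^sup>2 * 6561)) * B powr (- (2 * p + 9))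
     \<le> averaged_moment v p T"
proof -
  define \<rho> where "\<rho> = of_int pn / real q"
  define w where "w i = V (\<theta> + of_int i * \<rho>)" for i :: int
  define \<delta> where "\<delta> = \<bar>\<alpha> - \<rho>\<bar>"
  have B1: "1 \<le> B" by (rule order_trans[OF norm_window_ge_1 B[of 0 0]]) simp
  have \<Lambda>: "0 \<le> \<Lambda>" using lip by (rule lipschitz_on_nonneg)
  have h0: "2 \<le> h" using h[of 0] abs_ge_zero[of "V 0"] by linarith
  have B2: "1 \<le> B\<^sup>2" using B1 by simp
  have T1: "1 \<le> T" using T(1) B2 by linarith
  have wper: "w (i + int q) = w i" for i
  proof -
    have "\<theta> + of_int (i + int q) * \<rho> = (\<theta> + of_int i * \<rho>) + of_int pn" using q by (simp add: \<rho>_def field_simps)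
    then show ?thesis unfolding w_def by (simp only: periodic_int_shift[of V, OF per])
  qed
  define x where "x = T / (270 * B\<^sup>2)"
  define N where "N = nat \<lfloor>x\<rfloor>"
  have x1: "1 \<le> x" unfolding x_def using T(1) B2 by (subst le_divide_eq_1_pos) auto
  have Nx: "real N \<le> x" "x / 2 \<le> real N" "1 \<le> N"
  proof -
    have r: "real N = of_int \<lfloor>x\<rfloor>" using x1 unfolding N_def by simp
    then show "real N \<le> x" by simp
    show "1 \<le> N" using x1 unfolding N_def by (simp add: le_nat_iff le_floor_iff)
    then show "x / 2 \<le> real N" using r floor_correct[of x] by linarith
  qed
  define l where "l = 1 / (4 * real q * B\<^sup>2)"
  have l: "0 < l" "l \<le> 1"
  proof -
    show "0 < l" using q B1 by (simp add: l_def)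
    have "1 * 1 \<le> 4 * real q * B\<^sup>2" using q B2 by (intro mult_mono) auto
    then show "l \<le> 1" by (simp add: l_def)
  qed
  define e where "e = 1 / T + \<Lambda> * (real (2 * N) * \<delta>)"
  have e0: "0 \<le> e" using \<Lambda> T1 by (simp add: e_def \<delta>_def)
  have bound: "norm (window (\<lambda>i. Complex (E - v i) (1 / T)) j n) \<le> 81 * B\<^sup>2"
    if E: "E1 \<le> E" "E \<le> E1 + l" and j: "- int (2 * N) \<le> j" "j + int n \<le> int (2 * N) + 1" for E j n
  proof -
    have "norm (window (\<lambda>i. Complex (E - v i) (1 / T)) j n) \<le> 3 * (27 * B\<^sup>2)"
    proof (rule window_perturbation(2)[where lo = "- int (2 * N)" and hi = "int (2 * N) + 1" and q = "4 * N + 1"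
          and a = "\<lambda>i. complex_of_real (E - w i)" and e = e])
      show "norm (window (\<lambda>i. complex_of_real (E - w i)) j n) \<le> 27 * B\<^sup>2" for j n
      proof (rule norm_window_near_discriminant_zero[where q = q and ?E1.0 = E1])
        show "\<bar>E - E1\<bar> \<le> 1 / (4 * real q * B\<^sup>2)" using E by (simp add: l_def)
      qed (use wper q zero B in \<open>auto simp: w_def \<rho>_def\<close>)
      show "cmod (Complex (E - v i) (1 / T) - complex_of_real (E - w i)) \<le> e"
        if i: "- int (2 * N) \<le> i" "i < int (2 * N) + 1" for i
      proof -
        have "cmod (Complex (E - v i) (1 / T) - complex_of_real (E - w i)) \<le> \<bar>v i - w i\<bar> + 1 / T"
          using cmod_le[of "Complex (E - v i) (1 / T) - complex_of_real (E - w i)"] T1 by simp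
        also have "\<bar>v i - w i\<bar> \<le> \<Lambda> * (\<bar>real_of_int i\<bar> * \<delta>)"
          unfolding v_def w_def \<delta>_def by (rule lipschitz_potential_diff[OF lip])
        also have "\<dots> \<le> \<Lambda> * (real (2 * N) * \<delta>)"
          using i \<Lambda> by (intro mult_left_mono mult_right_mono) (auto simp: \<delta>_def abs_le_iff)
        finally show ?thesis by (simp add: e_def)
      qed
      show "real (4 * N + 1) * (27 * B\<^sup>2 * e) \<le> 1"
      proof -
        have NB: "270 * (real N * B\<^sup>2) \<le> T" using Nx(1) B2 unfolding x_def by (subst (asm) pos_le_divide_eq) (auto simp: mult_ac)
        have "\<Lambda> * (real (2 * N) * \<delta>) * (135 * real N * B\<^sup>2) = \<Lambda> * \<delta> * (270 * (real N * B\<^sup>2)) * real N"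
          by (simp add: algebra_simps)
        also have "\<dots> \<le> \<Lambda> * \<delta> * T * (T / 270)"
        proof (intro mult_mono NB mult_nonneg_nonneg)
          have "real N * 1 \<le> real N * B\<^sup>2" using B2 by (intro mult_left_mono) auto
          then have "real N * 270 \<le> 270 * (real N * B\<^sup>2)" by simp
          then show "real N \<le> T / 270" using NB by simp
        qed (use \<Lambda> T1 in \<open>auto simp: \<delta>_def\<close>)
        also have "\<dots> = \<Lambda> * T\<^sup>2 * \<delta> / 270" by (simp add: power2_eq_square)
        also have "\<dots> \<le> (1 + \<Lambda>) * T\<^sup>2 * \<delta> / 270"
          by (intro divide_right_mono mult_right_mono) (auto simp: \<delta>_def)
        also have "\<dots> \<le> 1 / 2" using T(2) unfolding \<delta>_def \<rho>_def by simp
        finally have 2: "\<Lambda> * (real (2 * N) * \<delta>) * (135 * real N * B\<^sup>2) \<le> 1 / 2" .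
        have 1: "1 / T * (135 * real N * B\<^sup>2) \<le> 1 / 2" using NB T1 by (simp add: field_simps)
        have "real (4 * N + 1) * (27 * B\<^sup>2 * e) \<le> (5 * real N) * (27 * B\<^sup>2 * e)"
          using Nx(3) e0 by (intro mult_right_mono) auto
        also have "\<dots> = e * (135 * real N * B\<^sup>2)" by (simp add: algebra_simps)
        also have "\<dots> = 1 / T * (135 * real N * B\<^sup>2) + \<Lambda> * (real (2 * N) * \<delta>) * (135 * real N * B\<^sup>2)"
          unfolding e_def by (rule distrib_right)
        also have "\<dots> \<le> 1" using 1 2 by linarith
        finally show ?thesis .
      qed
      show "n \<le> 4 * N + 1" using j by linarith
    qed (use e0 j in auto)
    then show ?thesis by simp
  qed
  define R where "R = 2 + 2 * h"
  have lower: "real N powr p * (real N / T) * (l / (128 * pi * ((1 + R) * (81 * B\<^sup>2))\<^sup>2))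
    \<le> averaged_moment v p T"
  proof (rule averaged_moment_lower_bound[where v = v and h = h and ?E0.0 = E1 and l = l and N = N and R = R and B = "81 * B\<^sup>2"])
    show "\<bar>v n\<bar> + 2 \<le> h" for n unfolding v_def by (rule h)
    show "cmod (Complex (E - v 0) (1 / T)) \<le> R" if "E1 \<le> E" "E \<le> E1 + l" for E
    proof -
      have "cmod (Complex (E - v 0) (1 / T)) \<le> \<bar>E - v 0\<bar> + 1 / T"
        using cmod_le[of "Complex (E - v 0) (1 / T)"] T1 by simp
      moreover have "1 / T \<le> 1" using T1 by simp
      moreover have "\<bar>v 0\<bar> + 2 \<le> h" unfolding v_def by (rule h)
      ultimately show ?thesis using that E1 l(2) unfolding R_def by linarith
    qed
    show "norm (window (\<lambda>i. Complex (E - v i) (1 / T)) j n) \<le> 81 * B\<^sup>2"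
      if "E1 \<le> E" "E \<le> E1 + l" "- int (2 * N) \<le> j" "j + int n \<le> int (2 * N) + 1" for E j n
      by (rule bound[OF that])
  qed (use p T1 l Nx in simp_all)
  have N1: "T / (540 * B\<^sup>2) \<le> real N" using Nx(2) by (simp add: x_def)
  have TB: "0 \<le> T / (540 * B\<^sup>2)" using T1 B2 by simp
  have Bp: "B\<^sup>2 = B powr 2" "B ^ 4 = B powr 4" using B1 powr_realpow[of B 2] powr_realpow[of B 4] by simp_all
  have "T powr p / (540 powr p * (540 * 512 * pi * (3 + 2 * h)\<^sup>2 * 6561)) * B powr (- (2 * p + 9))
     = (T / (540 * B\<^sup>2)) powr p * ((T / (540 * B\<^sup>2)) / T) * ((1 / (4 * B * B\<^sup>2)) / (128 * pi * ((1 + R) * (81 * B\<^sup>2))\<^sup>2))"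
  proof -
    have e1: "(T / (540 * B\<^sup>2)) powr p = T powr p / (540 powr p * B powr (2 * p))"
    proof -
      have "(B\<^sup>2) powr p = B powr (2 * p)" by (simp only: Bp powr_powr)
      then show ?thesis using T1 B1 by (simp add: powr_divide powr_mult)
    qed
    have e2: "B powr (- (2 * p + 9)) = 1 / (B powr (2 * p) * B ^ 9)"
    proof -
      have "B powr (2 * p + 9) = B powr (2 * p) * B ^ 9" using B1 by (simp add: powr_add)
      then show ?thesis by (simp only: powr_minus_divide)
    qed
    have e3: "1 + R = 3 + 2 * h" by (simp add: R_def)
    have gen: "x / (c * (540 * 512 * d * k\<^sup>2 * 6561)) * (1 / (y * b ^ 9))
        = x / (c * y) * ((t / (540 * b\<^sup>2)) / t) * ((1 / (4 * b * b\<^sup>2)) / (128 * d * (k * (81 * b\<^sup>2))\<^sup>2))"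
      if "0 < b" "0 < c" "0 < d" "0 < k" "0 < t" "0 < y" for b c d k t x y :: real
    proof -
      have "(t / (540 * b\<^sup>2)) / t = 1 / (540 * b\<^sup>2)" using that by simp
      moreover have "(540 * b\<^sup>2) * ((4 * b * b\<^sup>2) * (128 * d * (k * (81 * b\<^sup>2))\<^sup>2)) = (540 * 512 * d * k\<^sup>2 * 6561) * b ^ 9"
        by (simp add: power_mult_distrib eval_nat_numeral)
      ultimately show ?thesis by (simp only: times_divide_times_eq mult_1 divide_divide_eq_left mult.assoc mult_1_right)
          (simp add: mult_ac)
    qed
    show ?thesis unfolding e1 e2 e3 by (rule gen) (use T1 B1 h0 in auto)
  qed
  also have "\<dots> \<le> real N powr p * (real N / T) * (l / (128 * pi * ((1 + R) * (81 * B\<^sup>2))\<^sup>2))"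
  proof (intro mult_mono powr_mono2 divide_right_mono N1 TB)
    show "1 / (4 * B * B\<^sup>2) \<le> l"
      unfolding l_def using q qB B1 by (intro divide_left_mono mult_right_mono) auto
  qed (use p T1 B1 h0 TB in \<open>auto simp: R_def\<close>)
  also note lower
  finally show ?thesis .
qed

lemma position_moment_eq:
  assumes V: "lipschitz_on_circle V"
  shows "position_moment (schroedinger V \<alpha> \<theta>) p T
    = averaged_moment (\<lambda>n. V (\<theta> + of_int n * \<alpha>)) p T"
  unfolding position_moment_def moment_def propagator_eq_amplitude[OF V] ..

text \<open>
  The averaged moment is at most a constant times \<open>T powr p\<close>.
\<close>
lemma upper_dynamical_exponent_le_1:
  assumes V: "lipschitz_on_circle V" and p: "0 < p"
  shows "upper_dynamical_exponent (schroedinger V \<alpha> \<theta>) p \<le> 1"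
proof -
  define v where "v n = V (\<theta> + of_int n * \<alpha>)" for n :: int
  obtain b where "\<And>x. \<bar>V x\<bar> \<le> b" using lipschitz_on_circle_bounded[OF V] by blast
  then have v: "\<bar>v n\<bar> + 2 \<le> b + 2" for n by (simp add: v_def)
  define m where "m T = position_moment (schroedinger V \<alpha> \<theta>) p T" for T
  define C where "C = 1 + 2 * ((2 * exp 1 * (b + 2)) powr p * p powr p + moment_const p)"
  have C: "1 \<le> C" using moment_const_nonneg[of v "b + 2" p, OF v p] by (simp add: C_def)
  have m: "m T \<le> C * T powr p" if "1 \<le> T" for T
  proof -
    have "m T \<le> 2 * ((2 * exp 1 * (b + 2)) powr p * p powr p + moment_const p) * T powr p"
      unfolding m_def position_moment_eq[OF V] v_def[symmetric]
      using averaged_moment_le[of v "b + 2" p T, OF v p that] by simp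
    also have "\<dots> \<le> C * T powr p" by (intro mult_right_mono) (auto simp: C_def)
    finally show ?thesis .
  qed
  have "\<forall>\<^sub>F T in at_top. ereal (ln (m T) / (p * ln T)) \<le> ereal (1 + ln C / (p * ln T))"
    using eventually_gt_at_top[of 1]
  proof eventually_elim
    case (elim T)
    have lT: "0 < ln T" using elim by simp
    have "ln (m T) \<le> ln C + p * ln T"
    proof (cases "0 < m T")
      case True
      then have "ln (m T) \<le> ln (C * T powr p)" using m[of T] elim C by (subst ln_le_cancel_iff) auto
      then show ?thesis using C elim by (simp add: ln_mult ln_powr)
    next
      case False
      moreover have "0 \<le> m T"
        unfolding m_def position_moment_eq[OF V] v_def[symmetric]
        using averaged_moment_ge[of v "b + 2" p T 0 "{}" 0, OF v p] elim by simp
      ultimately have "ln (m T) = 0" by simp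
      moreover have "0 \<le> ln C" using C by simp
      ultimately show ?thesis using p lT by simp
    qed
    then have "ln (m T) / (p * ln T) \<le> (ln C + p * ln T) / (p * ln T)"
      using p lT by (intro divide_right_mono) auto
    then show ?case using p lT by (simp add: add_divide_distrib add.commute)
  qed
  then have "Limsup at_top (\<lambda>T. ereal (ln (m T) / (p * ln T))) \<le> Limsup at_top (\<lambda>T. ereal (1 + ln C / (p * ln T)))"
    by (rule Limsup_mono)
  also have "\<dots> = 1"
  proof (rule lim_imp_Limsup)
    have "((\<lambda>T. 1 + ln C / (p * ln T)) \<longlongrightarrow> 1) at_top" using p by real_asymp
    then show "((\<lambda>T. ereal (1 + ln C / (p * ln T))) \<longlongrightarrow> 1) at_top" by (simp add: one_ereal_def)
  qed simp
  finally show ?thesis by (simp add: upper_dynamical_exponent_def m_def)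
qed

text \<open>
  The loss \<open>T powr (- s * (2 * p + 9))\<close> is the one of
  \<open>averaged_moment_periodic_approximation\<close> with \<open>B \<le> T powr s\<close>. It
  lowers the exponent by \<open>s * (2 * p + 9) / p\<close>, which tends to 0 with \<open>s\<close>.
\<close>
lemma quasiballistic_if_frequently_large:
  assumes V: "lipschitz_on_circle V"
    and low: "\<And>p s. 0 < p \<Longrightarrow> 0 < s \<Longrightarrow> s \<le> 1 / 8 \<Longrightarrow>
      \<exists>c>0. \<exists>\<^sub>F T in at_top. c * T powr p * T powr (- s * (2 * p + 9)) \<le> position_moment (schroedinger V \<alpha> \<theta>) p T"
  shows "quasiballistic (schroedinger V \<alpha> \<theta>)"
  unfolding quasiballistic_def
proof (intro allI impI antisym)
  fix p :: real assume p: "0 < p"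
  show "upper_dynamical_exponent (schroedinger V \<alpha> \<theta>) p \<le> 1" by (rule upper_dynamical_exponent_le_1[OF V p])
  define m where "m T = position_moment (schroedinger V \<alpha> \<theta>) p T" for T
  show "1 \<le> upper_dynamical_exponent (schroedinger V \<alpha> \<theta>) p"
  proof (rule ccontr)
    assume "\<not> ?thesis"
    then have "Limsup at_top (\<lambda>T. ereal (ln (m T) / (p * ln T))) < 1"
      by (simp add: upper_dynamical_exponent_def m_def)
    then obtain y where y: "Limsup at_top (\<lambda>T. ereal (ln (m T) / (p * ln T))) < ereal y" "ereal y < 1"
      using ereal_dense2 by blast
    have y1: "y < 1" using y(2) by simp
    have ev: "\<forall>\<^sub>F T in at_top. ln (m T) / (p * ln T) < y" using Limsup_lessD[OF y(1)] by simp
    define s where "s = min (1 / 8) ((1 - y) * p / (2 * (2 * p + 9)))"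
    have s: "0 < s" "s \<le> 1 / 8" unfolding s_def using p y1 by (auto intro: min.cobounded1 simp del: min_less_iff_conj simp add: min_def)
    have "s \<le> (1 - y) * p / (2 * (2 * p + 9))" by (simp add: s_def)
    then have sp: "s * (2 * p + 9) \<le> (1 - y) * p / 2" using p by (simp add: field_simps)
    obtain c where c: "0 < c" "\<exists>\<^sub>F T in at_top. c * T powr p * T powr (- s * (2 * p + 9)) \<le> m T"
      using low[OF p s] unfolding m_def by blast
    have "\<forall>\<^sub>F T in at_top. - ln c < (1 - y) * p / 2 * ln T" using p y1 by real_asymp
    then have "\<forall>\<^sub>F T in at_top. \<not> c * T powr p * T powr (- s * (2 * p + 9)) \<le> m T"
      using ev eventually_gt_at_top[of 1]
    proof eventually_elim
      case (elim T)
      have lT: "0 < ln T" using elim(3) by simp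
      have "ln (m T) < y * (p * ln T)" using elim(2) p lT by (simp add: pos_divide_less_eq)
      moreover have "ln (c * T powr p * T powr (- s * (2 * p + 9))) = ln c + p * ln T - s * (2 * p + 9) * ln T"
        using c(1) elim(3) by (simp add: ln_mult ln_powr)
      moreover have "s * (2 * p + 9) * ln T \<le> (1 - y) * p / 2 * ln T" using sp lT by (intro mult_right_mono) auto
      moreover have "p * ln T - y * (p * ln T) = 2 * ((1 - y) * p / 2 * ln T)" by (simp add: algebra_simps)
      ultimately have "ln (m T) < ln (c * T powr p * T powr (- s * (2 * p + 9)))" using elim(1) by linarith
      moreover have "0 < c * T powr p * T powr (- s * (2 * p + 9))" using c(1) elim(3) by simp
      ultimately show ?case by (smt (verit) ln_le_cancel_iff)
    qed
    then show False using c(2) by (simp add: frequently_def)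
  qed
qed

section \<open>Quasiballistic motion along the convergents\<close>

text \<open>
  All good rational approximations with a large denominator \<open>q\<close> have a zero of the
  discriminant, in a fixed bounded set of energies, at which the transfer matrices over at most one
  period grow at most at rate \<open>\<gamma>\<close>.
\<close>
definition tame_approximants :: "(real \<Rightarrow> real) \<Rightarrow> real \<Rightarrow> real \<Rightarrow> real \<Rightarrow> real \<Rightarrow> bool" where
  "tame_approximants V \<alpha> \<theta> c \<gamma> \<longleftrightarrow> (\<exists>K q0. \<forall>q\<ge>q0. \<forall>p. coprime p (int q) \<longrightarrow> \<bar>\<alpha> - of_int p / real q\<bar> \<le> 1 / real q \<longrightarrow>
     (\<exists>E. \<bar>E\<bar> \<le> c \<and> trace (window (energies V \<theta> (of_int p / real q) E) 0 q) = 0 \<and>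
       (\<forall>j n. n \<le> q \<longrightarrow> norm (window (energies V \<theta> (of_int p / real q) E) j n)
         \<le> exp (K + \<gamma> * real q))))"

lemma frequently_at_top_iff:
  "(\<exists>\<^sub>F T in at_top. P T) \<longleftrightarrow> (\<forall>T0::real. \<exists>T\<ge>T0. P T)"
  by (auto simp: frequently_def eventually_at_top_linorder)

text \<open>
  Take a convergent with a large denominator \<open>q\<close> whose successor satisfies \<open>q'
  \<ge> exp (\<kappa> q)\<close>, and the time \<open>T = sqrt (q' / (1 + \<Lambda>))\<close>, the
  largest one, up to constants, for which the periodic approximation is good enough. Then \<open>B =
  exp (K + \<gamma> q)\<close> is at most \<open>T powr s\<close>, because \<open>\<gamma> \<le> s
  \<kappa> / 4\<close> and \<open>T\<close> is about \<open>exp (\<kappa> q / 2)\<close> or larger.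
\<close>
lemma frequently_large_moment:
  assumes V: "lipschitz_on_circle V" and h: "\<And>x. \<bar>V x\<bar> + 2 \<le> h" and irr: "\<alpha> \<notin> \<rat>"
    and tame: "tame_approximants V \<alpha> \<theta> (h + 1) \<gamma>" and \<gamma>: "0 < \<gamma>"
    and p: "0 < p" and s: "0 < s" "s \<le> 1 / 8" and \<kappa>: "ereal \<kappa> < cf_beta \<alpha>" "4 * \<gamma> \<le> s * \<kappa>"
  shows "\<exists>c>0. \<exists>\<^sub>F T in at_top. c * T powr p * T powr (- s * (2 * p + 9)) \<le> position_moment (schroedinger V \<alpha> \<theta>) p T"
proof -
  obtain \<Lambda> where per: "\<And>x. V (x + 1) = V x" and lip: "\<Lambda>-lipschitz_on UNIV V"
    using V unfolding lipschitz_on_circle_def by blast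
  have \<Lambda>: "0 \<le> \<Lambda>" using lip by (rule lipschitz_on_nonneg)
  have h2: "2 \<le> h" using h[of 0] abs_ge_zero[of "V 0"] by linarith
  have "0 < s * \<kappa>" using \<kappa>(2) \<gamma> by linarith
  then have \<kappa>0: "0 < \<kappa>" using s by (simp add: zero_less_mult_iff)
  obtain K0 q0 where K0: "\<And>q p. q0 \<le> q \<Longrightarrow> coprime p (int q) \<Longrightarrow> \<bar>\<alpha> - of_int p / real q\<bar> \<le> 1 / real q \<Longrightarrow>
     (\<exists>E. \<bar>E\<bar> \<le> h + 1 \<and> trace (window (energies V \<theta> (of_int p / real q) E) 0 q) = 0 \<and>
       (\<forall>j n. n \<le> q \<longrightarrow> norm (window (energies V \<theta> (of_int p / real q) E) j n)
         \<le> exp (K0 + \<gamma> * real q)))"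
    using tame unfolding tame_approximants_def by blast
  \<comment> \<open>The second entry makes \<open>q \<le> exp (K + \<gamma> q)\<close>.\<close>
  define K where "K = max K0 (ln (1 / \<gamma>))"
  define c where "c = 1 / (540 powr p * (540 * 512 * pi * (3 + 2 * h)\<^sup>2 * 6561))"
  have c: "0 < c" using h2 by (simp add: c_def)
  show ?thesis
  proof (intro exI[of _ c] conjI c, unfold frequently_at_top_iff, intro allI)
    fix T0 :: real
    \<comment> \<open>Since \<open>s \<le> 1 / 8\<close>, \<open>B\<^sup>2 \<le> T powr (1 / 4)\<close>; so \<open>270 \<le> T powr (3 / 4)\<close> yields \<open>270 * B\<^sup>2 \<le> T\<close>.\<close>
    define T1 where "T1 = max T0 (270 powr (4 / 3))"
    have T1: "0 < T1" by (simp add: T1_def less_max_iff_disj)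
    define N where "N = q0 + nat \<lceil>(K + s / 2 * ln (1 + \<Lambda>)) * (4 / (s * \<kappa>))\<rceil> + nat \<lceil>(ln T1 + ln (1 + \<Lambda>) / 2) * (2 / \<kappa>)\<rceil> + 1"
    obtain pn qi q' :: int where qi: "int N \<le> qi" "coprime pn qi" "0 < q'"
      "exp (\<kappa> * of_int qi) \<le> of_int q'" "\<bar>\<alpha> - of_int pn / of_int qi\<bar> \<le> 1 / (of_int qi * of_int q')"
      by (rule frequently_good_approximant[OF irr \<kappa>(1)])
    define q where "q = nat qi"
    have qi_eq: "qi = int q" using qi(1) by (simp add: q_def)
    have "1 \<le> N" by (simp add: N_def)
    then have q: "N \<le> q" "0 < q" using qi(1) by (auto simp: qi_eq)
    have q'1: "1 \<le> real_of_int q'" using qi(3) by simp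
    have close: "\<bar>\<alpha> - of_int pn / real q\<bar> \<le> 1 / (real q * of_int q')" using qi(5) by (simp add: qi_eq)
    also have "\<dots> \<le> 1 / (real q * 1)" using q q'1 by (intro divide_left_mono mult_left_mono) auto
    finally have close1: "\<bar>\<alpha> - of_int pn / real q\<bar> \<le> 1 / real q" by simp
    have "q0 \<le> q" using q by (simp add: N_def)
    from K0[OF this qi(2)[unfolded qi_eq] close1] obtain E where E: "\<bar>E\<bar> \<le> h + 1"
      "trace (window (energies V \<theta> (of_int pn / real q) E) 0 q) = 0"
      "\<And>j n. n \<le> q \<Longrightarrow> norm (window (energies V \<theta> (of_int pn / real q) E) j n)
         \<le> exp (K0 + \<gamma> * real q)" by blast
    define B where "B = exp (K + \<gamma> * real q)"
    define T where "T = sqrt (of_int q' / (1 + \<Lambda>))"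
    have Tsq: "T\<^sup>2 = of_int q' / (1 + \<Lambda>)" using \<Lambda> q'1 by (simp add: T_def)
    have Tpos: "0 < T" using \<Lambda> q'1 by (simp add: T_def)
    have lnT: "\<kappa> * real q / 2 - ln (1 + \<Lambda>) / 2 \<le> ln T"
    proof -
      have "\<kappa> * real q \<le> ln (of_int q')" using qi(4) q'1 by (simp add: ln_ge_iff qi_eq)
      moreover have "2 * ln T = ln (T\<^sup>2)" using Tpos by (simp add: ln_realpow)
      moreover have "ln (T\<^sup>2) = ln (of_int q') - ln (1 + \<Lambda>)" unfolding Tsq using \<Lambda> q'1 by (simp add: ln_div)
      ultimately show ?thesis by linarith
    qed
    have T1T: "T1 \<le> T"
    proof -
      have "(ln T1 + ln (1 + \<Lambda>) / 2) * (2 / \<kappa>) \<le> real N" unfolding N_def of_nat_add by linarith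
      also have "\<dots> \<le> real q" using q by simp
      finally have "ln T1 + ln (1 + \<Lambda>) / 2 \<le> \<kappa> * real q / 2" using \<kappa>0 by (simp add: field_simps)
      then have "ln T1 \<le> ln T" using lnT by linarith
      then show ?thesis using T1 Tpos by simp
    qed
    have BT: "B \<le> T powr s"
    proof -
      have "(K + s / 2 * ln (1 + \<Lambda>)) * (4 / (s * \<kappa>)) \<le> real N" unfolding N_def of_nat_add by linarith
      also have "\<dots> \<le> real q" using q by simp
      finally have "K + s / 2 * ln (1 + \<Lambda>) \<le> s * \<kappa> / 4 * real q" using \<kappa>0 s by (simp add: field_simps)
      moreover have "\<gamma> * real q \<le> s * \<kappa> / 4 * real q" using \<kappa>(2) by (intro mult_right_mono) auto
      moreover have "s * (\<kappa> * real q / 2 - ln (1 + \<Lambda>) / 2) \<le> s * ln T" using lnT s by (intro mult_left_mono) auto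
      moreover have "s * (\<kappa> * real q / 2 - ln (1 + \<Lambda>) / 2) = 2 * (s * \<kappa> / 4 * real q) - s / 2 * ln (1 + \<Lambda>)"
        by (simp add: algebra_simps)
      ultimately have "K + \<gamma> * real q \<le> s * ln T" by linarith
      then show ?thesis using Tpos by (simp add: B_def powr_def)
    qed
    have qB: "real q \<le> B"
    proof -
      have "\<gamma> * real q \<le> exp (\<gamma> * real q)" using exp_ge_add_one_self[of "\<gamma> * real q"] by linarith
      then have "real q \<le> 1 / \<gamma> * exp (\<gamma> * real q)" using \<gamma> by (simp add: field_simps)
      also have "1 / \<gamma> \<le> exp K" using \<gamma> unfolding K_def by (metis divide_pos_pos exp_le_cancel_iff exp_ln max.cobounded2 zero_less_one)
      finally show ?thesis by (simp add: B_def exp_add)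
    qed
    have T270: "270 powr (4 / 3) \<le> T" using T1T by (simp add: T1_def)
    have T_ge_1: "1 \<le> T" using order_trans[OF ge_one_powr_ge_zero T270] by simp
    have B2T: "270 * B\<^sup>2 \<le> T"
    proof -
      have "B\<^sup>2 \<le> (T powr s)\<^sup>2" using BT by (intro power_mono) (auto simp: B_def)
      also have "\<dots> = T powr (2 * s)" using powr_power[of T s 2] Tpos by (simp add: mult.commute)
      also have "\<dots> \<le> T powr (1 / 4)" using s T_ge_1 by (intro powr_mono) auto
      finally have "B\<^sup>2 \<le> T powr (1 / 4)" .
      moreover have "270 \<le> T powr (3 / 4)"
        using powr_mono2[OF _ _ T270, of "3 / 4"] by (simp add: powr_powr)
      ultimately have "270 * B\<^sup>2 \<le> T powr (3 / 4) * T powr (1 / 4)" by (intro mult_mono) auto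
      also have "\<dots> = T" using Tpos by (simp add: powr_add[symmetric])
      finally show ?thesis .
    qed
    have Tclose: "(1 + \<Lambda>) * T\<^sup>2 * \<bar>\<alpha> - of_int pn / real q\<bar> \<le> 1"
    proof -
      have T2: "(1 + \<Lambda>) * T\<^sup>2 = of_int q'" unfolding Tsq using \<Lambda> by simp
      have "of_int q' * \<bar>\<alpha> - of_int pn / real q\<bar> \<le> of_int q' * (1 / (real q * of_int q'))"
        using close q'1 by (intro mult_left_mono) auto
      also have "\<dots> \<le> 1" using q q'1 by simp
      finally show ?thesis unfolding T2 .
    qed
    have KB: "exp (K0 + \<gamma> * real q) \<le> B" by (simp add: B_def K_def)
    have main: "c * T powr p * B powr (- (2 * p + 9)) \<le> position_moment (schroedinger V \<alpha> \<theta>) p T"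
      using averaged_moment_periodic_approximation[where V = V and \<Lambda> = \<Lambda> and h = h and p = p and q = q and ?E1.0 = E
          and \<theta> = \<theta> and pn = pn and B = B and T = T and \<alpha> = \<alpha>, OF per lip h p q(2) E(2) order_trans[OF E(3) KB] qB E(1) B2T Tclose]
      unfolding position_moment_eq[OF V] by (simp add: c_def)
    have "T powr (- s * (2 * p + 9)) = (T powr s) powr (- (2 * p + 9))" by (simp add: powr_powr algebra_simps)
    also have "\<dots> \<le> B powr (- (2 * p + 9))"
      using BT p by (intro powr_mono2') (auto simp: B_def)
    finally have "c * T powr p * T powr (- s * (2 * p + 9)) \<le> c * T powr p * B powr (- (2 * p + 9))"
      using c by (intro mult_left_mono) auto
    moreover have "T0 \<le> T" using T1T by (simp add: T1_def)
    ultimately show "\<exists>T\<ge>T0. c * T powr p * T powr (- s * (2 * p + 9)) \<le> position_moment (schroedinger V \<alpha> \<theta>) p T"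
      using main by (intro exI[of _ T]) linarith
  qed
qed

lemma periodic_sample:
  fixes V :: "real \<Rightarrow> real" and p :: int and q :: nat
  assumes "\<And>x. V (x + 1) = V x" and q: "0 < q"
  shows "V (\<theta> + of_int (i + int q) * (of_int p / real q)) = V (\<theta> + of_int i * (of_int p / real q))"
proof -
  have "\<theta> + of_int (i + int q) * (of_int p / real q) = (\<theta> + of_int i * (of_int p / real q)) + of_int p"
    using q by (simp add: field_simps)
  then show ?thesis by (simp only: periodic_int_shift[of V, OF assms(1)])
qed

text \<open>
  The rate is the trivial one, from multiplying the norms of the single steps.
\<close>
lemma tame_approximants_crude:
  assumes per: "\<And>x. V (x + 1) = V x" and b: "\<And>x. \<bar>V x\<bar> \<le> b"
  shows "tame_approximants V \<alpha> \<theta> (b + 3) (ln (2 * b + 5))"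
  unfolding tame_approximants_def
proof (rule exI[of _ "ln 2"], rule exI[of _ "1::nat"], intro allI impI)
  fix q :: nat and p :: int assume q: "1 \<le> q"
  have b0: "0 \<le> b" using order_trans[OF abs_ge_zero b[of 0]] .
  define w where "w i = V (\<theta> + of_int i * (of_int p / real q))" for i :: int
  have wper: "w (i + int q) = w i" for i unfolding w_def using q by (intro periodic_sample per) auto
  have wb: "\<bar>w i\<bar> \<le> b" for i unfolding w_def by (rule b)
  have q0: "0 < q" using q by simp
  obtain E where E: "\<bar>E\<bar> < b + 3" "discriminant w q (complex_of_real E) = 0"
    by (rule discriminant_zero_exists[of w q b, OF wper q0 wb])
  have "norm (window (\<lambda>i. complex_of_real (E - w i)) j n) \<le> exp (ln 2 + ln (2 * b + 5) * real q)" if n: "n \<le> q" for j n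
  proof -
    have "cmod (complex_of_real (E - w i)) \<le> 2 * b + 3" for i
    proof -
      have "cmod (complex_of_real (E - w i)) = \<bar>E - w i\<bar>" by (rule norm_of_real)
      then show ?thesis using E(1) wb[of i] by linarith
    qed
    then have "norm (window (\<lambda>i. complex_of_real (E - w i)) j n) \<le> 2 * (2 * b + 3 + 2) ^ n"
      by (rule norm_window_le_power)
    also have "2 * b + 3 + 2 = 2 * b + 5" by simp
    also have "2 * (2 * b + 5) ^ n \<le> 2 * (2 * b + 5) ^ q" using n b0 by (intro mult_left_mono power_increasing) auto
    also have "\<dots> = exp (ln 2 + ln (2 * b + 5) * real q)"
      using b0 by (simp add: exp_add exp_of_nat2_mult)
    finally show ?thesis .
  qed
  then show "\<exists>E. \<bar>E\<bar> \<le> b + 3 \<and> trace (window (energies V \<theta> (of_int p / real q) E) 0 q) = 0 \<and>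
       (\<forall>j n. n \<le> q \<longrightarrow> norm (window (energies V \<theta> (of_int p / real q) E) j n)
         \<le> exp (ln 2 + ln (2 * b + 5) * real q))"
    using E unfolding discriminant_def w_def by (intro exI[of _ E]) simp
qed

text \<open>
  The uniform bound is used twice. With rate \<open>\<gamma>\<close> it determines how close to
  \<open>E\<close> the zero of the discriminant has to be; with the much smaller rate
  \<open>d\<^sup>2 / 128\<close> it then shows that there is a zero within that distance
  \<open>d\<close>.
\<close>
lemma tame_approximants_subexponential:
  assumes per: "\<And>x. V (x + 1) = V x" and lip: "\<Lambda>-lipschitz_on UNIV V" and b: "\<And>x. \<bar>V x\<bar> \<le> b"
    and L: "lyapunov V \<alpha> E = 0" and \<gamma>: "0 < \<gamma>"
  shows "tame_approximants V \<alpha> \<theta> (\<bar>E\<bar> + 1) \<gamma>"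
proof -
  obtain \<delta> K q0 where \<delta>: "0 < \<delta>"
    and K: "\<And>q p E' \<theta> j n. q0 \<le> q \<Longrightarrow> coprime p (int q) \<Longrightarrow> \<bar>\<alpha> - of_int p / real q\<bar> \<le> 1 / real q \<Longrightarrow> \<bar>E' - E\<bar> \<le> \<delta> \<Longrightarrow> n \<le> q
      \<Longrightarrow> norm (window (energies V \<theta> (of_int p / real q) E') j n) \<le> exp (K + \<gamma> * real q)"
    using subexponential_windows[where V = V and \<Lambda> = \<Lambda> and b = b and E = E and \<alpha> = \<alpha> and \<gamma> = \<gamma>, OF per lip b L \<gamma>] by metis
  define d where "d = min \<delta> 1"
  have d: "0 < d" "d \<le> 1" "d \<le> \<delta>" using \<delta> by (auto simp: d_def)
  have d2: "0 < d\<^sup>2 / 128" using d by simp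
  obtain \<delta>' K' q1 where K': "\<And>q p E' \<theta> j n. q1 \<le> q \<Longrightarrow> coprime p (int q) \<Longrightarrow> \<bar>\<alpha> - of_int p / real q\<bar> \<le> 1 / real q \<Longrightarrow> \<bar>E' - E\<bar> \<le> \<delta>' \<Longrightarrow> n \<le> q
      \<Longrightarrow> norm (window (energies V \<theta> (of_int p / real q) E') j n) \<le> exp (K' + d\<^sup>2 / 128 * real q)"
    and \<delta>': "0 < \<delta>'"
    using subexponential_windows[where V = V and \<Lambda> = \<Lambda> and b = b and E = E and \<alpha> = \<alpha> and \<gamma> = "d\<^sup>2 / 128", OF per lip b L d2] by metis
  define q2 where "q2 = q0 + q1 + nat \<lceil>(ln 100 + 4 * K') * (16 / d\<^sup>2)\<rceil> + 1"
  show ?thesis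
    unfolding tame_approximants_def
  proof (rule exI[of _ K], rule exI[of _ q2], intro allI impI)
    fix q :: nat and p :: int
    assume q: "q2 \<le> q" and pq: "coprime p (int q)" and close: "\<bar>\<alpha> - of_int p / real q\<bar> \<le> 1 / real q"
    have q0: "0 < q" "q0 \<le> q" "q1 \<le> q" using q by (auto simp: q2_def)
    define w where "w i = V (\<theta> + of_int i * (of_int p / real q))" for i :: int
    have wper: "w (i + int q) = w i" for i unfolding w_def using q0 by (intro periodic_sample per) auto
    have M: "norm (window (\<lambda>i. complex_of_real (E - w i)) 0 q) \<le> exp (K' + real q * (d\<^sup>2 / 128))"
      using K'[OF q0(3) pq close, of E q \<theta> 0] \<delta>' by (simp add: w_def mult.commute)
    have large: "ln 100 + 4 * K' < real q * (d\<^sup>2 / 16)"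
    proof -
      have "(ln 100 + 4 * K') * (16 / d\<^sup>2) < real q2" unfolding q2_def of_nat_add by linarith
      also have "\<dots> \<le> real q" using q by simp
      finally show ?thesis using d by (simp add: field_simps)
    qed
    obtain E1 where E1: "\<bar>E1 - E\<bar> < d" "discriminant w q (complex_of_real E1) = 0"
      using discriminant_zero_near[of w q d E K', OF wper q0(1) d(1,2) M large] by blast
    have "\<bar>E1 - E\<bar> \<le> \<delta>" "\<bar>E1\<bar> \<le> \<bar>E\<bar> + 1" using E1(1) d by linarith+
    then show "\<exists>E'. \<bar>E'\<bar> \<le> \<bar>E\<bar> + 1 \<and> trace (window (energies V \<theta> (of_int p / real q) E') 0 q) = 0 \<and>
       (\<forall>j n. n \<le> q \<longrightarrow> norm (window (energies V \<theta> (of_int p / real q) E') j n)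
         \<le> exp (K + \<gamma> * real q))"
    proof (intro exI[of _ E1] conjI allI impI)
      show "trace (window (energies V \<theta> (of_int p / real q) E1) 0 q) = 0"
        using E1(2) by (simp add: discriminant_def w_def)
    qed (use K[OF q0(2) pq close] in auto)
  qed
qed

lemma tame_approximants_mono: "tame_approximants V \<alpha> \<theta> c \<gamma> \<Longrightarrow> c \<le> c' \<Longrightarrow> tame_approximants V \<alpha> \<theta> c' \<gamma>"
  unfolding tame_approximants_def by (meson order_trans)

theorem theorem3:
  fixes V :: "real \<Rightarrow> real" and \<alpha> \<theta> :: real
  assumes "lipschitz_on_circle V"
    and "\<alpha> \<notin> \<rat>"
  shows "(zero_lyapunov_set V \<alpha> \<noteq> {} \<and> cf_beta \<alpha> > 0 \<longrightarrow> quasiballistic (schroedinger V \<alpha> \<theta>))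
    \<and> (zero_lyapunov_set V \<alpha> = {} \<and> cf_beta \<alpha> = \<infinity> \<longrightarrow> quasiballistic (schroedinger V \<alpha> \<theta>))"
proof (intro conjI impI)
  obtain \<Lambda> where per: "\<And>x. V (x + 1) = V x" and lip: "\<Lambda>-lipschitz_on UNIV V"
    using assms(1) unfolding lipschitz_on_circle_def by blast
  obtain b where b: "\<And>x. \<bar>V x\<bar> \<le> b" using lipschitz_on_circle_bounded[OF assms(1)] by blast
  have b0: "0 \<le> b" using order_trans[OF abs_ge_zero b[of 0]] .
  {
    assume *: "zero_lyapunov_set V \<alpha> \<noteq> {} \<and> cf_beta \<alpha> > 0"
    then obtain E where E: "lyapunov V \<alpha> E = 0" unfolding zero_lyapunov_set_def by blast
    obtain \<kappa> where \<kappa>: "0 < ereal \<kappa>" "ereal \<kappa> < cf_beta \<alpha>" using * ereal_dense2[of 0 "cf_beta \<alpha>"] by blast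
    show "quasiballistic (schroedinger V \<alpha> \<theta>)"
    proof (rule quasiballistic_if_frequently_large[OF assms(1)])
      fix p s :: real assume ps: "0 < p" "0 < s" "s \<le> 1 / 8"
      have \<gamma>: "0 < s * \<kappa> / 4" using ps \<kappa> by simp
      have h: "\<bar>V x\<bar> + 2 \<le> b + 2 + \<bar>E\<bar>" for x using b[of x] by linarith
      have "tame_approximants V \<alpha> \<theta> (\<bar>E\<bar> + 1) (s * \<kappa> / 4)"
        by (rule tame_approximants_subexponential[where V = V and \<Lambda> = \<Lambda> and b = b, OF per lip b E \<gamma>])
      then have tame: "tame_approximants V \<alpha> \<theta> (b + 2 + \<bar>E\<bar> + 1) (s * \<kappa> / 4)"
        by (rule tame_approximants_mono) (use b0 in simp)
      show "\<exists>c>0. \<exists>\<^sub>F T in at_top. c * T powr p * T powr (- s * (2 * p + 9)) \<le> position_moment (schroedinger V \<alpha> \<theta>) p T"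
        by (rule frequently_large_moment[where V = V, OF assms(1) h assms(2) tame \<gamma> ps \<kappa>(2)]) simp
    qed
  next
    assume *: "zero_lyapunov_set V \<alpha> = {} \<and> cf_beta \<alpha> = \<infinity>"
    show "quasiballistic (schroedinger V \<alpha> \<theta>)"
    proof (rule quasiballistic_if_frequently_large[OF assms(1)])
      fix p s :: real assume ps: "0 < p" "0 < s" "s \<le> 1 / 8"
      define \<gamma> where "\<gamma> = ln (2 * b + 5)"
      have \<gamma>: "0 < \<gamma>" using b0 by (simp add: \<gamma>_def)
      have h: "\<bar>V x\<bar> + 2 \<le> b + 2" for x using b[of x] by linarith
      have "tame_approximants V \<alpha> \<theta> (b + 3) \<gamma>"
        unfolding \<gamma>_def by (rule tame_approximants_crude[where V = V and b = b, OF per b])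
      then have tame: "tame_approximants V \<alpha> \<theta> (b + 2 + 1) \<gamma>" by (rule tame_approximants_mono) simp
      show "\<exists>c>0. \<exists>\<^sub>F T in at_top. c * T powr p * T powr (- s * (2 * p + 9)) \<le> position_moment (schroedinger V \<alpha> \<theta>) p T"
        by (rule frequently_large_moment[where V = V, OF assms(1) h assms(2) tame \<gamma> ps, where \<kappa> = "4 * \<gamma> / s"]) (use * ps in auto)
    qed
  }
qed

end
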